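(* Let $m\in\{1,2,4,8\}$ and let $V$ be the representation of dimension $n=6m+8$ of the corresponding Lie algebra $\mathfrak g$ in the $e_7$ series. Then $$\check R(u)=P_1+\frac{2+u}{2-u}P_2+\frac{2+u}{2-u}\,\frac{m+2+u}{m+2-u}P_3+\frac{2+u}{2-u}\,\frac{m+2+u}{m+2-u}\,\frac{2m+2+u}{2m+2-u}P_4\in\mathrm{End}(V\otimes V)$$ satisfies the Yang–Baxter equation $$(\check R(u)\otimes 1)(1\otimes\check R(u+v))(\check R(v)\otimes 1)=(1\otimes\check R(v))(\check R(u+v)\otimes 1)(1\otimes\check R(u))$$ in $\mathrm{End}(V\otimes V\otimes V)$, as an identity of rational functions of $u,v$.
   Context: Work over $\mathbb{C}$. The $e_7$ series consists of the following pairs $(\mathfrak g,V)$ with $\dim V=n=6m+8$: $m=1$: $\mathfrak g=c_3$, $V$ the $14$-dimensional third fundamental representation (the traceless part of $\Lambda^3\mathbb{C}^6$); $m=2$: $\mathfrak g=a_5$, $V=\Lambda^3\mathbb{C}^6$; $m=4$: $\mathfrak g=d_6$, $V$ a $32$-dimensional half-spin representation; $m=8$: $\mathfrak g=e_7$, $V$ the $56$-dimensional irreducible representation. In each case $V$ carries a $\mathfrak g$-invariant symplectic form, and $V\otimes V=W_1\oplus W_2\oplus W_3\oplus W_4$ as a $\mathfrak g$-module with irreducible, pairwise non-isomorphic summands: $\mathrm{Sym}^2V=W_1\oplus W_3$, where $W_1$ has highest weight twice that of $V$ and $W_3\cong\mathfrak g$ is the adjoint representation; $\Lambda^2V=W_2\oplus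 W_4$, where $W_4\cong\mathbb{C}$ is the trivial representation (spanned by the invariant symplectic bivector) and $W_2$ is its invariant complement. $P_i$ denotes the $\mathfrak g$-equivariant projector of $V\otimes V$ onto $W_i$. *)

theory Defs
  imports "HOL-Analysis.Analysis" "HOL-Computational_Algebra.Fraction_Field"
begin

section \<open>Complex Lie algebras and their representations\<close>

text \<open>
  A finite-dimensional complex Lie algebra is given in coordinates, as a bracket on \<open>complex ^ 'g\<close>,
  and a representation on \<open>complex ^ 'n\<close> by matrices. The scalar multiplication is \<open>*s\<close>, so
  linearity is over the complex numbers.
\<close>

definition lie_algebra :: "(complex ^ 'g \<Rightarrow> complex ^ 'g \<Rightarrow> complex ^ 'g) \<Rightarrow> bool" where
  "lie_algebra br \<longleftrightarrow>
     (\<forall>x. Vector_Spaces.linear (*s) (*s) (br x)) \<and>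
     (\<forall>y. Vector_Spaces.linear (*s) (*s) (\<lambda>x. br x y)) \<and>
     (\<forall>x. br x x = 0) \<and>
     (\<forall>x y z. br x (br y z) + br y (br z x) + br z (br x y) = 0)"

definition lie_generated_by ::
    "(complex ^ 'g \<Rightarrow> complex ^ 'g \<Rightarrow> complex ^ 'g) \<Rightarrow> (complex ^ 'g) set \<Rightarrow> bool" where
  "lie_generated_by br X \<longleftrightarrow>
     (\<forall>S. vec.subspace S \<and> (\<forall>x\<in>S. \<forall>y\<in>S. br x y \<in> S) \<and> X \<subseteq> S \<longrightarrow> S = UNIV)"

definition lie_representation ::
    "(complex ^ 'g \<Rightarrow> complex ^ 'g \<Rightarrow> complex ^ 'g) \<Rightarrow>
     (complex ^ 'g \<Rightarrow> complex ^ 'n ^ 'n) \<Rightarrow> bool" where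
  "lie_representation br \<rho> \<longleftrightarrow>
     (\<forall>x y. \<rho> (x + y) = \<rho> x + \<rho> y) \<and>
     (\<forall>c x. \<rho> (c *s x) = mat c ** \<rho> x) \<and>
     (\<forall>x y. \<rho> (br x y) = \<rho> x ** \<rho> y - \<rho> y ** \<rho> x)"

definition adjoint_rep ::
    "(complex ^ 'g \<Rightarrow> complex ^ 'g \<Rightarrow> complex ^ 'g) \<Rightarrow> complex ^ 'g \<Rightarrow> complex ^ 'g ^ 'g" where
  "adjoint_rep br x = matrix (br x)"

definition lie_submodule ::
    "(complex ^ 'g \<Rightarrow> complex ^ 'n ^ 'n) \<Rightarrow> (complex ^ 'n) set \<Rightarrow> bool" where
  "lie_submodule \<rho> W \<longleftrightarrow> vec.subspace W \<and> (\<forall>x. \<forall>w\<in>W. \<rho> x *v w \<in> W)"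

definition irreducible_submodule ::
    "(complex ^ 'g \<Rightarrow> complex ^ 'n ^ 'n) \<Rightarrow> (complex ^ 'n) set \<Rightarrow> bool" where
  "irreducible_submodule \<rho> W \<longleftrightarrow>
     lie_submodule \<rho> W \<and> W \<noteq> {0} \<and>
     (\<forall>U. lie_submodule \<rho> U \<and> U \<subseteq> W \<longrightarrow> U = {0} \<or> U = W)"

text \<open>
  Isomorphism of a submodule \<open>W\<close> of \<open>\<rho>\<close> with a submodule \<open>U\<close> of \<open>\<sigma>\<close>. Every linear map on \<open>W\<close>
  extends to the ambient space, so it is enough to consider restrictions of matrices.
\<close>

definition isomorphic_submodules ::
    "(complex ^ 'g \<Rightarrow> complex ^ 'n ^ 'n) \<Rightarrow> (complex ^ 'n) set \<Rightarrow>
     (complex ^ 'g \<Rightarrow> complex ^ 'p ^ 'p) \<Rightarrow> (complex ^ 'p) set \<Rightarrow> bool" where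
  "isomorphic_submodules \<rho> W \<sigma> U \<longleftrightarrow>
     (\<exists>F :: complex ^ 'n ^ 'p. bij_betw ((*v) F) W U \<and>
        (\<forall>x. \<forall>w\<in>W. F *v (\<rho> x *v w) = \<sigma> x *v (F *v w)))"

definition internal_direct_sum ::
    "(complex ^ 'n) set \<Rightarrow> (complex ^ 'n) set \<Rightarrow> (complex ^ 'n) set \<Rightarrow> bool" where
  "internal_direct_sum U W S \<longleftrightarrow> S = {a + b |a b. a \<in> U \<and> b \<in> W} \<and> U \<inter> W = {0}"


section \<open>Simple Lie algebras by type\<close>

datatype lie_type = C3 | A5 | D6 | E7

fun lie_rank :: "lie_type \<Rightarrow> nat" where
  "lie_rank C3 = 3"
| "lie_rank A5 = 5"
| "lie_rank D6 = 6"
| "lie_rank E7 = 7"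

text \<open>
  The nodes of the Dynkin diagrams are numbered from 1 as in Bourbaki. In type \<open>C3\<close> the long simple
  root is \<open>\<alpha>\<^sub>3\<close>.
\<close>

fun dynkin_edges :: "lie_type \<Rightarrow> nat set set" where
  "dynkin_edges C3 = {{1, 2}, {2, 3}}"
| "dynkin_edges A5 = {{1, 2}, {2, 3}, {3, 4}, {4, 5}}"
| "dynkin_edges D6 = {{1, 2}, {2, 3}, {3, 4}, {4, 5}, {4, 6}}"
| "dynkin_edges E7 = {{1, 3}, {3, 4}, {4, 5}, {5, 6}, {6, 7}, {2, 4}}"

text \<open>
  \<open>cartan_entry X i j\<close> is \<open>\<alpha>\<^sub>j(h\<^sub>i) = 2(\<alpha>\<^sub>i, \<alpha>\<^sub>j) / (\<alpha>\<^sub>i, \<alpha>\<^sub>i)\<close>; the entry \<open>-2\<close> of \<open>C3\<close> is thus in the row of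
  the short root \<open>\<alpha>\<^sub>2\<close> and the column of the long root \<open>\<alpha>\<^sub>3\<close>.
\<close>

definition cartan_entry :: "lie_type \<Rightarrow> nat \<Rightarrow> nat \<Rightarrow> int" where
  "cartan_entry X i j =
     (if i = j then 2
      else if X = C3 \<and> i = 2 \<and> j = 3 then -2
      else if {i, j} \<in> dynkin_edges X then -1
      else 0)"

text \<open>
  The elements \<open>e\<^sub>i, f\<^sub>i, h\<^sub>i\<close> generate the Lie algebra and satisfy the Chevalley--Serre relations of
  the given type. By Serre's theorem a Lie algebra presented by these generators and relations is
  the simple Lie algebra of that type; as \<open>complex ^ 'g\<close> is nonzero, it has no smaller quotient of
  this form, and so the predicate says that the bracket is simple of type \<open>X\<close> with Chevalley
  generators \<open>e\<^sub>i, f\<^sub>i, h\<^sub>i\<close>.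
\<close>

definition chevalley_generators ::
    "lie_type \<Rightarrow> (complex ^ 'g \<Rightarrow> complex ^ 'g \<Rightarrow> complex ^ 'g) \<Rightarrow>
     (nat \<Rightarrow> complex ^ 'g) \<Rightarrow> (nat \<Rightarrow> complex ^ 'g) \<Rightarrow> (nat \<Rightarrow> complex ^ 'g) \<Rightarrow> bool" where
  "chevalley_generators X br e f h \<longleftrightarrow>
     (let I = {1..lie_rank X}; a = cartan_entry X in
       lie_generated_by br (e ` I \<union> f ` I \<union> h ` I) \<and>
       (\<forall>i\<in>I. \<forall>j\<in>I.
          br (h i) (h j) = 0 \<and>
          br (e i) (f j) = (if i = j then h i else 0) \<and>
          br (h i) (e j) = of_int (a i j) *s e j \<and>
          br (h i) (f j) = of_int (- a i j) *s f j \<and>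
          (i \<noteq> j \<longrightarrow> (br (e i) ^^ nat (1 - a i j)) (e j) = 0) \<and>
          (i \<noteq> j \<longrightarrow> (br (f i) ^^ nat (1 - a i j)) (f j) = 0)))"

text \<open>
  A vector of weight \<open>\<mu>\<close> annihilated by all \<open>e\<^sub>i\<close>. The predicate is only used for irreducible \<open>W\<close>,
  where it says that \<open>W\<close> is the irreducible module of highest weight \<open>\<mu>\<close>. Weights are given by
  their values \<open>\<mu>(h\<^sub>i)\<close>.
\<close>

definition has_highest_weight ::
    "lie_type \<Rightarrow> (nat \<Rightarrow> complex ^ 'g) \<Rightarrow> (nat \<Rightarrow> complex ^ 'g) \<Rightarrow>
     (complex ^ 'g \<Rightarrow> complex ^ 'n ^ 'n) \<Rightarrow> (complex ^ 'n) set \<Rightarrow> (nat \<Rightarrow> nat) \<Rightarrow> bool" where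
  "has_highest_weight X e h \<rho> W \<mu> \<longleftrightarrow>
     (\<exists>w\<in>W. w \<noteq> 0 \<and>
        (\<forall>i\<in>{1..lie_rank X}. \<rho> (e i) *v w = 0 \<and> \<rho> (h i) *v w = of_nat (\<mu> i) *s w))"

definition fundamental_weight :: "nat \<Rightarrow> nat \<Rightarrow> nat" where
  "fundamental_weight k i = (if i = k then 1 else 0)"


section \<open>The $e_7$ series\<close>

text \<open>
  Triples \<open>(m, X, k)\<close>, where \<open>X\<close> is the type of the Lie algebra and \<open>V\<close> is its fundamental
  representation of highest weight \<open>\<omega>\<^sub>k\<close>: the traceless part of the third exterior power of the
  6-dimensional representation of \<open>C3\<close> (dimension 14), the third exterior power of the
  6-dimensional representation of \<open>A5\<close> (20), the two half-spin representations of \<open>D6\<close> (32), and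
  the representation of \<open>E7\<close> of dimension 56.
\<close>

definition e7_series :: "(nat \<times> lie_type \<times> nat) set" where
  "e7_series = {(1, C3, 3), (2, A5, 3), (4, D6, 5), (4, D6, 6), (8, E7, 7)}"

definition e7_series_module ::
    "nat \<Rightarrow> lie_type \<Rightarrow> nat \<Rightarrow> (complex ^ 'g \<Rightarrow> complex ^ 'g \<Rightarrow> complex ^ 'g) \<Rightarrow>
     (nat \<Rightarrow> complex ^ 'g) \<Rightarrow> (nat \<Rightarrow> complex ^ 'g) \<Rightarrow> (nat \<Rightarrow> complex ^ 'g) \<Rightarrow>
     (complex ^ 'g \<Rightarrow> complex ^ 'n ^ 'n) \<Rightarrow> bool" where
  "e7_series_module m X k br e f h \<rho> \<longleftrightarrow>
     (m, X, k) \<in> e7_series \<and>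
     lie_algebra br \<and> chevalley_generators X br e f h \<and>
     lie_representation br \<rho> \<and> irreducible_submodule \<rho> UNIV \<and>
     has_highest_weight X e h \<rho> UNIV (fundamental_weight k) \<and>
     CARD('n) = 6 * m + 8"


section \<open>Tensor squares and the decomposition of \<open>V \<otimes> V\<close>\<close>

text \<open>
  With \<open>V = complex ^ 'n\<close>, the spaces \<open>V \<otimes> V\<close> and \<open>V \<otimes> V \<otimes> V\<close> are \<open>complex ^ ('n \<times> 'n)\<close> and
  \<open>complex ^ ('n \<times> 'n \<times> 'n)\<close>, in the basis of tensors of unit vectors. The tensor product of two
  linear maps is the Kronecker product of their matrices.
\<close>

definition kron ::
    "'a::semiring_1 ^ 'c::finite ^ 'a1::finite \<Rightarrow>
     'a ^ 'd::finite ^ 'b1::finite \<Rightarrow>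
     'a ^ ('c \<times> 'd) ^ ('a1 \<times> 'b1)" where
  "kron A B = (\<chi> p q. A $ fst p $ fst q * B $ snd p $ snd q)"

definition tensor_square ::
    "(complex ^ 'g \<Rightarrow> complex ^ 'n ^ 'n) \<Rightarrow> complex ^ 'g \<Rightarrow> complex ^ ('n \<times> 'n) ^ ('n \<times> 'n)" where
  "tensor_square \<rho> x = kron (\<rho> x) (mat 1) + kron (mat 1) (\<rho> x)"

definition sym2 :: "(complex ^ ('n::finite \<times> 'n)) set" where
  "sym2 = {t. \<forall>i j. t $ (i, j) = t $ (j, i)}"

definition alt2 :: "(complex ^ ('n::finite \<times> 'n)) set" where
  "alt2 = {t. \<forall>i j. t $ (i, j) = - t $ (j, i)}"

text \<open>
  \<open>W 1, ..., W 4\<close> are the four irreducible summands of \<open>V \<otimes> V\<close>, for \<open>V\<close> of highest weight \<open>\<omega>\<^sub>k\<close>.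
\<close>

definition e7_decomposition ::
    "lie_type \<Rightarrow> nat \<Rightarrow> (complex ^ 'g \<Rightarrow> complex ^ 'g \<Rightarrow> complex ^ 'g) \<Rightarrow>
     (nat \<Rightarrow> complex ^ 'g) \<Rightarrow> (nat \<Rightarrow> complex ^ 'g) \<Rightarrow>
     (complex ^ 'g \<Rightarrow> complex ^ 'n ^ 'n) \<Rightarrow> (nat \<Rightarrow> (complex ^ ('n \<times> 'n)) set) \<Rightarrow> bool" where
  "e7_decomposition X k br e h \<rho> W \<longleftrightarrow>
     (let \<tau> = tensor_square \<rho> in
       (\<forall>i\<in>{1..4}. irreducible_submodule \<tau> (W i)) \<and>
       (\<forall>i\<in>{1..4}. \<forall>j\<in>{1..4}. i \<noteq> j \<longrightarrow> \<not> isomorphic_submodules \<tau> (W i) \<tau> (W j)) \<and>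
       internal_direct_sum (W 1) (W 3) sym2 \<and>
       internal_direct_sum (W 2) (W 4) alt2 \<and>
       has_highest_weight X e h \<tau> (W 1) (\<lambda>i. 2 * fundamental_weight k i) \<and>
       isomorphic_submodules \<tau> (W 3) (adjoint_rep br) UNIV \<and>
       vec.dim (W 4) = 1 \<and> (\<forall>x. \<forall>w\<in>W 4. \<tau> x *v w = 0))"

text \<open>
  As the summands of \<open>V \<otimes> V\<close> are pairwise non-isomorphic and irreducible, the equivariant projector
  onto \<open>W i\<close> is unique; its kernel is the sum of the other summands.
\<close>

definition equivariant_projector ::
    "(complex ^ 'g \<Rightarrow> complex ^ 'n ^ 'n) \<Rightarrow> (complex ^ 'n) set \<Rightarrow> complex ^ 'n ^ 'n \<Rightarrow> bool" where
  "equivariant_projector \<rho> W P \<longleftrightarrow>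
     P ** P = P \<and> range ((*v) P) = W \<and> (\<forall>x. P ** \<rho> x = \<rho> x ** P)"


section \<open>The Yang--Baxter equation over the field of rational functions\<close>

text \<open>
  The field of rational functions in two variables \<open>u\<close>, \<open>v\<close> with complex coefficients: fractions of
  polynomials in \<open>u\<close> whose coefficients are polynomials in \<open>v\<close>.
\<close>

type_synonym ratfun = "complex poly poly fract"

definition const_rf :: "complex \<Rightarrow> ratfun" where
  "const_rf c = Fract [:[:c:]:] 1"

definition u_rf :: ratfun where
  "u_rf = Fract [:0, 1:] 1"

definition v_rf :: ratfun where
  "v_rf = Fract [:[:0, 1:]:] 1"

definition R_check ::
    "nat \<Rightarrow> (nat \<Rightarrow> complex ^ 'i ^ 'i) \<Rightarrow> ratfun \<Rightarrow> ratfun ^ 'i ^ 'i" where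
  "R_check m P x =
     (let Q = (\<lambda>i. map_matrix const_rf (P i));
          a = (2 + x) / (2 - x);
          b = (of_nat m + 2 + x) / (of_nat m + 2 - x);
          c = (2 * of_nat m + 2 + x) / (2 * of_nat m + 2 - x)
      in Q 1 + mat a ** Q 2 + mat (a * b) ** Q 3 + mat (a * b * c) ** Q 4)"

text \<open>
  \<open>R \<otimes> 1\<close> and \<open>1 \<otimes> R\<close> on the triple tensor product. Since \<open>'n \<times> 'n \<times> 'n\<close> is \<open>'n \<times> ('n \<times> 'n)\<close>, the
  former needs a reindexing by the associator.
\<close>

definition assoc_index :: "'n \<times> 'n \<times> 'n \<Rightarrow> ('n \<times> 'n) \<times> 'n" where
  "assoc_index = (\<lambda>(i, j, k). ((i, j), k))"

definition tensor_one ::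
    "'a::semiring_1 ^ ('n::finite \<times> 'n) ^ ('n \<times> 'n) \<Rightarrow> 'a ^ ('n \<times> 'n \<times> 'n) ^ ('n \<times> 'n \<times> 'n)" where
  "tensor_one R =
     (\<chi> p q. kron R (mat 1 :: 'a ^ 'n ^ 'n) $ assoc_index p $ assoc_index q)"

definition one_tensor ::
    "'a::semiring_1 ^ ('n::finite \<times> 'n) ^ ('n \<times> 'n) \<Rightarrow> 'a ^ ('n \<times> 'n \<times> 'n) ^ ('n \<times> 'n \<times> 'n)" where
  "one_tensor R = kron (mat 1 :: 'a ^ 'n ^ 'n) R"

end

theory Submission
  imports Defs "HOL-Computational_Algebra.Fundamental_Theorem_Algebra"
begin

text \<open>
  Each \<open>R\<close> intertwines operators \<open>z1 x\<^sub>1 + z2 x\<^sub>2 + z3 x\<^sub>3\<close> plus a correction built from the split Casimir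
  operator \<open>C\<close> (the evaluation modules of the Yangian), so both sides of the Yang--Baxter equation
  intertwine the same two actions on \<open>V \<otimes> V \<otimes> V\<close>. At leading order in the spectral parameters such an
  intertwiner is a multiple of the reversal of the factors, because \<open>V\<close> is irreducible. The adjoint with respect
  to the invariant symplectic form exchanges the two sides and fixes the reversal, hence their difference
  has no leading term and vanishes.

  The intertwining property of \<open>R\<close> only depends on the differences of the eigenvalues of \<open>C\<close> on the four
  summands. These are determined by \<open>n\<close> alone, without the root system: the traces of \<open>C\<close>, of its
  square and of its product with the flip, and one cubic contraction give polynomial equations for \<open>dim g\<close>; besides
  the actual value their roots are negative or the dimension of the full symplectic algebra, for which \<open>W 1\<close> is zero.
\<close>

section \<open>Matrix algebra\<close>

text \<open>The pole positions 2, m + 2 and 2 m + 2 are m + 4 times the gaps between the eigenvalues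
  of \<open>C\<close> on consecutive summands; this is the origin of the factor m + 4 in every
  correction term. The intertwining property rests on a selection rule: x acting on a single factor
  of \<open>V \<otimes> V\<close> links only neighbours in the chain 1 - 2 - 3 - 4. Summands of
  equal symmetry are not linked because of the flip, and 1 and 4 are not linked because x moves the
  symplectic bivector into \<open>W 3\<close>. What remains is one condition per edge of a path, and
  such conditions are met independently by the ratios of consecutive coefficients.

  On the triple product no irreducibility is at hand for the operators including their correction.
  Scaling the parameters by an indeterminate separates degrees: the correction has degree 0 and
  drops out of the relation for the top coefficient. The entries then lie in a field of rational
  functions, which is not algebraically closed, so Schur's lemma is carried over to it from the
  complex numbers.\<close>

definition scm :: "'a::comm_semiring_1 \<Rightarrow> 'a ^ 'n ^ 'm \<Rightarrow> 'a ^ 'n ^ 'm" (infixr \<open>*m\<close> 75) where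
  "c *m A = (\<chi> i j. c * A $ i $ j)"

lemma scm_nth [simp]: "(c *m A) $ i $ j = c * A $ i $ j"
  by (simp add: scm_def)

lemma mat_mult_scm: "mat c ** A = c *m A"
  by (simp add: vec_eq_iff matrix_matrix_mult_def mat_def if_distrib [where f = "\<lambda>x. x * _"] sum.delta cong: if_cong)

lemma mult_mat_scm: "A ** mat c = c *m A"
  by (simp add: vec_eq_iff matrix_matrix_mult_def mat_def if_distrib [where f = "\<lambda>x. _ * x"] sum.delta
      mult.commute cong: if_cong)

lemma scm_mat: "c *m mat d = mat (c * d)"
  by (simp add: vec_eq_iff mat_def)

lemma scm_mult_left: "(c *m A) ** B = c *m (A ** B)"
  by (simp add: vec_eq_iff matrix_matrix_mult_def sum_distrib_left mult.assoc)

lemma scm_mult_right: "A ** (c *m B) = c *m (A ** B)"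
  by (simp add: vec_eq_iff matrix_matrix_mult_def sum_distrib_left mult.left_commute)

lemma scm_scm: "c *m d *m A = (c * d) *m A"
  by (simp add: vec_eq_iff mult.assoc)

lemma scm_one [simp]: "1 *m A = A"
  by (simp add: vec_eq_iff)

lemma scm_zero [simp]: "c *m 0 = 0" "0 *m A = 0"
  by (simp_all add: vec_eq_iff)

lemma scm_add: "c *m (A + B) = c *m A + c *m B"
  by (simp add: vec_eq_iff algebra_simps)

lemma scm_minus: "c *m (- A) = - (c *m (A :: 'a::comm_ring_1 ^ 'n ^ 'm))"
  by (simp add: vec_eq_iff)

lemma scm_sum: "c *m (\<Sum>i\<in>I. A i) = (\<Sum>i\<in>I. c *m A i)"
  by (simp add: vec_eq_iff sum_distrib_left)

lemma scm_vector_mult: "(c *m A) *v w = c *s (A *v w)"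
  by (simp add: vec_eq_iff matrix_vector_mult_def sum_distrib_left mult.assoc)

lemma transpose_scm: "transpose (c *m A) = c *m transpose A"
  by (simp add: vec_eq_iff transpose_def)

lemma trace_scm: "trace (c *m A) = c * trace A"
  by (simp add: trace_def sum_distrib_left)

lemma scm_cancel: "c *m A = c *m B \<Longrightarrow> c \<noteq> 0 \<Longrightarrow> A = B"
  for c :: "'a::idom"
  by (simp add: vec_eq_iff)

lemma matrix_add_rdistrib: "(A + B) ** C = A ** C + B ** C"
  by (simp add: vec_eq_iff matrix_matrix_mult_def algebra_simps sum.distrib)

lemma matrix_diff_ldistrib: "A ** (B - C) = A ** B - A ** (C :: 'a::ring_1 ^ 'n ^ 'm)"
  by (simp add: vec_eq_iff matrix_matrix_mult_def algebra_simps sum_subtractf)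

lemma matrix_diff_rdistrib: "(A - B) ** C = A ** C - B ** (C :: 'a::ring_1 ^ 'n ^ 'm)"
  by (simp add: vec_eq_iff matrix_matrix_mult_def algebra_simps sum_subtractf)

lemma matrix_minus_left: "(- A) ** B = - (A ** (B :: 'a::ring_1 ^ 'n ^ 'm))"
  by (simp add: vec_eq_iff matrix_matrix_mult_def sum_negf)

lemma matrix_minus_right: "A ** (- B) = - (A ** (B :: 'a::ring_1 ^ 'n ^ 'm))"
  by (simp add: vec_eq_iff matrix_matrix_mult_def sum_negf)

lemma matrix_sum_left: "(\<Sum>i\<in>I. A i) ** B = (\<Sum>i\<in>I. A i ** B)"
  by (induction I rule: infinite_finite_induct) (simp_all add: matrix_add_rdistrib)

lemma matrix_sum_right: "B ** (\<Sum>i\<in>I. A i) = (\<Sum>i\<in>I. B ** A i)"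
  by (induction I rule: infinite_finite_induct) (simp_all add: matrix_add_ldistrib)

lemma matrix_vector_sum_left: "(\<Sum>i\<in>I. A i) *v w = (\<Sum>i\<in>I. A i *v w)"
  by (induction I rule: infinite_finite_induct) (simp_all add: matrix_vector_mult_add_rdistrib)

lemma matrix_vector_minus: "A *v (- w) = - (A *v (w :: 'a::comm_ring_1 ^ 'n))"
  by (simp add: vec_eq_iff matrix_vector_mult_def sum_negf)

lemma matrix_vector_scale: "A *v (c *s w) = c *s (A *v (w :: 'a::comm_ring_1 ^ 'n))"
  by (simp add: vec_eq_iff matrix_vector_mult_def sum_distrib_left mult.left_commute)

lemma transpose_add: "transpose (A + B) = transpose A + transpose B"
  by (simp add: vec_eq_iff transpose_def)

lemma transpose_diff: "transpose (A - B) = transpose A - transpose B"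
  by (simp add: vec_eq_iff transpose_def)

lemma transpose_sum: "transpose (\<Sum>i\<in>I. A i) = (\<Sum>i\<in>I. transpose (A i))"
  by (simp add: vec_eq_iff transpose_def)

lemma trace_sum: "trace (\<Sum>i\<in>I. A i) = (\<Sum>i\<in>I. trace (A i :: 'a::comm_semiring_1 ^ 'n ^ 'n))"
  by (induction I rule: infinite_finite_induct) (simp_all add: trace_add, simp_all add: trace_def)

lemma trace_minus: "trace (- A) = - trace (A :: 'a::comm_ring_1 ^ 'n ^ 'n)"
  by (simp add: trace_def sum_negf)

lemmas matrix_ring_simps =
  matrix_add_ldistrib matrix_add_rdistrib matrix_diff_ldistrib matrix_diff_rdistrib
  matrix_minus_left matrix_minus_right scm_mult_left scm_mult_right

lemma matrix_eq_zero_vector: "A = 0 \<longleftrightarrow> (\<forall>w. A *v w = (0 :: 'a::semiring_1 ^ 'm))"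
  by (simp add: matrix_eq)


section \<open>Kronecker products\<close>

lemma kron_nth [simp]: "kron A B $ (i, j) $ (k, l) = A $ i $ k * B $ j $ l"
  by (simp add: kron_def)

lemma kron_mult: "kron A B ** kron C D = kron (A ** C) (B ** (D :: 'a::comm_semiring_1 ^ _ ^ _))"
  by (simp add: vec_eq_iff matrix_matrix_mult_def sum_product UNIV_Times_UNIV [symmetric]
      sum.cartesian_product kron_def case_prod_beta mult_ac del: UNIV_Times_UNIV)

lemma kron_add_left: "kron (A + B) C = kron A C + kron B C"
  by (simp add: vec_eq_iff algebra_simps)

lemma kron_add_right: "kron A (B + C) = kron A B + kron A C"
  by (simp add: vec_eq_iff algebra_simps)

lemma kron_diff_left: "kron (A - B) C = kron A C - kron B (C :: 'a::ring_1 ^ _ ^ _)"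
  by (simp add: vec_eq_iff algebra_simps)

lemma kron_diff_right: "kron A (B - C) = kron A B - kron A (C :: 'a::ring_1 ^ _ ^ _)"
  by (simp add: vec_eq_iff algebra_simps)

lemma kron_minus_left: "kron (- A) B = - kron A (B :: 'a::ring_1 ^ _ ^ _)"
  by (simp add: vec_eq_iff)

lemma kron_minus_right: "kron A (- B) = - kron A (B :: 'a::ring_1 ^ _ ^ _)"
  by (simp add: vec_eq_iff)

lemma kron_scm_left: "kron (c *m A) B = c *m kron A B"
  by (simp add: vec_eq_iff mult.assoc)

lemma kron_scm_right: "kron A (c *m B) = c *m kron A B"
  by (simp add: vec_eq_iff mult.left_commute)

lemma kron_zero [simp]: "kron 0 A = 0" "kron A 0 = 0"
  by (simp_all add: vec_eq_iff)

lemma kron_sum_left: "kron (\<Sum>i\<in>I. A i) B = (\<Sum>i\<in>I. kron (A i) B)"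
  by (induction I rule: infinite_finite_induct) (simp_all add: kron_add_left)

lemma kron_sum_right: "kron B (\<Sum>i\<in>I. A i) = (\<Sum>i\<in>I. kron B (A i))"
  by (induction I rule: infinite_finite_induct) (simp_all add: kron_add_right)

lemma kron_mat_one [simp]: "kron (mat 1) (mat 1) = mat 1"
  by (simp add: vec_eq_iff mat_def)

lemma kron_transpose: "transpose (kron A B) = kron (transpose A) (transpose B)"
  by (simp add: vec_eq_iff transpose_def)

lemma trace_kron: "trace (kron A B) = trace A * trace (B :: 'a::comm_semiring_1 ^ 'n ^ 'n)"
  by (simp add: trace_def sum_product sum.cartesian_product kron_def case_prod_beta
      UNIV_Times_UNIV [symmetric] del: UNIV_Times_UNIV)

definition tensor_swap :: "'a::semiring_1 ^ ('n::finite \<times> 'n) ^ ('n \<times> 'n)" where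
  "tensor_swap = (\<chi> p q. if p = prod.swap q then 1 else 0)"

lemma tensor_swap_mult_nth: "(tensor_swap ** A) $ (i, j) = A $ (j, i)"
proof -
  have "(i, j) = prod.swap k \<longleftrightarrow> k = (j, i)" for k
    by (cases k) auto
  then show ?thesis
    by (simp add: vec_eq_iff matrix_matrix_mult_def tensor_swap_def
        if_distrib [where f = "\<lambda>x. x * _"] cong: if_cong)
qed

lemma tensor_swap_vector_nth: "(tensor_swap *v w) $ (i, j) = w $ (j, i)"
proof -
  have "(i, j) = prod.swap k \<longleftrightarrow> k = (j, i)" for k
    by (cases k) auto
  then show ?thesis
    by (simp add: matrix_vector_mult_def tensor_swap_def
        if_distrib [where f = "\<lambda>x. x * _"] cong: if_cong)
qed

lemma tensor_swap_nth: "tensor_swap $ (i, j) $ (k, l) = (if i = l \<and> j = k then 1 else 0)"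
  by (simp add: tensor_swap_def)

lemma tensor_swap_transpose: "transpose tensor_swap = tensor_swap"
  by (auto simp: vec_eq_iff transpose_def tensor_swap_nth)

lemma mult_tensor_swap_nth: "(A ** tensor_swap) $ p $ (i, j) = (A :: 'a::comm_semiring_1 ^ _ ^ _) $ p $ (j, i)"
proof -
  have "transpose (A ** tensor_swap) = tensor_swap ** transpose A"
    by (simp add: matrix_transpose_mul tensor_swap_transpose)
  from arg_cong [OF this, of "\<lambda>M. M $ (i, j) $ p"] show ?thesis
    by (simp add: tensor_swap_mult_nth) (simp add: transpose_def)
qed

lemma tensor_swap_kron:
  "tensor_swap ** kron A B = kron B A ** (tensor_swap :: 'a::comm_semiring_1 ^ _ ^ _)"
  by (simp add: vec_eq_iff tensor_swap_mult_nth mult_tensor_swap_nth mult.commute)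

text \<open>The flip turns a product of two traces into the trace of a product; thus the flip times
  \<open>casimir2\<close> has a trace made of pairings of dual bases.\<close>

lemma trace_tensor_swap_kron:
  "trace (tensor_swap ** kron A B) = trace (A ** (B :: 'a::comm_semiring_1 ^ 'n ^ 'n))"
proof -
  have "trace (tensor_swap ** kron A B) = (\<Sum>i\<in>UNIV. \<Sum>j\<in>UNIV. (tensor_swap ** kron A B) $ (i, j) $ (i, j))"
    by (simp only: trace_def UNIV_Times_UNIV [symmetric] sum.cartesian_product case_prod_unfold prod.collapse)
  also have "\<dots> = trace (A ** B)"
    by (subst sum.swap) (simp add: tensor_swap_mult_nth, simp add: trace_def matrix_matrix_mult_def)
  finally show ?thesis .
qed

lemma trace_tensor_swap:
  "trace (tensor_swap :: 'a::comm_semiring_1 ^ ('n::finite \<times> 'n) ^ ('n \<times> 'n)) = of_nat CARD('n)"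
  using trace_tensor_swap_kron [of "mat 1" "mat 1 :: 'a ^ 'n ^ 'n"] by (simp add: trace_I)


section \<open>The two embeddings into the triple tensor product\<close>

lemma matrix_mult_reindex:
  assumes "bij f"
  shows "(\<chi> p q. A $ f p $ f q) ** (\<chi> p q. B $ f p $ f q) = (\<chi> p q. (A ** B) $ f p $ f q)"
proof -
  have "(\<Sum>k\<in>UNIV. A $ f i $ f k * B $ f k $ f j) = (\<Sum>k\<in>UNIV. A $ f i $ k * B $ k $ f j)" for i j
    using sum.reindex_bij_betw [OF assms, of "\<lambda>k. A $ f i $ k * B $ k $ f j"] .
  then show ?thesis
    by (simp add: vec_eq_iff matrix_matrix_mult_def)
qed

lemma bij_assoc_index: "bij assoc_index"
  by (rule bij_betw_byWitness [where f' = "\<lambda>((i, j), k). (i, j, k)"])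
     (auto simp: assoc_index_def)

lemma tensor_one_nth [simp]:
  "tensor_one R $ (i, j, k) $ (i', j', k') = R $ (i, j) $ (i', j') * mat 1 $ k $ k'"
  by (simp add: tensor_one_def assoc_index_def)

lemma tensor_one_mult:
  "tensor_one (A ** B) = tensor_one A ** tensor_one (B :: 'a::comm_semiring_1 ^ _ ^ _)"
  unfolding tensor_one_def matrix_mult_reindex [OF bij_assoc_index] kron_mult by simp

lemma tensor_one_add: "tensor_one (A + B) = tensor_one A + tensor_one B"
  by (simp add: vec_eq_iff algebra_simps)

lemma tensor_one_scm: "tensor_one (c *m A) = c *m tensor_one A"
  by (simp add: vec_eq_iff mult.assoc)

lemma tensor_one_sum: "tensor_one (\<Sum>i\<in>I. A i) = (\<Sum>i\<in>I. tensor_one (A i))"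
  by (induction I rule: infinite_finite_induct) (simp_all add: tensor_one_add, simp_all add: vec_eq_iff)

lemma tensor_one_kron: "tensor_one (kron A B) = kron A (kron B (mat 1))"
  by (simp add: vec_eq_iff mult.assoc)

lemma tensor_one_transpose: "transpose (tensor_one A) = tensor_one (transpose A)"
  by (simp add: vec_eq_iff transpose_def mat_def)

lemma one_tensor_nth [simp]:
  "one_tensor R $ (i, j, k) $ (i', j', k') = mat 1 $ i $ i' * R $ (j, k) $ (j', k')"
  by (simp add: one_tensor_def)

lemma one_tensor_mult:
  "one_tensor (A ** B) = one_tensor A ** one_tensor (B :: 'a::comm_semiring_1 ^ _ ^ _)"
  by (simp add: one_tensor_def kron_mult)

lemma one_tensor_add: "one_tensor (A + B) = one_tensor A + one_tensor B"
  by (simp add: one_tensor_def kron_add_right)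

lemma one_tensor_scm: "one_tensor (c *m A) = c *m one_tensor A"
  by (simp add: one_tensor_def kron_scm_right)

lemma one_tensor_sum: "one_tensor (\<Sum>i\<in>I. A i) = (\<Sum>i\<in>I. one_tensor (A i))"
  by (simp add: one_tensor_def kron_sum_right)

lemma one_tensor_transpose: "transpose (one_tensor A) = one_tensor (transpose A)"
  by (simp add: one_tensor_def kron_transpose)

section \<open>Reversal of the three tensor factors\<close>

definition tensor_rev :: "'a::semiring_1 ^ ('n::finite \<times> 'n \<times> 'n) ^ ('n \<times> 'n \<times> 'n)" where
  "tensor_rev = (\<chi> p q. if fst p = snd (snd q) \<and> fst (snd p) = fst (snd q) \<and> snd (snd p) = fst q then 1 else 0)"

lemma tensor_rev_mult_nth: "(tensor_rev ** A) $ (i, j, k) = A $ (k, j, i)"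
proof -
  have "i = snd (snd q) \<and> j = fst (snd q) \<and> k = fst q \<longleftrightarrow> q = (k, j, i)" for q
    by (cases q) auto
  then show ?thesis
    by (simp add: vec_eq_iff matrix_matrix_mult_def tensor_rev_def
        if_distrib [where f = "\<lambda>x. x * _"] cong: if_cong)
qed

lemma tensor_rev_transpose: "transpose tensor_rev = tensor_rev"
  by (auto simp: vec_eq_iff transpose_def tensor_rev_def)

lemma tensor_rev_idem: "tensor_rev ** tensor_rev = mat 1"
  by (simp add: vec_eq_iff tensor_rev_mult_nth) (auto simp: tensor_rev_def mat_def)

lemma mult_tensor_rev_nth:
  "(A ** tensor_rev) $ p $ (i, j, k) = (A :: 'a::comm_semiring_1 ^ _ ^ _) $ p $ (k, j, i)"
proof -
  have "transpose (A ** tensor_rev) = tensor_rev ** transpose A"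
    by (simp add: matrix_transpose_mul tensor_rev_transpose)
  from arg_cong [OF this, of "\<lambda>M. M $ (i, j, k) $ p"] show ?thesis
    by (simp add: tensor_rev_mult_nth) (simp add: transpose_def)
qed

lemma tensor_rev_kron:
  "tensor_rev ** kron A (kron B C) = kron C (kron B A) ** (tensor_rev :: 'a::comm_semiring_1 ^ _ ^ _)"
  by (simp add: vec_eq_iff tensor_rev_mult_nth mult_tensor_rev_nth mult_ac)

text \<open>Reversal carries positions 1, 2 to positions 3, 2, so A arrives with its two factors
  exchanged; commuting with the flip undoes this exchange.\<close>

lemma tensor_rev_tensor_one:
  assumes "tensor_swap ** A = A ** (tensor_swap :: 'a::comm_semiring_1 ^ _ ^ _)"
  shows "tensor_rev ** tensor_one A = one_tensor A ** tensor_rev"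
proof -
  have "A $ (j, i) $ (i', j') = A $ (i, j) $ (j', i')" for i j i' j'
    using arg_cong [OF assms, of "\<lambda>M. M $ (i, j) $ (i', j')"]
    by (simp add: tensor_swap_mult_nth mult_tensor_swap_nth)
  then show ?thesis
    by (auto simp: vec_eq_iff tensor_rev_mult_nth mult_tensor_rev_nth mat_def)
qed

lemma tensor_rev_one_tensor:
  assumes "tensor_swap ** A = A ** (tensor_swap :: 'a::comm_semiring_1 ^ _ ^ _)"
  shows "tensor_rev ** one_tensor A = tensor_one A ** tensor_rev"
proof -
  have "tensor_rev ** one_tensor A = tensor_rev ** (one_tensor A ** tensor_rev) ** tensor_rev"
    by (simp add: matrix_mul_assoc [symmetric] tensor_rev_idem)
  also have "\<dots> = tensor_one A ** tensor_rev"
    by (simp add: tensor_rev_tensor_one [OF assms, symmetric] matrix_mul_assoc tensor_rev_idem)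
  finally show ?thesis .
qed


section \<open>Extension of scalars\<close>

text \<open>Instances below are the complex constants in the rational functions, the constant
  polynomials in an auxiliary indeterminate, the composite of such maps, and evaluation of that
  indeterminate at 1.\<close>

locale ring_hom =
  fixes \<kappa> :: "'a::comm_ring_1 \<Rightarrow> 'b::comm_ring_1"
  assumes hom_add: "\<kappa> (x + y) = \<kappa> x + \<kappa> y"
    and hom_mult: "\<kappa> (x * y) = \<kappa> x * \<kappa> y"
    and hom_one: "\<kappa> 1 = 1"
begin

lemma hom_zero: "\<kappa> 0 = 0"
  using hom_add [of 0 0] by simp

lemma hom_minus: "\<kappa> (- x) = - \<kappa> x"
  using hom_add [of x "- x"] by (simp add: hom_zero eq_neg_iff_add_eq_0 add.commute)

lemma hom_diff: "\<kappa> (x - y) = \<kappa> x - \<kappa> y"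
  using hom_add [of x "- y"] by (simp add: hom_minus)

lemma hom_sum: "\<kappa> (\<Sum>i\<in>I. f i) = (\<Sum>i\<in>I. \<kappa> (f i))"
  by (induction I rule: infinite_finite_induct) (simp_all add: hom_add hom_zero)

lemma hom_of_nat: "\<kappa> (of_nat n) = of_nat n"
  by (induction n) (simp_all add: hom_add hom_zero hom_one)

lemma hom_numeral: "\<kappa> (numeral n) = numeral n"
  using hom_of_nat [of "numeral n"] by simp

lemma map_matrix_mult: "map_matrix \<kappa> (A ** B) = map_matrix \<kappa> A ** map_matrix \<kappa> B"
  by (simp add: vec_eq_iff matrix_matrix_mult_def hom_sum hom_mult)

lemma map_matrix_add: "map_matrix \<kappa> (A + B) = map_matrix \<kappa> A + map_matrix \<kappa> B"
  by (simp add: vec_eq_iff hom_add)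

lemma map_matrix_diff: "map_matrix \<kappa> (A - B) = map_matrix \<kappa> A - map_matrix \<kappa> B"
  by (simp add: vec_eq_iff hom_diff)

lemma map_matrix_minus: "map_matrix \<kappa> (- A) = - map_matrix \<kappa> A"
  by (simp add: vec_eq_iff hom_minus)

lemma map_matrix_zero: "map_matrix \<kappa> 0 = 0"
  by (simp add: vec_eq_iff hom_zero)

lemma map_matrix_sum: "map_matrix \<kappa> (\<Sum>i\<in>I. A i) = (\<Sum>i\<in>I. map_matrix \<kappa> (A i))"
  by (induction I rule: infinite_finite_induct) (simp_all add: map_matrix_add map_matrix_zero)

lemma map_matrix_scm: "map_matrix \<kappa> (c *m A) = \<kappa> c *m map_matrix \<kappa> A"
  by (simp add: vec_eq_iff hom_mult)

lemma map_matrix_mat: "map_matrix \<kappa> (mat c) = mat (\<kappa> c)"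
  by (simp add: vec_eq_iff mat_def hom_zero)

lemma map_matrix_kron: "map_matrix \<kappa> (kron A B) = kron (map_matrix \<kappa> A) (map_matrix \<kappa> B)"
  by (simp add: vec_eq_iff hom_mult)

lemma map_matrix_transpose: "map_matrix \<kappa> (transpose A) = transpose (map_matrix \<kappa> A)"
  by (simp add: vec_eq_iff transpose_def)

lemma map_matrix_tensor_one: "map_matrix \<kappa> (tensor_one A) = tensor_one (map_matrix \<kappa> A)"
  by (simp add: vec_eq_iff hom_mult mat_def hom_zero hom_one)

lemma map_matrix_one_tensor: "map_matrix \<kappa> (one_tensor A) = one_tensor (map_matrix \<kappa> A)"
  by (simp add: vec_eq_iff hom_mult mat_def hom_zero hom_one)

lemma map_matrix_tensor_swap: "map_matrix \<kappa> tensor_swap = tensor_swap"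
  by (simp add: vec_eq_iff tensor_swap_def hom_zero hom_one)

end

section \<open>Eigenvectors and Schur's lemma\<close>

text \<open>The vector p(A) w, evaluated by Horner's rule on the coefficients of p.\<close>

definition poly_act :: "'a::comm_ring_1 ^ 'n ^ 'n \<Rightarrow> 'a ^ 'n \<Rightarrow> 'a poly \<Rightarrow> 'a ^ 'n" where
  "poly_act A w p = fold_coeffs (\<lambda>a y. a *s w + A *v y) p 0"

lemma poly_act_0 [simp]: "poly_act A w 0 = 0"
  by (simp add: poly_act_def)

lemma poly_act_pCons [simp]: "poly_act A w (pCons a p) = a *s w + A *v poly_act A w p"
  by (cases "a = 0 \<and> p = 0") (auto simp: poly_act_def)

lemma poly_act_add: "poly_act A w (p + q) = poly_act A w p + poly_act A w q"
  by (induction p q rule: poly_induct2)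
     (simp_all add: matrix_vector_right_distrib vector_sadd_rdistrib algebra_simps)

lemma poly_act_smult: "poly_act A w (smult c p) = c *s poly_act A w p"
  by (induction p) (simp_all add: matrix_vector_scale vector_add_ldistrib vector_smult_assoc)

lemma poly_act_diff: "poly_act A w (p - q) = poly_act A w p - poly_act A w q"
  using poly_act_add [of A w p "- q"] poly_act_smult [of A w "- 1" q]
  by (simp add: vector_sneg_minus1 [symmetric])

lemma poly_act_sum: "poly_act A w (\<Sum>i\<in>I. p i) = (\<Sum>i\<in>I. poly_act A w (p i))"
  by (induction I rule: infinite_finite_induct) (simp_all add: poly_act_add)

lemma poly_act_monom: "poly_act A w (monom c k) = c *s (((*v) A ^^ k) w)"
  by (induction k) (simp_all add: monom_0 monom_Suc matrix_vector_scale)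

lemma poly_act_in_subspace:
  fixes A :: "complex ^ 'n ^ 'n"
  assumes "vec.subspace W" "\<And>w. w \<in> W \<Longrightarrow> A *v w \<in> W" "w \<in> W"
  shows "poly_act A w p \<in> W"
  using assms by (induction p) (auto intro: vec.subspace_add vec.subspace_scale vec.subspace_0)

text \<open>The vectors w, A w, ..., up to the power \<open>CARD('n)\<close>, are one too many to be
  independent.\<close>

lemma poly_act_annihilator:
  fixes A :: "complex ^ 'n ^ 'n"
  shows "\<exists>p. p \<noteq> 0 \<and> poly_act A w p = 0"
\<comment> \<open>Dependence is a property of sets, so coinciding iterates would merge in the image
  and are treated separately.\<close>
proof (cases "inj_on (\<lambda>k. ((*v) A ^^ k) w) {..CARD('n)}")
  case False
  then obtain i j where "i \<noteq> j" and "((*v) A ^^ i) w = ((*v) A ^^ j) w"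
    by (auto simp: inj_on_def)
  then have "poly_act A w (monom 1 i - monom 1 j) = 0"
    by (simp add: poly_act_diff poly_act_monom)
  moreover have "coeff (monom 1 i - monom (1 :: complex) j) i \<noteq> 0"
    using \<open>i \<noteq> j\<close> by simp
  then have "monom 1 i - monom (1 :: complex) j \<noteq> 0"
    by force
  ultimately show ?thesis by blast
next
  case True
  let ?f = "\<lambda>k. ((*v) A ^^ k) w" and ?I = "{..CARD('n)}"
  have "card (?f ` ?I) = Suc CARD('n)"
    using card_image [OF True] by simp
  moreover have "vec.independent (?f ` ?I) \<Longrightarrow> card (?f ` ?I) \<le> CARD('n)"
    by (metis dim_subset_UNIV_cart_gen vec.dim_eq_card_independent)
  ultimately have "vec.dependent (?f ` ?I)"
    by force
  then obtain u where u: "\<exists>v\<in>?f ` ?I. u v \<noteq> 0" "(\<Sum>v\<in>?f ` ?I. u v *s v) = 0"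
    by (subst (asm) vec.dependent_finite) auto
  define p where "p = (\<Sum>k\<in>?I. monom (u (?f k)) k)"
  have "poly_act A w p = 0"
    using u(2) by (simp add: p_def poly_act_sum poly_act_monom sum.reindex [OF True])
  moreover obtain k where "k \<in> ?I" "u (?f k) \<noteq> 0"
    using u(1) by auto
  then have "coeff p k \<noteq> 0"
    by (simp add: p_def coeff_sum)
  then have "p \<noteq> 0"
    by force
  ultimately show ?thesis by blast
qed

text \<open>A nonzero polynomial of least degree annihilating v has a root c. Dividing out the
  linear factor leaves a q of smaller degree, so q(A) v is nonzero, and it is an eigenvector for
  c.\<close>

lemma exists_eigenvector:
  fixes A :: "complex ^ 'n ^ 'n"
  assumes W: "vec.subspace W" "\<And>w. w \<in> W \<Longrightarrow> A *v w \<in> W" and "W \<noteq> {0}"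
  obtains w c where "w \<in> W" "w \<noteq> 0" "A *v w = c *s w"
proof -
  obtain v where v: "v \<in> W" "v \<noteq> 0"
    using \<open>W \<noteq> {0}\<close> vec.subspace_0 [OF W(1)] by blast
  obtain p where p: "p \<noteq> 0" "poly_act A v p = 0"
    and min: "\<And>q. q \<noteq> 0 \<Longrightarrow> poly_act A v q = 0 \<Longrightarrow> degree p \<le> degree q"
    using exists_least_iff [of "\<lambda>d. \<exists>p. p \<noteq> 0 \<and> poly_act A v p = 0 \<and> degree p = d"]
      poly_act_annihilator [of A v] by (metis not_le)
  have "degree p \<noteq> 0"
  proof
    assume "degree p = 0"
    then obtain a where "p = [:a:]"
      by (metis degree_eq_zeroE)
    with p v show False by simp
  qed
  then have "\<not> constant (poly p)"
    by (simp add: constant_degree)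
  then obtain c where "poly p c = 0"
    using fundamental_theorem_of_algebra by blast
  then obtain q where q: "p = [:- c, 1:] * q"
    by (auto simp: poly_eq_0_iff_dvd)
  with p have "q \<noteq> 0" by auto
  then have "degree p = Suc (degree q)"
    by (simp add: q degree_mult_eq del: mult_pCons_left)
  with min [of q] \<open>q \<noteq> 0\<close> have "poly_act A v q \<noteq> 0"
    by linarith
  moreover have "A *v poly_act A v q = c *s poly_act A v q"
    using p(2) by (simp add: q poly_act_add poly_act_smult poly_act_diff)
  ultimately show thesis
    using that poly_act_in_subspace [OF W v(1)] by blast
qed

lemma irreducible_subspace: "irreducible_submodule \<rho> W \<Longrightarrow> vec.subspace W"
  and irreducible_invariant: "irreducible_submodule \<rho> W \<Longrightarrow> w \<in> W \<Longrightarrow> \<rho> x *v w \<in> W"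
  by (simp_all add: irreducible_submodule_def lie_submodule_def)

lemma irreducible_eq:
  "\<lbrakk>irreducible_submodule \<rho> W; vec.subspace U; U \<subseteq> W; \<And>x w. w \<in> U \<Longrightarrow> \<rho> x *v w \<in> U; U \<noteq> {0}\<rbrakk> \<Longrightarrow> U = W"
  unfolding irreducible_submodule_def lie_submodule_def by blast

text \<open>An eigenspace of A inside W is a nonzero submodule, hence all of W.\<close>

lemma schur_scalar:
  fixes A :: "complex ^ 'n ^ 'n" and \<rho> :: "complex ^ 'g \<Rightarrow> complex ^ 'n ^ 'n"
  assumes W: "irreducible_submodule \<rho> W"
    and A: "\<And>w. w \<in> W \<Longrightarrow> A *v w \<in> W" "\<And>x w. w \<in> W \<Longrightarrow> A *v (\<rho> x *v w) = \<rho> x *v (A *v w)"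
  obtains c where "\<And>w. w \<in> W \<Longrightarrow> A *v w = c *s w"
proof -
  have "W \<noteq> {0}"
    using W by (simp add: irreducible_submodule_def)
  then obtain v c where v: "v \<in> W" "v \<noteq> 0" "A *v v = c *s v"
    using exists_eigenvector [OF irreducible_subspace [OF W] A(1)] by blast
  let ?U = "{w \<in> W. A *v w = c *s w}"
  have "?U = W"
  proof (rule irreducible_eq [OF W])
    show "vec.subspace ?U"
      using irreducible_subspace [OF W]
      by (auto simp: vec.subspace_def matrix_vector_right_distrib vector_add_ldistrib
          matrix_vector_scale vector_smult_assoc mult.commute)
    show "\<rho> x *v w \<in> ?U" if "w \<in> ?U" for x w
      using that irreducible_invariant [OF W] by (simp add: A matrix_vector_scale)
    show "?U \<noteq> {0}"
      using v by blast
  qed auto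
  then show thesis
    using that by blast
qed

text \<open>A nonzero F would have zero kernel in W and image U, making it an isomorphism.\<close>

lemma schur_zero:
  fixes F :: "complex ^ 'n ^ 'p"
  assumes W: "irreducible_submodule \<rho> W" and U: "irreducible_submodule \<sigma> U"
    and F: "\<And>w. w \<in> W \<Longrightarrow> F *v w \<in> U" "\<And>x w. w \<in> W \<Longrightarrow> F *v (\<rho> x *v w) = \<sigma> x *v (F *v w)"
    and "\<not> isomorphic_submodules \<rho> W \<sigma> U" and "w \<in> W"
  shows "F *v w = 0"
proof (rule ccontr)
  assume "F *v w \<noteq> 0"
  let ?K = "{w \<in> W. F *v w = 0}"
  have K: "?K = {0}"
  proof (rule ccontr)
    assume "?K \<noteq> {0}"
    have "?K = W"
    proof (rule irreducible_eq [OF W _ _ _ \<open>?K \<noteq> {0}\<close>])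
      show "vec.subspace ?K"
        using irreducible_subspace [OF W]
        by (auto simp: vec.subspace_def matrix_vector_right_distrib matrix_vector_scale)
      show "\<rho> x *v w \<in> ?K" if "w \<in> ?K" for x w
        using that irreducible_invariant [OF W] by (simp add: F)
    qed auto
    with \<open>w \<in> W\<close> \<open>F *v w \<noteq> 0\<close> show False by blast
  qed
  have inj: "inj_on ((*v) F) W"
  proof (rule inj_onI)
    fix x y assume "x \<in> W" "y \<in> W" "F *v x = F *v y"
    then have "x - y \<in> ?K"
      using vec.subspace_diff [OF irreducible_subspace [OF W]] by (simp add: matrix_vector_mult_diff_distrib)
    with K show "x = y" by auto
  qed
  have "(*v) F ` W = U"
  proof (rule irreducible_eq [OF U])
    show "vec.subspace ((*v) F ` W)"
      using irreducible_subspace [OF W]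
      by (auto intro!: vec.linear_subspace_image)
    show "\<sigma> x *v u \<in> (*v) F ` W" if "u \<in> (*v) F ` W" for x u
      using that irreducible_invariant [OF W] by (auto simp: F(2) [symmetric])
    show "(*v) F ` W \<noteq> {0}"
      using \<open>w \<in> W\<close> \<open>F *v w \<noteq> 0\<close> by blast
  qed (use F in auto)
  with inj F assms(5) show False
    by (auto simp: isomorphic_submodules_def bij_betw_def)
qed


section \<open>Traces\<close>

text \<open>The matrix with the eigenbasis as columns conjugates A to a diagonal matrix.\<close>

lemma trace_eigenbasis:
  fixes A :: "complex ^ 'n ^ 'n"
  assumes B: "vec.independent B" "vec.span B = UNIV" and A: "\<And>b. b \<in> B \<Longrightarrow> A *v b = l b *s b"
  shows "trace A = (\<Sum>b\<in>B. l b)"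
proof -
  have "card B = CARD('n)"
    using vec.dim_eq_card [of B UNIV] B by (simp add: card_cart_basis)
  then obtain f where f: "bij_betw f (UNIV :: 'n set) B"
    using finite_same_card_bij [of "UNIV :: 'n set" B] vec.finiteI_independent [OF B(1)] by auto
  define S where "S = (\<chi> i j. f j $ i)"
  define D where "D = (\<chi> i j. if i = j then l (f j) else 0)"
  have col: "column j S = f j" for j
    by (simp add: S_def column_def vec_eq_iff)
  have "columns S = B"
    using f by (auto simp: columns_def col bij_betw_def)
  with B obtain S' where S': "S ** S' = mat 1"
    using matrix_right_invertible_span_columns [of S] by auto
  have "A ** S = S ** D"
  proof -
    have "(A ** S) $ i $ j = (A *v f j) $ i" for i j
      by (simp add: S_def matrix_matrix_mult_def matrix_vector_mult_def)
    moreover have "(S ** D) $ i $ j = l (f j) * f j $ i" for i j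
      by (simp add: S_def D_def matrix_matrix_mult_def if_distrib [where f = "\<lambda>x. _ * x"] mult.commute cong: if_cong)
    moreover have "f j \<in> B" for j
      using f by (auto simp: bij_betw_def)
    ultimately show ?thesis
      by (simp add: vec_eq_iff A)
  qed
  have "trace A = trace (A ** (S ** S'))"
    by (simp add: S')
  also have "\<dots> = trace ((S ** D) ** S')"
    by (simp add: matrix_mul_assoc \<open>A ** S = S ** D\<close>)
  also have "\<dots> = trace (D ** (S' ** S))"
    by (metis matrix_mul_assoc trace_mul_sym)
  also have "\<dots> = trace D"
    using S' matrix_left_right_inverse [of S S'] by simp
  also have "\<dots> = (\<Sum>b\<in>B. l b)"
    using sum.reindex_bij_betw [OF f, of l] by (simp add: trace_def D_def)
  finally show ?thesis .
qed

lemma trace_idempotent: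
  fixes P :: "complex ^ 'n ^ 'n"
  assumes "P ** P = P"
  shows "trace P = of_nat (vec.dim (range ((*v) P)))"
proof -
  let ?R = "range ((*v) P)" and ?K = "{w. P *v w = 0}"
  have R: "P *v w = w" if "w \<in> ?R" for w
    using that assms by (auto simp: matrix_vector_mul_assoc)
  \<comment> \<open>A basis chosen inside the union of range and kernel consists of eigenvectors for
    1 and 0.\<close>
  obtain B where B: "B \<subseteq> ?R \<union> ?K" "vec.independent B" "?R \<union> ?K \<subseteq> vec.span B"
    using vec.maximal_independent_subset by blast
  have "w \<in> vec.span B" for w
  proof -
    have "P *v w \<in> vec.span B" "w - P *v w \<in> vec.span B"
      using B(3) assms by (auto simp: matrix_vector_mult_diff_distrib matrix_vector_mul_assoc)
    from vec.span_add [OF this] show ?thesis by simp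
  qed
  then have span: "vec.span B = UNIV" by auto
  have "trace P = (\<Sum>b\<in>B. if b \<in> ?R then 1 else 0)"
  proof (rule trace_eigenbasis [OF B(2) span])
    fix b assume "b \<in> B"
    show "P *v b = (if b \<in> ?R then 1 else 0) *s b"
    proof (cases "b \<in> ?R")
      case True
      then show ?thesis using R [of b] by simp
    next
      case False
      then show ?thesis using \<open>b \<in> B\<close> B(1) by auto
    qed
  qed
  also have "\<dots> = of_nat (card (B \<inter> ?R))"
    using vec.finiteI_independent [OF B(2)] by (simp add: sum.If_cases Int_def)
  also have "card (B \<inter> ?R) = vec.dim ?R"
  proof (rule vec.basis_card_eq_dim)
    have "P *v w \<in> vec.span (B \<inter> ?R)" if "w \<in> vec.span B" for w
      using that
    proof (induction rule: vec.span_induct)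
      case base
      then show ?case
        by (auto simp: vec.subspace_def matrix_vector_right_distrib matrix_vector_scale
            intro: vec.span_add vec.span_scale vec.span_zero)
    next
      case (step b)
      then consider "b \<in> ?R" | "P *v b = 0"
        using B(1) by blast
      then show ?case
      proof cases
        case 1
        with step show ?thesis
          by (simp only: R, intro vec.span_base) auto
      qed (simp add: vec.span_zero)
    qed
    then show "?R \<subseteq> vec.span (B \<inter> ?R)"
      by (auto simp: span)
    show "vec.independent (B \<inter> ?R)"
      using B(2) by (rule vec.independent_mono) auto
  qed auto
  finally show ?thesis .
qed


section \<open>Schur's lemma after extension of scalars\<close>

locale scalar_extension = ring_hom \<kappa> for \<kappa> :: "complex \<Rightarrow> 'b::field"
begin

text \<open>Through \<kappa> the field is a complex vector space, where a nonzero f is an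
  independent set and the value 1 at f extends linearly. Applied entrywise, such functionals bring
  matrices back to the complex numbers.\<close>

lemma exists_functional:
  assumes "f \<noteq> 0"
  obtains l where "\<And>x y. l (x + y) = l x + l y" "\<And>c x. l (\<kappa> c * x) = c * l x" "l f \<noteq> (0 :: complex)"
proof -
  let ?s = "\<lambda>c x. \<kappa> c * x"
  have vs: "vector_space ?s"
    by (rule vector_space.intro) (simp_all add: hom_add hom_mult hom_one distrib_left distrib_right mult.assoc)
  interpret vp: vector_space_pair ?s "(*) :: complex \<Rightarrow> complex \<Rightarrow> complex"
    by (intro vector_space_pair.intro vs vector_space_over_itself.vector_space_axioms)
  have "vp.vs1.independent {f}"
    using assms vp.vs1.dependent_single [of f] by blast
  then obtain l where l: "Vector_Spaces.linear ?s (*) l" "\<forall>x\<in>{f}. l x = (1 :: complex)"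
    using vp.linear_independent_extend [of "{f}" "\<lambda>_. 1"] by blast
  show thesis
  proof (rule that)
    show "l (x + y) = l x + l y" for x y
      using l(1) unfolding Vector_Spaces.linear_iff by blast
    show "l (\<kappa> c * x) = c * l x" for c x
      using l(1) unfolding Vector_Spaces.linear_iff by blast
    show "l f \<noteq> 0"
      using l(2) by simp
  qed
qed

text \<open>No eigenvalue of M need lie in the larger field. Instead, every complex-linear
  functional applied entrywise turns M into a complex matrix commuting with \<rho>, hence a scalar
  one; since these functionals separate points, M is scalar itself.\<close>

lemma schur_scalar_extension:
  fixes M :: "'b ^ 'n ^ 'n" and \<rho> :: "complex ^ 'g \<Rightarrow> complex ^ 'n ^ 'n"
  assumes irr: "irreducible_submodule \<rho> UNIV"
    and M: "\<And>x. M ** map_matrix \<kappa> (\<rho> x) = map_matrix \<kappa> (\<rho> x) ** M"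
  obtains c where "M = mat c"
proof -
  have sc: "\<exists>c. map_matrix l M = mat c"
    if l: "\<And>x y. l (x + y) = l x + l y" "\<And>c x. l (\<kappa> c * x) = c * l x" for l :: "'b \<Rightarrow> complex"
  proof -
    have l0: "l 0 = 0"
      using l(1) [of 0 0] by simp
    have lsum: "l (sum g I) = (\<Sum>i\<in>I. l (g i))" for g :: "'n \<Rightarrow> 'b" and I
      by (induction I rule: infinite_finite_induct) (simp_all add: l l0)
    have l2: "l (x * \<kappa> c) = l x * c" for x c
      using l(2) [of c x] by (simp add: mult.commute)
    have "map_matrix l M ** \<rho> x = \<rho> x ** map_matrix l M" for x
    proof -
      have "map_matrix l M ** \<rho> x = map_matrix l (M ** map_matrix \<kappa> (\<rho> x))"
        by (simp add: vec_eq_iff matrix_matrix_mult_def lsum l2)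
      also have "\<dots> = \<rho> x ** map_matrix l M"
        by (simp add: M) (simp add: vec_eq_iff matrix_matrix_mult_def lsum l)
      finally show ?thesis .
    qed
    then obtain c where "\<And>w. map_matrix l M *v w = c *s w"
      using schur_scalar [OF irr, of "map_matrix l M"] by (auto simp: matrix_vector_mul_assoc)
    then have "map_matrix l M = mat c"
      by (simp add: matrix_eq vec_eq_iff matrix_vector_mult_def mat_def
          if_distrib [where f = "\<lambda>x. x * _"] cong: if_cong)
    then show ?thesis ..
  qed
  \<comment> \<open>Any diagonal entry can serve as the scalar.\<close>
  fix i0 :: 'n
  have "M = mat (M $ i0 $ i0)"
  proof (rule ccontr)
    assume "M \<noteq> mat (M $ i0 $ i0)"
    then obtain i j where "M $ i $ j - mat (M $ i0 $ i0) $ i $ j \<noteq> 0"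
      by (auto simp: vec_eq_iff)
    then obtain l where l: "\<And>x y. l (x + y) = l x + l y" "\<And>c x. l (\<kappa> c * x) = c * l x"
      "l (M $ i $ j - mat (M $ i0 $ i0) $ i $ j) \<noteq> (0 :: complex)"
      using exists_functional by blast
    from sc [OF l(1,2)] obtain c where c: "map_matrix l M = mat c" ..
    then have "l (M $ i $ j) = mat c $ i $ j" "l (M $ i0 $ i0) = c"
      by (auto simp: vec_eq_iff mat_def) 
    moreover have "l 0 = 0"
      using l(1) [of 0 0] by simp
    moreover have "l (x - y) = l x - l y" for x y
      using l(1) [of "x - y" y] by simp
    ultimately show False
      using l(3) by (simp add: mat_def split: if_splits)
  qed
  then show thesis using that by blast
qed

text \<open>For fixed indices p, q of the second factor the block of M commutes with \<rho> and is a
  scalar; these scalars are the entries of \<open>M'\<close>.\<close>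

lemma commutant_kron_left:
  fixes M :: "'b ^ ('n::finite \<times> 'p::finite) ^ ('n \<times> 'p)" and \<rho> :: "complex ^ 'g \<Rightarrow> complex ^ 'n ^ 'n"
  assumes irr: "irreducible_submodule \<rho> UNIV"
    and M: "\<And>x. M ** kron (map_matrix \<kappa> (\<rho> x)) (mat 1) = kron (map_matrix \<kappa> (\<rho> x)) (mat 1) ** M"
  obtains M' where "M = kron (mat 1) M'"
proof -
  have "\<exists>c. (\<chi> i j. M $ (i, p) $ (j, q)) = mat c" for p q
  proof -
    let ?N = "\<chi> i j. M $ (i, p) $ (j, q)"
    have "?N ** map_matrix \<kappa> (\<rho> x) = map_matrix \<kappa> (\<rho> x) ** ?N" for x
    proof -
      let ?x = "map_matrix \<kappa> (\<rho> x)"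
      have "(M ** kron ?x (mat 1)) $ (i, p) $ (j, q)
          = (\<Sum>k\<in>UNIV. \<Sum>r\<in>UNIV. M $ (i, p) $ (k, r) * (?x $ k $ j * mat 1 $ r $ q))" for i j
        by (simp only: matrix_matrix_mult_def vec_lambda_beta UNIV_Times_UNIV [symmetric]
            sum.cartesian_product case_prod_unfold kron_def prod.collapse fst_conv snd_conv)
      moreover have "(\<Sum>k\<in>UNIV. \<Sum>r\<in>UNIV. M $ (i, p) $ (k, r) * (?x $ k $ j * mat 1 $ r $ q))
          = (?N ** ?x) $ i $ j" for i j
        by (simp add: matrix_matrix_mult_def mat_def if_distrib [where f = "\<lambda>x. _ * x"] cong: if_cong)
      moreover
      have "(kron ?x (mat 1) ** M) $ (i, p) $ (j, q)
          = (\<Sum>k\<in>UNIV. \<Sum>r\<in>UNIV. ?x $ i $ k * mat 1 $ p $ r * M $ (k, r) $ (j, q))" for i j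
        by (simp only: matrix_matrix_mult_def vec_lambda_beta UNIV_Times_UNIV [symmetric]
            sum.cartesian_product case_prod_unfold kron_def prod.collapse fst_conv snd_conv)
      moreover have "(\<Sum>k\<in>UNIV. \<Sum>r\<in>UNIV. ?x $ i $ k * mat 1 $ p $ r * M $ (k, r) $ (j, q))
          = (?x ** ?N) $ i $ j" for i j
        by (simp add: matrix_matrix_mult_def mat_def if_distrib [where f = "\<lambda>x. _ * x"]
            if_distrib [where f = "\<lambda>x. x * _"] cong: if_cong)
      ultimately show ?thesis
        by (simp add: vec_eq_iff M)
    qed
    then obtain c where "?N = mat c"
      using schur_scalar_extension [OF irr] by blast
    then show ?thesis ..
  qed
  then obtain c where c: "\<And>p q. (\<chi> i j. M $ (i, p) $ (j, q)) = mat (c p q)"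
    by metis
  have "M = kron (mat 1) (\<chi> p q. c p q)"
    using c by (simp add: vec_eq_iff mat_def)
  then show thesis using that by blast
qed

end

section \<open>Tensors as matrices\<close>

definition tens :: "'a ^ 'p::finite ^ 'n::finite \<Rightarrow> 'a ^ ('n \<times> 'p)" where
  "tens M = (\<chi> p. M $ fst p $ snd p)"

lemma tens_nth [simp]: "tens M $ (i, j) = M $ i $ j"
  by (simp add: tens_def)

lemma tens_cases: obtains M where "w = tens M"
proof
  show "w = tens (\<chi> i j. w $ (i, j))"
    by (simp add: vec_eq_iff)
qed

lemma tens_eq_iff [simp]: "tens M = tens N \<longleftrightarrow> M = N"
  by (simp add: vec_eq_iff)

lemma tens_zero [simp]: "tens 0 = 0" "tens M = 0 \<longleftrightarrow> M = 0"
  by (simp_all add: vec_eq_iff)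

lemma tens_add: "tens (M + N) = tens M + tens N"
  by (simp add: vec_eq_iff)

lemma tens_diff: "tens (M - N) = tens M - tens N"
  by (simp add: vec_eq_iff)

lemma tens_minus: "tens (- M) = - tens M"
  by (simp add: vec_eq_iff)

lemma tens_scm: "tens (c *m M) = c *s tens M"
  by (simp add: vec_eq_iff)

lemma tens_sum: "tens (\<Sum>i\<in>I. M i) = (\<Sum>i\<in>I. tens (M i))"
  by (simp add: vec_eq_iff)

lemma kron_tens: "kron A B *v tens M = tens (A ** M ** transpose (B :: 'a::comm_semiring_1 ^ _ ^ _))"
proof -
  have "(kron A B *v tens M) $ (i, j) = (\<Sum>k\<in>UNIV. \<Sum>l\<in>UNIV. A $ i $ k * B $ j $ l * M $ k $ l)" for i j
    by (simp only: matrix_vector_mult_def vec_lambda_beta UNIV_Times_UNIV [symmetric] sum.cartesian_product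
        case_prod_unfold kron_def tens_def prod.collapse fst_conv snd_conv)
  also have "(\<Sum>k\<in>UNIV. \<Sum>l\<in>UNIV. A $ i $ k * B $ j $ l * M $ k $ l) = (A ** M ** transpose B) $ i $ j" for i j
    by (subst sum.swap) (simp add: matrix_matrix_mult_def transpose_def sum_distrib_right sum_distrib_left mult_ac)
  finally show ?thesis
    by (simp add: vec_eq_iff)
qed

lemma tens_sym2: "tens M \<in> sym2 \<longleftrightarrow> transpose M = M"
  by (auto simp: sym2_def vec_eq_iff transpose_def)

lemma tens_alt2: "tens M \<in> alt2 \<longleftrightarrow> transpose M = - M"
  by (auto simp: alt2_def vec_eq_iff transpose_def)

lemma sum_1_4: "(\<Sum>i\<in>{1..4::nat}. f i) = f 1 + f 2 + f 3 + f 4"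
  by (simp add: eval_nat_numeral add.assoc)


section \<open>Lie algebras and the trace form\<close>

text \<open>The preimage under F of a nonzero submodule is a nonzero submodule of U. Applied to
  \<open>W 3\<close>, this makes the adjoint module irreducible: the Lie algebra has no proper
  nonzero ideal.\<close>

lemma irreducible_isomorphic:
  fixes \<sigma> :: "complex ^ 'g \<Rightarrow> complex ^ 'p ^ 'p"
  assumes irr: "irreducible_submodule \<tau> U" and iso: "isomorphic_submodules \<tau> U \<sigma> UNIV"
  shows "irreducible_submodule \<sigma> UNIV"
proof -
  obtain F where F: "bij_betw ((*v) F) U UNIV"
    "\<And>x w. w \<in> U \<Longrightarrow> F *v (\<tau> x *v w) = \<sigma> x *v (F *v w)"
    using iso unfolding isomorphic_submodules_def by blast
  have zero: "0 \<in> U"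
    using vec.subspace_0 irreducible_subspace [OF irr] by blast
  have "N = {0} \<or> N = UNIV" if N: "vec.subspace N" "\<And>x w. w \<in> N \<Longrightarrow> \<sigma> x *v w \<in> N" for N
  proof (cases "N = {0}")
    case False
    let ?K = "{w \<in> U. F *v w \<in> N}"
    obtain y where y: "y \<in> N" "y \<noteq> 0"
      using False vec.subspace_0 [OF N(1)] by blast
    have "?K = U"
    proof (rule irreducible_eq [OF irr])
      show "vec.subspace ?K"
        using irreducible_subspace [OF irr] N(1)
        by (auto simp: vec.subspace_def matrix_vector_right_distrib matrix_vector_scale)
      show "\<tau> x *v w \<in> ?K" if "w \<in> ?K" for x w
        using that N(2) [of "F *v w" x] irreducible_invariant [OF irr] by (simp add: F(2))
      have "y \<in> (*v) F ` U"
        using F(1) by (simp add: bij_betw_def)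
      then obtain w where "w \<in> U" "F *v w = y"
        by blast
      with y have "w \<in> ?K" "w \<noteq> 0" by auto
      then show "?K \<noteq> {0}" by blast
    qed blast
    then have "F *v w \<in> N" if "w \<in> U" for w
      using that by blast
    then have "(*v) F ` U \<subseteq> N"
      by blast
    then show ?thesis
      using F(1) by (auto simp: bij_betw_def)
  qed simp
  moreover have "UNIV \<noteq> {0 :: complex ^ 'p}"
  proof
    assume "UNIV = {0 :: complex ^ 'p}"
    then have "F *v w \<in> {0}" for w
      by blast
    then have "F *v w = F *v 0" for w
      by simp
    then have "w = 0" if "w \<in> U" for w
      using F(1) zero that unfolding bij_betw_def inj_on_def by blast
    with zero have "U = {0}" by blast
    with irr show False by (simp add: irreducible_submodule_def)
  qed
  ultimately show ?thesis
    unfolding irreducible_submodule_def lie_submodule_def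
    using vec.subspace_UNIV by blast
qed

locale lie_rep =
  fixes br :: "complex ^ 'g \<Rightarrow> complex ^ 'g \<Rightarrow> complex ^ 'g"
    and \<rho> :: "complex ^ 'g \<Rightarrow> complex ^ 'n ^ 'n"
  assumes lie: "lie_algebra br" and rep: "lie_representation br \<rho>"
begin

lemma br_linear: "Vector_Spaces.linear (*s) (*s) (br x)"
  using lie by (simp add: lie_algebra_def)

lemma adjoint_apply [simp]: "adjoint_rep br x *v y = br x y"
  by (simp add: adjoint_rep_def matrix_works [OF br_linear])

lemma rep_add: "\<rho> (x + y) = \<rho> x + \<rho> y"
  and rep_scale: "\<rho> (c *s x) = c *m \<rho> x"
  and rep_br: "\<rho> (br x y) = \<rho> x ** \<rho> y - \<rho> y ** \<rho> x"
  using rep by (simp_all add: lie_representation_def mat_mult_scm)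

lemma rep_zero [simp]: "\<rho> 0 = 0"
  using rep_scale [of 0 0] by simp

lemma rep_sum: "\<rho> (\<Sum>i\<in>I. x i) = (\<Sum>i\<in>I. \<rho> (x i))"
  by (induction I rule: infinite_finite_induct) (simp_all add: rep_add)

lemma rep_vector: "\<rho> (\<Sum>i\<in>I. c i *s x i) = (\<Sum>i\<in>I. c i *m \<rho> (x i))"
  by (simp add: rep_sum rep_scale)

lemma tensor_square_tens: "tensor_square \<rho> x *v tens M = tens (\<rho> x ** M + M ** transpose (\<rho> x))"
  by (simp add: tensor_square_def matrix_vector_mult_add_rdistrib kron_tens tens_add)

text \<open>Normalising by the trace on V itself makes the traces of \<open>casimir2\<close> squared
  and of its product with the flip equal to the dimension of the Lie algebra.\<close>

definition trace_form :: "complex ^ 'g \<Rightarrow> complex ^ 'g \<Rightarrow> complex" where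
  "trace_form x y = trace (\<rho> x ** \<rho> y)"

lemma trace_form_sym: "trace_form x y = trace_form y x"
  unfolding trace_form_def by (rule trace_mul_sym)

lemma trace_form_add: "trace_form (x + y) z = trace_form x z + trace_form y z"
  "trace_form z (x + y) = trace_form z x + trace_form z y"
  by (simp_all add: trace_form_def rep_add matrix_ring_simps trace_add)

lemma trace_form_scale: "trace_form (c *s x) z = c * trace_form x z"
  "trace_form z (c *s x) = c * trace_form z x"
  by (simp_all add: trace_form_def rep_scale matrix_ring_simps trace_scm)

lemma trace_form_zero [simp]: "trace_form 0 x = 0" "trace_form x 0 = 0"
  by (simp_all add: trace_form_def trace_0 [simplified])

lemma trace_form_sum: "trace_form (\<Sum>i\<in>I. x i) z = (\<Sum>i\<in>I. trace_form (x i) z)"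
  "trace_form z (\<Sum>i\<in>I. x i) = (\<Sum>i\<in>I. trace_form z (x i))"
  by (induction I rule: infinite_finite_induct) (simp_all add: trace_form_add)

lemma trace_form_diff: "trace_form (x - y) z = trace_form x z - trace_form y z"
  using trace_form_add(1) [of "x - y" y z] by simp

lemma trace_form_invariant: "trace_form (br x y) z = - trace_form y (br x z)"
proof -
  have "trace (\<rho> x ** \<rho> y ** \<rho> z) = trace (\<rho> y ** (\<rho> z ** \<rho> x))"
    using trace_mul_sym [of "\<rho> x" "\<rho> y ** \<rho> z"] by (simp add: matrix_mul_assoc)
  then show ?thesis
    by (simp add: trace_form_def rep_br matrix_ring_simps trace_sub matrix_mul_assoc)
qed

end

locale nondegenerate_lie_rep = lie_rep br \<rho>
  for br :: "complex ^ 'g \<Rightarrow> complex ^ 'g \<Rightarrow> complex ^ 'g"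
    and \<rho> :: "complex ^ 'g \<Rightarrow> complex ^ 'n ^ 'n" +
  assumes radical: "(\<And>y. trace_form x y = 0) \<Longrightarrow> x = 0"
begin

definition std_basis :: "'g \<Rightarrow> complex ^ 'g" where
  "std_basis a = axis a 1"

definition gram :: "complex ^ 'g ^ 'g" where
  "gram = (\<chi> a b. trace_form (std_basis a) (std_basis b))"

text \<open>The columns of the inverse Gram matrix are the coordinates of the dual basis.\<close>

definition dual_basis :: "'g \<Rightarrow> complex ^ 'g" where
  "dual_basis a = column a (SOME H. gram ** H = mat 1)"

lemma std_expansion: "y = (\<Sum>a\<in>UNIV. y $ a *s std_basis a)"
  by (simp add: std_basis_def basis_expansion)

lemma gram_right_inverse: "gram ** (SOME H. gram ** H = mat 1) = mat 1"
proof -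
  have "c = 0" if "gram *v c = 0" for c
  proof (rule radical)
    fix y
    have "trace_form c (std_basis a) = 0" for a
    proof -
      have "trace_form c (std_basis a) = (\<Sum>b\<in>UNIV. c $ b * trace_form (std_basis b) (std_basis a))"
        by (subst std_expansion [of c]) (simp add: trace_form_sum trace_form_scale)
      also have "\<dots> = (gram *v c) $ a"
        by (simp add: gram_def matrix_vector_mult_def trace_form_sym mult.commute)
      finally show ?thesis using that by simp
    qed
    then show "trace_form c y = 0"
      by (subst std_expansion [of y]) (simp add: trace_form_sum trace_form_scale)
  qed
  then have "\<exists>H. H ** gram = mat 1"
    by (simp add: matrix_left_invertible_ker)
  then have "\<exists>H. gram ** H = mat 1"
    by (simp add: matrix_left_right_inverse)
  then show ?thesis
    by (rule someI_ex)
qed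

lemma trace_form_dual: "trace_form (std_basis a) (dual_basis b) = (if a = b then 1 else 0)"
proof -
  let ?H = "SOME H. gram ** H = mat 1"
  have "trace_form (std_basis a) (dual_basis b) = (\<Sum>c\<in>UNIV. dual_basis b $ c * trace_form (std_basis a) (std_basis c))"
    by (subst std_expansion [of "dual_basis b"]) (simp add: trace_form_sum trace_form_scale)
  also have "\<dots> = (gram ** ?H) $ a $ b"
    by (simp add: gram_def matrix_matrix_mult_def dual_basis_def column_def mult.commute)
  finally show ?thesis
    by (simp only: gram_right_inverse) (simp add: mat_def)
qed

lemma expansion: "y = (\<Sum>a\<in>UNIV. trace_form y (dual_basis a) *s std_basis a)"
proof -
  have "trace_form y (dual_basis a) = y $ a" for a
    by (subst std_expansion [of y])
       (simp add: trace_form_sum trace_form_scale trace_form_dual if_distrib [where f = "\<lambda>x. _ * x"] cong: if_cong)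
  then show ?thesis
    using std_expansion [of y] by simp
qed

lemma dual_expansion: "y = (\<Sum>a\<in>UNIV. trace_form y (std_basis a) *s dual_basis a)"
proof -
  let ?z = "\<Sum>a\<in>UNIV. trace_form y (std_basis a) *s dual_basis a"
  have *: "trace_form (y - ?z) (std_basis b) = 0" for b
    by (simp add: trace_form_diff trace_form_sum trace_form_scale trace_form_sym [of "dual_basis _"] trace_form_dual
        if_distrib [where f = "\<lambda>x. _ * x"] cong: if_cong)
  have "trace_form (y - ?z) x = 0" for x
    by (subst std_expansion [of x]) (simp only: trace_form_sum trace_form_scale *, simp)
  then have "y - ?z = 0"
    by (rule radical)
  then show ?thesis by simp
qed

definition casimir2 :: "complex ^ ('n \<times> 'n) ^ ('n \<times> 'n)" where
  "casimir2 = (\<Sum>a\<in>UNIV. kron (\<rho> (std_basis a)) (\<rho> (dual_basis a)))"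

text \<open>The commutator of x in the first factor with \<open>casimir2\<close>, the form of the
  correction in the coproduct of the Yangian.\<close>

definition bracket_casimir :: "complex ^ 'g \<Rightarrow> complex ^ ('n \<times> 'n) ^ ('n \<times> 'n)" where
  "bracket_casimir x = (\<Sum>a\<in>UNIV. kron (\<rho> (br x (std_basis a))) (\<rho> (dual_basis a)))"

text \<open>Invariance of the trace form moves the bracket, with a sign, from a basis to its dual:
  expand the bracket in the standard basis, exchange the sums, and recollect in the dual basis. This
  is the reason why \<open>casimir2\<close> is equivariant.\<close>

lemma bracket_casimir_dual:
  "bracket_casimir x = - (\<Sum>a\<in>UNIV. kron (\<rho> (std_basis a)) (\<rho> (br x (dual_basis a))))"
proof -
  let ?c = "\<lambda>a b. trace_form (br x (std_basis a)) (dual_basis b)"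
  have inner: "(\<Sum>a\<in>UNIV. ?c a b *m kron (\<rho> (std_basis b)) (\<rho> (dual_basis a)))
      = - kron (\<rho> (std_basis b)) (\<rho> (br x (dual_basis b)))" for b
  proof -
    have "?c a b = - trace_form (br x (dual_basis b)) (std_basis a)" for a
      by (metis trace_form_invariant trace_form_sym)
    then have "(\<Sum>a\<in>UNIV. ?c a b *m kron (\<rho> (std_basis b)) (\<rho> (dual_basis a)))
        = - (\<Sum>a\<in>UNIV. trace_form (br x (dual_basis b)) (std_basis a) *m kron (\<rho> (std_basis b)) (\<rho> (dual_basis a)))"
      by (simp add: vec_eq_iff sum_negf)
    also have "\<dots> = - kron (\<rho> (std_basis b)) (\<rho> (br x (dual_basis b)))"
      by (subst (4) dual_expansion) (simp add: rep_vector kron_sum_right kron_scm_right)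
    finally show ?thesis .
  qed
  have "bracket_casimir x = (\<Sum>a\<in>UNIV. \<Sum>b\<in>UNIV. ?c a b *m kron (\<rho> (std_basis b)) (\<rho> (dual_basis a)))"
    unfolding bracket_casimir_def
    by (subst expansion) (simp add: rep_vector kron_sum_left kron_scm_left)
  also have "\<dots> = (\<Sum>b\<in>UNIV. \<Sum>a\<in>UNIV. ?c a b *m kron (\<rho> (std_basis b)) (\<rho> (dual_basis a)))"
    by (rule sum.swap)
  finally show ?thesis
    by (simp add: inner sum_negf)
qed

lemma casimir2_commute_left:
  "kron (\<rho> x) (mat 1) ** casimir2 - casimir2 ** kron (\<rho> x) (mat 1) = bracket_casimir x"
  by (simp add: casimir2_def bracket_casimir_def matrix_sum_left matrix_sum_right kron_mult rep_br
      kron_diff_left sum_subtractf)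

lemma casimir2_equivariant: "casimir2 ** tensor_square \<rho> x = tensor_square \<rho> x ** casimir2"
proof -
  have "kron (mat 1) (\<rho> x) ** casimir2 - casimir2 ** kron (mat 1) (\<rho> x) = - bracket_casimir x"
    by (simp add: bracket_casimir_dual) (simp add: casimir2_def matrix_sum_left matrix_sum_right kron_mult rep_br
        kron_diff_right sum_subtractf)
  with casimir2_commute_left [of x] show ?thesis
    by (simp add: tensor_square_def matrix_ring_simps algebra_simps)
qed

lemma casimir2_tens:
  "casimir2 *v tens M = tens (\<Sum>a\<in>UNIV. \<rho> (std_basis a) ** M ** transpose (\<rho> (dual_basis a)))"
  by (simp add: casimir2_def matrix_vector_sum_left kron_tens tens_sum)

lemma trace_swap_casimir2: "trace (tensor_swap ** casimir2) = of_nat CARD('g)"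
  by (simp add: casimir2_def matrix_sum_right trace_sum trace_tensor_swap_kron
      trace_form_dual [unfolded trace_form_def])

text \<open>The Gram matrix of the dual basis is the inverse of \<open>gram\<close>, so this is the
  trace of the identity.\<close>

lemma sum_gram_dual_gram:
  "(\<Sum>a\<in>UNIV. \<Sum>b\<in>UNIV. trace_form (std_basis b) (std_basis a) * trace_form (dual_basis b) (dual_basis a))
    = of_nat CARD('g)"
proof -
  have "(\<Sum>a\<in>UNIV. \<Sum>b\<in>UNIV. trace_form (std_basis b) (std_basis a) * trace_form (dual_basis b) (dual_basis a))
      = (\<Sum>a\<in>UNIV. trace_form (\<Sum>b\<in>UNIV. trace_form (std_basis a) (std_basis b) *s dual_basis b) (dual_basis a))"
    by (simp add: trace_form_sum trace_form_scale trace_form_sym)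
  also have "\<dots> = of_nat CARD('g)"
    by (simp add: dual_expansion [symmetric] trace_form_dual)
  finally show ?thesis .
qed

lemma trace_casimir2_squared: "trace (casimir2 ** casimir2) = of_nat CARD('g)"
proof -
  have "trace (casimir2 ** casimir2) = (\<Sum>a\<in>UNIV. \<Sum>b\<in>UNIV.
      trace_form (std_basis b) (std_basis a) * trace_form (dual_basis b) (dual_basis a))"
    by (simp add: casimir2_def matrix_sum_left matrix_sum_right trace_sum kron_mult trace_kron trace_form_def)
  then show ?thesis
    by (simp only: sum_gram_dual_gram)
qed

end

section \<open>The modules of the $e_7$ series\<close>

locale e7_rep = lie_rep br \<rho>
  for br :: "complex ^ 'g \<Rightarrow> complex ^ 'g \<Rightarrow> complex ^ 'g"
    and \<rho> :: "complex ^ 'g \<Rightarrow> complex ^ 'n ^ 'n" +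
  fixes m k :: nat and X :: lie_type and e f h :: "nat \<Rightarrow> complex ^ 'g"
    and W :: "nat \<Rightarrow> (complex ^ ('n \<times> 'n)) set"
    and P :: "nat \<Rightarrow> complex ^ ('n \<times> 'n) ^ ('n \<times> 'n)"
  assumes e7: "e7_series_module m X k br e f h \<rho>"
    and decomposition: "e7_decomposition X k br e h \<rho> W"
    and projectors: "\<And>i. i \<in> {1..4} \<Longrightarrow> equivariant_projector (tensor_square \<rho>) (W i) (P i)"
begin

declare One_nat_def [simp del]

abbreviation \<tau> where "\<tau> \<equiv> tensor_square \<rho>"

lemma irreducible_rep: "irreducible_submodule \<rho> UNIV"
  using e7 by (simp add: e7_series_module_def)

lemma card_n: "CARD('n) = 6 * m + 8"
  using e7 by (simp add: e7_series_module_def)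

lemma irreducible_W: "i \<in> {1..4} \<Longrightarrow> irreducible_submodule \<tau> (W i)"
  using decomposition by (simp add: e7_decomposition_def Let_def)

lemma not_isomorphic_W:
  "\<lbrakk>i \<in> {1..4}; j \<in> {1..4}; i \<noteq> j\<rbrakk> \<Longrightarrow> \<not> isomorphic_submodules \<tau> (W i) \<tau> (W j)"
  using decomposition by (simp add: e7_decomposition_def Let_def)

lemma isomorphic_adjoint: "isomorphic_submodules \<tau> (W 3) (adjoint_rep br) UNIV"
  using decomposition by (simp add: e7_decomposition_def Let_def)

lemma irreducible_adjoint: "irreducible_submodule (adjoint_rep br) UNIV"
  using irreducible_isomorphic [OF irreducible_W isomorphic_adjoint] by simp

lemma adjoint_submodule:
  assumes "vec.subspace N" "\<And>x y. y \<in> N \<Longrightarrow> br x y \<in> N" "N \<noteq> {0}"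
  shows "N = UNIV"
  using irreducible_eq [OF irreducible_adjoint, of N] assms by simp

lemma k_range: "k \<in> {1..lie_rank X}"
  using e7 by (auto simp: e7_series_module_def e7_series_def)

lemma chevalley:
  assumes "i \<in> {1..lie_rank X}" "j \<in> {1..lie_rank X}"
  shows "br (h i) (h j) = 0" "br (e i) (f i) = h i"
    "br (h i) (e j) = of_int (cartan_entry X i j) *s e j"
    "br (h i) (f j) = of_int (- cartan_entry X i j) *s f j"
  using e7 assms by (simp_all add: e7_series_module_def chevalley_generators_def Let_def)

lemma generated:
  assumes "vec.subspace S" "\<And>x y. x \<in> S \<Longrightarrow> y \<in> S \<Longrightarrow> br x y \<in> S"
    "\<And>i. i \<in> {1..lie_rank X} \<Longrightarrow> e i \<in> S \<and> f i \<in> S \<and> h i \<in> S"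
  shows "S = UNIV"
proof -
  have "lie_generated_by br (e ` {1..lie_rank X} \<union> f ` {1..lie_rank X} \<union> h ` {1..lie_rank X})"
    using e7 by (simp add: e7_series_module_def chevalley_generators_def Let_def)
  moreover have "e ` {1..lie_rank X} \<union> f ` {1..lie_rank X} \<union> h ` {1..lie_rank X} \<subseteq> S"
    using assms(3) by blast
  ultimately show ?thesis
    unfolding lie_generated_by_def using assms(1,2) by blast
qed

section \<open>Weights of V and nondegeneracy of the trace form\<close>

lemma highest_weight_vector:
  obtains v where "v \<noteq> 0" "\<And>i. i \<in> {1..lie_rank X} \<Longrightarrow> \<rho> (h i) *v v = of_nat (fundamental_weight k i) *s v"
  using e7 by (auto simp: e7_series_module_def has_highest_weight_def)

text \<open>Integrality is the point: it will make the trace of the square of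
  \<open>\<rho> (h k)\<close> a sum of squares of integers. The zero vector is included, so that
  root vectors preserve the set.\<close>

definition weight_vectors :: "(complex ^ 'n) set" where
  "weight_vectors = {v. \<exists>\<mu> :: nat \<Rightarrow> int. \<forall>i\<in>{1..lie_rank X}. \<rho> (h i) *v v = of_int (\<mu> i) *s v}"

lemma root_vector_shifts_weight:
  assumes "\<And>i. i \<in> {1..lie_rank X} \<Longrightarrow> br (h i) x = of_int (\<nu> i) *s x" and "v \<in> weight_vectors"
  shows "\<rho> x *v v \<in> weight_vectors"
proof -
  obtain \<mu> :: "nat \<Rightarrow> int" where \<mu>: "\<And>i. i \<in> {1..lie_rank X} \<Longrightarrow> \<rho> (h i) *v v = of_int (\<mu> i) *s v"
    using assms(2) unfolding weight_vectors_def by blast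
  have "\<rho> (h i) *v (\<rho> x *v v) = of_int (\<mu> i + \<nu> i) *s (\<rho> x *v v)" if "i \<in> {1..lie_rank X}" for i
  proof -
    have "\<rho> (h i) ** \<rho> x = \<rho> (br (h i) x) + \<rho> x ** \<rho> (h i)"
      by (simp add: rep_br)
    then have "\<rho> (h i) *v (\<rho> x *v v) = \<rho> (br (h i) x) *v v + \<rho> x *v (\<rho> (h i) *v v)"
      by (simp add: matrix_vector_mul_assoc matrix_vector_mult_add_rdistrib)
    also have "\<dots> = of_int (\<mu> i + \<nu> i) *s (\<rho> x *v v)"
      using that by (simp add: assms(1) \<mu> rep_scale scm_vector_mult matrix_vector_scale vector_sadd_rdistrib add.commute)
    finally show ?thesis .
  qed
  then show ?thesis
    unfolding weight_vectors_def by (intro CollectI exI [of _ "\<lambda>i. \<mu> i + \<nu> i"] ballI)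
qed

text \<open>The elements preserving the span form a subalgebra that contains the Chevalley
  generators, hence everything. The span is therefore a submodule, and it contains the highest
  weight vector.\<close>

lemma span_weight_vectors: "vec.span weight_vectors = UNIV"
proof -
  let ?S = "vec.span weight_vectors"
  have lin: "A *v v \<in> ?S" if "\<And>v. v \<in> weight_vectors \<Longrightarrow> A *v v \<in> ?S" "v \<in> ?S" for A v
    using that(2)
  proof (induction rule: vec.span_induct)
    case base
    then show ?case
      by (auto simp: vec.subspace_def matrix_vector_right_distrib matrix_vector_scale
          intro: vec.span_add vec.span_scale vec.span_zero)
  qed (use that in auto)
  have "{x. \<forall>v\<in>?S. \<rho> x *v v \<in> ?S} = UNIV"
  proof (rule generated)
    show "vec.subspace {x. \<forall>v\<in>?S. \<rho> x *v v \<in> ?S}"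
      by (auto simp: vec.subspace_def rep_add rep_scale scm_vector_mult matrix_vector_mult_add_rdistrib
          intro: vec.span_add vec.span_scale vec.span_zero)
  next
    fix x y
    assume "x \<in> {x. \<forall>v\<in>?S. \<rho> x *v v \<in> ?S}" "y \<in> {x. \<forall>v\<in>?S. \<rho> x *v v \<in> ?S}"
    then show "br x y \<in> {x. \<forall>v\<in>?S. \<rho> x *v v \<in> ?S}"
      by (auto simp: rep_br matrix_vector_mult_diff_rdistrib matrix_vector_mul_assoc [symmetric]
          intro: vec.span_diff)
  next
    fix i assume i: "i \<in> {1..lie_rank X}"
    have ne: "\<rho> (e i) *v v \<in> ?S" "\<rho> (f i) *v v \<in> ?S" "\<rho> (h i) *v v \<in> ?S" if v: "v \<in> weight_vectors" for v
    proof -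
      show "\<rho> (e i) *v v \<in> ?S"
        by (rule vec.span_base, rule root_vector_shifts_weight [OF chevalley(3) [OF _ i] v])
      show "\<rho> (f i) *v v \<in> ?S"
        by (rule vec.span_base, rule root_vector_shifts_weight [OF chevalley(4) [OF _ i] v])
      have "br (h j) (h i) = of_int 0 *s h i" if "j \<in> {1..lie_rank X}" for j
        using chevalley(1) [OF that i] by simp
      then show "\<rho> (h i) *v v \<in> ?S"
        by (intro vec.span_base root_vector_shifts_weight [OF _ v, of "h i" "\<lambda>_. 0"])
    qed
    then show "e i \<in> {x. \<forall>v\<in>?S. \<rho> x *v v \<in> ?S} \<and> f i \<in> {x. \<forall>v\<in>?S. \<rho> x *v v \<in> ?S} \<and> h i \<in> {x. \<forall>v\<in>?S. \<rho> x *v v \<in> ?S}"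
      using lin by blast
  qed
  then have inv: "\<rho> x *v v \<in> ?S" if "v \<in> ?S" for x v
    using that by blast
  obtain v where v: "v \<noteq> 0" "\<And>i. i \<in> {1..lie_rank X} \<Longrightarrow> \<rho> (h i) *v v = of_nat (fundamental_weight k i) *s v"
    using highest_weight_vector by blast
  then have "v \<in> weight_vectors"
    unfolding weight_vectors_def
    by (intro CollectI exI [of _ "\<lambda>i. int (fundamental_weight k i)"] ballI) simp
  then have "v \<in> ?S"
    by (rule vec.span_base)
  with v(1) have "?S \<noteq> {0}" by blast
  then show ?thesis
    by (intro irreducible_eq [OF irreducible_rep]) (auto intro: inv)
qed

lemma rep_h_nonzero: "\<rho> (h k) \<noteq> 0"
proof
  assume "\<rho> (h k) = 0"
  moreover obtain v where "v \<noteq> 0" "\<rho> (h k) *v v = of_nat (fundamental_weight k k) *s v"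
    using highest_weight_vector [OF _] k_range by metis
  ultimately show False
    by (simp add: fundamental_weight_def)
qed

text \<open>In a basis of weight vectors this is a sum of squares of integers. If it vanished,
  \<open>\<rho> (h k)\<close> would kill that basis, but it acts by 1 on the highest weight
  vector.\<close>

lemma trace_form_h: "trace_form (h k) (h k) \<noteq> 0"
proof
  assume zero: "trace_form (h k) (h k) = 0"
  obtain B where B: "B \<subseteq> weight_vectors" "vec.independent B" "weight_vectors \<subseteq> vec.span B"
    using vec.maximal_independent_subset by blast
  then have span: "vec.span B = UNIV"
    using vec.span_mono [OF B(3)] span_weight_vectors by (auto simp: vec.span_span)
  have "\<forall>b\<in>B. \<exists>c :: int. \<rho> (h k) *v b = of_int c *s b"
    using B(1) k_range by (auto simp: weight_vectors_def)
  then obtain c :: "complex ^ 'n \<Rightarrow> int" where c: "\<And>b. b \<in> B \<Longrightarrow> \<rho> (h k) *v b = of_int (c b) *s b"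
    by metis
  have "trace_form (h k) (h k) = (\<Sum>b\<in>B. of_int (c b * c b))"
    unfolding trace_form_def
    by (rule trace_eigenbasis [OF B(2) span])
       (simp add: matrix_vector_mul_assoc [symmetric] c matrix_vector_scale vector_smult_assoc)
  with zero have "of_int (\<Sum>b\<in>B. c b * c b) = (0 :: complex)"
    by (simp only: of_int_sum)
  then have "(\<Sum>b\<in>B. c b * c b) = 0"
    by (simp only: of_int_eq_0_iff)
  then have "\<forall>b\<in>B. c b * c b = 0"
    using vec.finiteI_independent [OF B(2)] by (subst (asm) sum_nonneg_eq_0_iff) auto
  then have "\<rho> (h k) *v b = 0" if "b \<in> B" for b
    using c [OF that] that by simp
  moreover have "v \<in> vec.span B" for v
    by (simp add: span)
  ultimately have "\<rho> (h k) *v v = 0" for v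
    using vec.linear_eq_0_on_span [OF matrix_vector_mul_linear_gen] by blast
  with rep_h_nonzero show False
    by (simp add: matrix_eq_zero_vector)
qed

text \<open>The radical of the trace form is an ideal, and it is not everything because of
  \<open>trace_form_h\<close>.\<close>

sublocale nondegenerate_lie_rep br \<rho>
proof
  let ?N = "{x. \<forall>y. trace_form x y = 0}"
  have "?N = {0}"
  proof (rule ccontr)
    assume "?N \<noteq> {0}"
    then have "?N = UNIV"
      by (intro adjoint_submodule) (auto simp: vec.subspace_def trace_form_add trace_form_scale trace_form_invariant)
    with trace_form_h show False by blast
  qed
  then show "x = 0" if "\<And>y. trace_form x y = 0" for x
    using that by blast
qed

text \<open>The span of the brackets is an ideal containing \<open>h k\<close>, which is nonzero.
  Linear statements about the Lie algebra may thus be checked on brackets.\<close>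

lemma perfect: "vec.span {br x y |x y. True} = UNIV"
proof (rule adjoint_submodule)
  show "br x y \<in> vec.span {br x y |x y. True}" for x y
    by (rule vec.span_base) blast
  show "vec.span {br x y |x y. True} \<noteq> {0}"
  proof
    assume "vec.span {br x y |x y. True} = {0}"
    then have z: "br x y = 0" for x y
      using vec.span_base [of "br x y" "{br x y |x y. True}"] by blast
    have "h k = 0"
      using chevalley(2) [OF k_range k_range] z by simp
    with rep_h_nonzero show False by simp
  qed
qed (rule vec.subspace_span)

lemma perfect_induct [case_names bracket subspace]:
  assumes "\<And>x y. Q (br x y)" and "vec.subspace {x. Q x}"
  shows "Q x"
proof -
  have "x \<in> vec.span {br x y |x y. True}"
    unfolding perfect by (rule UNIV_I)
  then show ?thesis
    by (induction rule: vec.span_induct) (use assms in auto)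
qed

lemma trace_rep: "trace (\<rho> x) = 0"
proof (induction x rule: perfect_induct)
  case (bracket x y)
  then show ?case
    by (simp add: rep_br trace_sub trace_mul_sym [of "\<rho> x"])
next
  case subspace
  then show ?case
    by (auto simp: vec.subspace_def rep_add rep_scale trace_add trace_scm trace_0 [simplified])
qed

lemma trace_casimir2: "trace casimir2 = 0"
  by (simp add: casimir2_def trace_sum trace_kron trace_rep)


section \<open>The projectors\<close>

lemma P_in: "i \<in> {1..4} \<Longrightarrow> P i *v w \<in> W i"
  and P_idem: "i \<in> {1..4} \<Longrightarrow> P i ** P i = P i"
  and P_range: "i \<in> {1..4} \<Longrightarrow> range ((*v) (P i)) = W i"
  and P_equivariant: "i \<in> {1..4} \<Longrightarrow> P i ** \<tau> x = \<tau> x ** P i"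
  using projectors [of i] by (auto simp: equivariant_projector_def)

lemma P_W: "i \<in> {1..4} \<Longrightarrow> w \<in> W i \<Longrightarrow> P i *v w = w"
  using P_idem [of i] P_range [of i] by (metis imageE matrix_vector_mul_assoc)

text \<open>Schur's lemma for \<open>P j ** A\<close> between non-isomorphic summands. For A the
  identity it gives orthogonality of the projectors, for A the operator \<open>casimir2\<close> it
  shows that every summand is preserved.\<close>

lemma equivariant_off_diagonal:
  assumes "\<And>x. A ** \<tau> x = \<tau> x ** A" "i \<in> {1..4}" "j \<in> {1..4}" "i \<noteq> j" "w \<in> W i"
  shows "P j *v (A *v w) = 0"
proof -
  have "(P j ** A) *v w = 0"
  proof (rule schur_zero [OF irreducible_W irreducible_W _ _ not_isomorphic_W \<open>w \<in> W i\<close>])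
    show "(P j ** A) *v w \<in> W j" for w
      using assms P_in by (simp add: matrix_vector_mul_assoc [symmetric])
    show "(P j ** A) *v (\<tau> x *v w) = \<tau> x *v ((P j ** A) *v w)" for x w
    proof -
      have "P j ** A ** \<tau> x = P j ** (\<tau> x ** A)"
        by (simp add: matrix_mul_assoc [symmetric] assms(1))
      also have "\<dots> = \<tau> x ** (P j ** A)"
        using P_equivariant [OF assms(3)] by (simp add: matrix_mul_assoc)
      finally show ?thesis
        by (simp add: matrix_vector_mul_assoc)
    qed
  qed (use assms in auto)
  then show ?thesis
    by (simp add: matrix_vector_mul_assoc)
qed

lemma P_W_other: "\<lbrakk>i \<in> {1..4}; j \<in> {1..4}; i \<noteq> j; w \<in> W i\<rbrakk> \<Longrightarrow> P j *v w = 0"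
  using equivariant_off_diagonal [of "mat 1" i j w] by simp

lemma P_mult: "\<lbrakk>i \<in> {1..4}; j \<in> {1..4}\<rbrakk> \<Longrightarrow> P i ** P j = (if i = j then P i else 0)"
  using P_idem [of i] P_W_other [of j i] P_in [of j]
  by (auto simp: matrix_eq_zero_vector matrix_vector_mul_assoc [symmetric])

lemma sym2_decomposition: "w \<in> sym2 \<Longrightarrow> P 1 *v w + P 3 *v w = w \<and> P 2 *v w = 0 \<and> P 4 *v w = 0"
  and W_sym2: "W 1 \<subseteq> sym2" "W 3 \<subseteq> sym2"
  and alt2_decomposition: "w \<in> alt2 \<Longrightarrow> P 2 *v w + P 4 *v w = w \<and> P 1 *v w = 0 \<and> P 3 *v w = 0"
  and W_alt2: "W 2 \<subseteq> alt2" "W 4 \<subseteq> alt2"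
proof -
  have dir: "internal_direct_sum (W 1) (W 3) sym2" "internal_direct_sum (W 2) (W 4) alt2"
    using decomposition by (simp_all add: e7_decomposition_def Let_def)
  have z: "0 \<in> W i" if "i \<in> {1..4}" for i
    using vec.subspace_0 irreducible_subspace [OF irreducible_W [OF that]] by blast
  have eq: "sym2 = {a + b |a b. a \<in> W 1 \<and> b \<in> W 3}" "alt2 = {a + b |a b. a \<in> W 2 \<and> b \<in> W 4}"
    using dir by (simp_all add: internal_direct_sum_def)
  show "P 1 *v w + P 3 *v w = w \<and> P 2 *v w = 0 \<and> P 4 *v w = 0" if "w \<in> sym2"
    using that unfolding eq by (auto simp: matrix_vector_right_distrib P_W P_W_other [of 1] P_W_other [of 3])
  show "P 2 *v w + P 4 *v w = w \<and> P 1 *v w = 0 \<and> P 3 *v w = 0" if "w \<in> alt2"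
    using that unfolding eq by (auto simp: matrix_vector_right_distrib P_W P_W_other [of 2] P_W_other [of 4])
  have "w + 0 \<in> sym2" if "w \<in> W 1" for w
    unfolding eq using that z [of 3] by force
  then show "W 1 \<subseteq> sym2" by auto
  have "0 + w \<in> sym2" if "w \<in> W 3" for w
    unfolding eq using that z [of 1] by force
  then show "W 3 \<subseteq> sym2" by auto
  have "w + 0 \<in> alt2" if "w \<in> W 2" for w
    unfolding eq using that z [of 4] by force
  then show "W 2 \<subseteq> alt2" by auto
  have "0 + w \<in> alt2" if "w \<in> W 4" for w
    unfolding eq using that z [of 2] by force
  then show "W 4 \<subseteq> alt2" by auto
qed

lemma P_sum: "(\<Sum>i\<in>{1..4}. P i) = mat 1"
proof -
  have "P 1 *v w + P 2 *v w + P 3 *v w + P 4 *v w = w" for w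
  proof -
    define u where "u = (1/2) *s (w + tensor_swap *v w)"
    define v where "v = (1/2) *s (w - tensor_swap *v w)"
    have "u \<in> sym2" "v \<in> alt2"
      by (auto simp: u_def v_def sym2_def alt2_def tensor_swap_vector_nth algebra_simps)
    note uv = sym2_decomposition [OF this(1)] alt2_decomposition [OF this(2)]
    have w: "w = u + v"
      by (simp add: u_def v_def vec_eq_iff field_simps)
    have z: "P 2 *v u = 0" "P 4 *v u = 0" "P 1 *v v = 0" "P 3 *v v = 0"
      using uv by blast+
    have "P 1 *v w + P 2 *v w + P 3 *v w + P 4 *v w = (P 1 *v u + P 3 *v u) + (P 2 *v v + P 4 *v v)"
      by (simp add: w matrix_vector_right_distrib z algebra_simps del: One_nat_def)
    also have "\<dots> = w"
      unfolding w using uv by metis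
    finally show ?thesis .
  qed
  then show ?thesis
    by (simp add: matrix_eq sum_1_4 matrix_vector_mult_add_rdistrib)
qed

text \<open>Odd indices are the symmetric summands, even indices the alternating ones.\<close>

definition swap_sign :: "nat \<Rightarrow> complex" where
  "swap_sign i = (if odd i then 1 else - 1)"

lemma index_cases:
  assumes "i \<in> {1..4::nat}" obtains "i = 1" | "i = 2" | "i = 3" | "i = 4"
  using assms by force

lemma swap_P: "i \<in> {1..4} \<Longrightarrow> tensor_swap ** P i = swap_sign i *m P i"
proof -
  assume i: "i \<in> {1..4}"
  have sym: "tensor_swap *v w = w" if "w \<in> sym2" for w :: "complex ^ ('n \<times> 'n)"
    using that by (simp add: vec_eq_iff tensor_swap_vector_nth sym2_def)
  have alt: "tensor_swap *v w = - w" if "w \<in> alt2" for w :: "complex ^ ('n \<times> 'n)"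
    using that unfolding alt2_def vec_eq_iff split_paired_All tensor_swap_vector_nth
      vector_uminus_component by blast
  have "tensor_swap *v (P i *v w) = swap_sign i *s (P i *v w)" for w
    using i P_in [OF i, of w] W_sym2 W_alt2
    by (cases i rule: index_cases) (simp_all add: swap_sign_def sym alt vector_sneg_minus1 [symmetric] subset_iff)
  then show ?thesis
    by (simp add: matrix_eq matrix_vector_mul_assoc [symmetric] scm_vector_mult)
qed

lemma swap_eq: "tensor_swap = (\<Sum>i\<in>{1..4}. swap_sign i *m P i)"
proof -
  have "tensor_swap = tensor_swap ** (\<Sum>i\<in>{1..4}. P i)"
    by (simp add: P_sum)
  also have "\<dots> = (\<Sum>i\<in>{1..4}. swap_sign i *m P i)"
    unfolding matrix_sum_right by (intro sum.cong refl swap_P)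
  finally show ?thesis .
qed

lemma P_spectral_mult: "i \<in> {1..4} \<Longrightarrow> P i ** (\<Sum>j\<in>{1..4}. c j *m P j) = c i *m P i"
  by (cases i rule: index_cases) (simp_all add: sum_1_4 matrix_ring_simps P_mult)

lemma P_swap: "i \<in> {1..4} \<Longrightarrow> P i ** tensor_swap = swap_sign i *m P i"
  unfolding swap_eq by (rule P_spectral_mult)

definition casimir_eigenvalue :: "nat \<Rightarrow> complex" where
  "casimir_eigenvalue i = (SOME c. \<forall>w\<in>W i. casimir2 *v w = c *s w)"

lemma casimir2_W:
  assumes i: "i \<in> {1..4}" and "w \<in> W i"
  shows "casimir2 *v w = casimir_eigenvalue i *s w"
proof -
  have in_W: "casimir2 *v w \<in> W i" if "w \<in> W i" for w
  proof -
    have "casimir2 *v w = (\<Sum>j\<in>{1..4}. P j *v (casimir2 *v w))"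
      unfolding matrix_vector_sum_left [symmetric] P_sum by simp
    also have "\<dots> = (\<Sum>j\<in>{i}. P j *v (casimir2 *v w))"
    proof (rule sum.mono_neutral_right)
      show "\<forall>j\<in>{1..4} - {i}. P j *v (casimir2 *v w) = 0"
        using equivariant_off_diagonal [OF casimir2_equivariant i _ _ that] by fast
    qed (use i in auto)
    also have "\<dots> = P i *v (casimir2 *v w)"
      by simp
    finally show ?thesis
      using P_in [OF i, of "casimir2 *v w"] by metis
  qed
  have "casimir2 *v (\<tau> x *v w) = \<tau> x *v (casimir2 *v w)" for x w
    unfolding matrix_vector_mul_assoc casimir2_equivariant ..
  then obtain c where "\<And>w. w \<in> W i \<Longrightarrow> casimir2 *v w = c *s w"
    using schur_scalar [OF irreducible_W [OF i] in_W] by blast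
  then have "\<exists>c. \<forall>w\<in>W i. casimir2 *v w = c *s w"
    by blast
  then have "\<forall>w\<in>W i. casimir2 *v w = casimir_eigenvalue i *s w"
    unfolding casimir_eigenvalue_def by (rule someI_ex)
  with assms(2) show ?thesis by blast
qed

lemma casimir2_P: "i \<in> {1..4} \<Longrightarrow> casimir2 ** P i = casimir_eigenvalue i *m P i"
  using P_in casimir2_W by (simp add: matrix_eq matrix_vector_mul_assoc [symmetric] scm_vector_mult)

lemma casimir2_eq: "casimir2 = (\<Sum>i\<in>{1..4}. casimir_eigenvalue i *m P i)"
proof -
  have "casimir2 = casimir2 ** (\<Sum>i\<in>{1..4}. P i)"
    by (simp add: P_sum)
  also have "\<dots> = (\<Sum>i\<in>{1..4}. casimir_eigenvalue i *m P i)"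
    unfolding matrix_sum_right by (intro sum.cong refl casimir2_P)
  finally show ?thesis .
qed

lemma P_casimir2: "i \<in> {1..4} \<Longrightarrow> P i ** casimir2 = casimir_eigenvalue i *m P i"
  unfolding casimir2_eq by (rule P_spectral_mult)

end

section \<open>The eigenvalues of the Casimir operator\<close>

text \<open>Here t1, t2, d and 1 are the dimensions of the summands and \<open>c i\<close> the
  eigenvalues of \<open>casimir2\<close>. The trace equations express c 2 and c 4 through d and
  leave two candidates for c 3; the cubic equation excludes one and then determines d.\<close>

lemma casimir_equations:
  fixes c :: "nat \<Rightarrow> complex" and d n t1 t2 :: complex
  assumes n: "n \<noteq> 0" "n + 1 \<noteq> 0" "n \<noteq> 2" "n + 16 \<noteq> 0" and d: "d \<noteq> 0" "d + 3 * (n + 1) \<noteq> 0" and t1: "t1 \<noteq> 0"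
    and tr1: "t1 + t2 + d + 1 = n\<^sup>2" and tr2: "t1 - t2 + d - 1 = n"
    and cas1: "c 1 * t1 + c 2 * t2 + c 3 * d + c 4 = 0"
    and cas2: "c 1 * t1 - c 2 * t2 + c 3 * d - c 4 = d"
    and cas3: "(c 1)\<^sup>2 * t1 + (c 2)\<^sup>2 * t2 + (c 3)\<^sup>2 * d + (c 4)\<^sup>2 = d"
    and c4: "n * c 4 = - d"
    and cubic: "2 * n * (c 3)\<^sup>2 = n * c 3 * (c 4 + - c 3) + n * c 2 * (c 4 + c 3) + 2 * c 2 - 2 * c 4"
  shows "(n + 16) * c 1 = 9" "(n + 16) * c 2 = - 3" "(n + 16) * c 3 = - (n + 7)"
    "(n + 16) * c 4 = - 3 * (n + 1)"
proof -
  \<comment> \<open>Twice a is the share of d in the dimension n (n + 1) / 2 of the symmetric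
    square, so 1 - 2 a vanishes exactly when \<open>W 1\<close> does.\<close>
  define a where "a = d / (n * (n + 1))"
  have da: "d = a * n * (n + 1)" and a0: "a \<noteq> 0"
    using n d by (simp_all add: a_def)
  have c4a: "c 4 = - a * (n + 1)"
  proof -
    have "n * (c 4 + a * (n + 1)) = 0"
      using c4 by (simp add: da algebra_simps)
    then have "c 4 + a * (n + 1) = 0"
      using n(1) by (simp only: mult_eq_0_iff simp_thms)
    then show ?thesis by algebra
  qed
  have t2: "2 * t2 = (n - 2) * (n + 1)"
  proof -
    have "2 * t2 = n\<^sup>2 - n - 2"
      unfolding tr1 [symmetric] using tr2 by (simp add: algebra_simps)
    then show ?thesis by (simp add: power2_eq_square algebra_simps)
  qed
  have t1a: "2 * t1 = n * (n + 1) * (1 - 2 * a)"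
  proof -
    have "2 * t1 = (t1 + t2 + d + 1) + (t1 - t2 + d - 1) - 2 * d"
      by (simp add: algebra_simps)
    also have "\<dots> = n\<^sup>2 + n - 2 * d"
      unfolding tr1 tr2 ..
    finally show ?thesis by (simp add: da power2_eq_square algebra_simps)
  qed
  have c2a: "c 2 = - a"
  proof -
    have "2 * (c 2 * t2 + c 4) = - d"
      using cas1 cas2 by algebra
    then have "c 2 * (2 * t2) = - d - 2 * c 4"
      by (simp add: algebra_simps)
    then have "(n - 2) * (n + 1) * (c 2 + a) = 0"
      unfolding t2 c4a da by (simp add: algebra_simps)
    with n show ?thesis by (simp add: eq_neg_iff_add_eq_0)
  qed
  have A: "(1 - 2 * a) * c 1 + 2 * a * c 3 = a"
  proof -
    have "2 * (c 1 * t1 + c 3 * d) = d"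
      using cas1 cas2 by algebra
    then have "c 1 * (2 * t1) + 2 * c 3 * d = d"
      by (simp add: algebra_simps)
    then have "n * (n + 1) * ((1 - 2 * a) * c 1 + 2 * a * c 3 - a) = 0"
      unfolding t1a da by (simp add: algebra_simps)
    with n show ?thesis by simp
  qed
  have B: "(1 - 2 * a) * (c 1)\<^sup>2 + 2 * a * (c 3)\<^sup>2 + 3 * a\<^sup>2 = 2 * a"
  proof -
    have "(c 1)\<^sup>2 * (2 * t1) + (c 2)\<^sup>2 * (2 * t2) + 2 * (c 3)\<^sup>2 * d + 2 * (c 4)\<^sup>2 = 2 * d"
      using arg_cong [OF cas3, of "\<lambda>x. 2 * x"] by (simp add: algebra_simps)
    then have "n * (n + 1) * ((1 - 2 * a) * (c 1)\<^sup>2 + 2 * a * (c 3)\<^sup>2 + 3 * a\<^sup>2 - 2 * a) = 0"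
      unfolding t1a t2 c2a c4a da by (simp add: algebra_simps power2_eq_square)
    with n show ?thesis by simp
  qed
  \<comment> \<open>Multiplied by 1 - 2 a, equation \<open>B\<close> contains c 1 only through (1 -
    2 a) c 1, which \<open>A\<close> expresses by c 3; the resulting quadratic splits.\<close>
  have "2 * a * ((c 3 - (3 * a - 1)) * (c 3 - (1 - a)))
      = (a - 2 * a * c 3)\<^sup>2 + (1 - 2 * a) * (2 * a * (c 3)\<^sup>2 + 3 * a\<^sup>2 - 2 * a)"
    by algebra
  also have "a - 2 * a * c 3 = (1 - 2 * a) * c 1"
    using A by (simp add: algebra_simps)
  also have "((1 - 2 * a) * c 1)\<^sup>2 + (1 - 2 * a) * (2 * a * (c 3)\<^sup>2 + 3 * a\<^sup>2 - 2 * a)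
      = (1 - 2 * a) * ((1 - 2 * a) * (c 1)\<^sup>2 + 2 * a * (c 3)\<^sup>2 + 3 * a\<^sup>2 - 2 * a)"
    by algebra
  also have "\<dots> = 0"
    unfolding B by simp
  finally have "2 * a * ((c 3 - (3 * a - 1)) * (c 3 - (1 - a))) = 0" .
  with a0 consider "c 3 = 3 * a - 1" | "c 3 = 1 - a"
    by auto
  moreover have a_half: "1 - 2 * a \<noteq> 0"
    using t1 t1a by auto
  have C: "3 * (c 3)\<^sup>2 + a * (n + 2) * c 3 - a\<^sup>2 * (n + 1) - 2 * a = 0"
  proof -
    have "n * (3 * (c 3)\<^sup>2 + a * (n + 2) * c 3 - a\<^sup>2 * (n + 1) - 2 * a) = 0"
      using cubic unfolding c2a c4a by algebra
    with n show ?thesis by simp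
  qed
  have an: "3 + a * n \<noteq> 0"
  proof
    assume "3 + a * n = 0"
    then have "(3 + a * n) * (n + 1) = 0" by simp
    with d show False by (simp add: da algebra_simps)
  qed
  ultimately have c3: "c 3 = 3 * a - 1"
  proof cases
    \<comment> \<open>For this root the cubic equation becomes (1 - 2 a) (3 + a n) = 0; the first
      factor is excluded by \<open>t1\<close>, the second by the assumption on d.\<close>
    case 2
    have "(1 - 2 * a) * (3 + a * n) = 0"
      using C unfolding 2 by algebra
    with a_half an show ?thesis by simp
  qed
  have "(1 - 2 * a) * ((n + 16) * a - 3) = 0"
    using C unfolding c3 by algebra
  with a_half have a: "(n + 16) * a = 3" by simp
  have "(1 - 2 * a) * (c 1 - 3 * a) = ((1 - 2 * a) * c 1 + 2 * a * c 3) - a"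
    unfolding c3 by (simp add: algebra_simps)
  then have "(1 - 2 * a) * (c 1 - 3 * a) = 0"
    unfolding A by simp
  with a_half have c1: "c 1 = 3 * a" by simp
  have "(n + 16) * c 1 = 3 * ((n + 16) * a)" "(n + 16) * c 2 = - ((n + 16) * a)"
    "(n + 16) * c 3 = 3 * ((n + 16) * a) - (n + 16)" "(n + 16) * c 4 = - ((n + 16) * a) * (n + 1)"
    unfolding c1 c2a c3 c4a by (simp_all add: algebra_simps)
  then show "(n + 16) * c 1 = 9" "(n + 16) * c 2 = - 3" "(n + 16) * c 3 = - (n + 7)"
    "(n + 16) * c 4 = - 3 * (n + 1)"
    unfolding a by simp_all
qed

lemma trace_mat: "trace (mat c :: 'a::comm_semiring_1 ^ 'n ^ 'n) = c * of_nat CARD('n)"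
  by (simp add: trace_def mat_def mult.commute)

context e7_rep
begin

lemma linear_vecI:
  fixes F :: "complex ^ 'a::finite \<Rightarrow> complex ^ 'b::finite"
  assumes "\<And>x y. F (x + y) = F x + F y" "\<And>c x. F (c *s x) = c *s F x"
  shows "Vector_Spaces.linear (*s) (*s) F"
  using assms by (simp add: Vector_Spaces.linear_iff vec.vector_space_axioms)

section \<open>The invariant bivector as an invertible matrix\<close>

definition invariant_form :: "complex ^ 'n ^ 'n" (\<open>J\<close>) where
  "J = (SOME M. tens M \<in> W 4 \<and> M \<noteq> 0)"

lemma J_W4: "tens J \<in> W 4" and J_nonzero: "J \<noteq> 0"
proof -
  have "irreducible_submodule \<tau> (W 4)"
    by (rule irreducible_W) simp
  then have "W 4 \<noteq> {0}" "0 \<in> W 4"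
    using vec.subspace_0 by (auto simp: irreducible_submodule_def lie_submodule_def)
  then obtain w where w: "w \<in> W 4" "w \<noteq> 0" by blast
  obtain M where "w = tens M" by (rule tens_cases)
  with w have "\<exists>M. tens M \<in> W 4 \<and> M \<noteq> 0" by auto
  from someI_ex [OF this] show "tens J \<in> W 4" "J \<noteq> 0"
    by (simp_all add: invariant_form_def)
qed

lemma \<tau>_W4: "w \<in> W 4 \<Longrightarrow> \<tau> x *v w = 0"
  using decomposition by (simp add: e7_decomposition_def Let_def)

lemma J_invariant: "J ** transpose (\<rho> x) = - (\<rho> x ** J)"
  using \<tau>_W4 [OF J_W4, of x] by (simp add: tensor_square_tens eq_neg_iff_add_eq_0 add.commute)

lemma J_transpose: "transpose J = - J"
  using J_W4 W_alt2 tens_alt2 by blast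

lemma W4_J:
  assumes "w \<in> W 4"
  obtains c where "w = c *s tens J"
proof -
  have "{c *s tens J |c. True} = W 4"
  proof (rule irreducible_eq [OF irreducible_W])
    show "vec.subspace {c *s tens J |c. True}"
      unfolding vec.subspace_def
      by (auto simp: vector_smult_assoc intro: exI [of _ "0 :: complex"])
         (metis vector_sadd_rdistrib)
    show "{c *s tens J |c. True} \<subseteq> W 4"
      using J_W4 vec.subspace_scale irreducible_subspace [OF irreducible_W [of 4]] by auto
    show "\<tau> x *v w \<in> {c *s tens J |c. True}" if "w \<in> {c *s tens J |c. True}" for x w
      using that by (auto simp: matrix_vector_scale \<tau>_W4 [OF J_W4] intro: exI [of _ "0 :: complex"])
    have "1 *s tens J \<in> {c *s tens J |c. True}" by blast
    moreover have "1 *s tens J \<noteq> 0"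
      using J_nonzero by simp
    ultimately show "{c *s tens J |c. True} \<noteq> {0}" by blast
  qed simp
  with assms show thesis using that by blast
qed

text \<open>\<open>J\<close> intertwines the dual action with \<rho>, so its range is a nonzero
  submodule of V.\<close>

lemma J_surj: "range ((*v) J) = UNIV"
proof (rule irreducible_eq [OF irreducible_rep])
  show "vec.subspace (range ((*v) J))"
    by (intro vec.linear_subspace_image matrix_vector_mul_linear_gen vec.subspace_UNIV)
  show "\<rho> x *v w \<in> range ((*v) J)" if w: "w \<in> range ((*v) J)" for x w
  proof -
    obtain v where "w = J *v v" using w by blast
    then have "\<rho> x *v w = J *v - (transpose (\<rho> x) *v v)"
      using arg_cong [OF J_invariant [of x], of "\<lambda>M. - (M *v v)"]
      by (simp only: matrix_vector_minus matrix_vector_mul_assoc)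
         (simp add: vec_eq_iff matrix_vector_mult_def sum_negf)
    then show ?thesis by blast
  qed
  have "\<exists>v. J *v v \<noteq> 0"
    using J_nonzero by (simp add: matrix_eq_zero_vector)
  then show "range ((*v) J) \<noteq> {0}" by blast
qed simp

definition J_inv :: "complex ^ 'n ^ 'n" where
  "J_inv = (SOME M. J ** M = mat 1)"

lemma J_inverse: "J ** J_inv = mat 1" "J_inv ** J = mat 1"
proof -
  have "\<exists>M. J ** M = mat 1"
    using J_surj by (simp add: matrix_right_invertible_surjective)
  then show "J ** J_inv = mat 1"
    unfolding J_inv_def by (rule someI_ex)
  then show "J_inv ** J = mat 1"
    by (simp add: matrix_left_right_inverse)
qed

lemma J_cancel: "A ** J = B ** J \<Longrightarrow> A = B"
  using J_inverse(1) by (metis matrix_mul_assoc matrix_mul_rid)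

lemma rep_J_sym: "transpose (\<rho> y ** J) = \<rho> y ** J"
  by (simp add: matrix_transpose_mul J_transpose matrix_minus_left J_invariant)

lemma \<tau>_rep_J: "\<tau> x *v tens (\<rho> y ** J) = tens (\<rho> (br x y) ** J)"
  by (simp add: tensor_square_tens rep_br matrix_ring_simps matrix_mul_assoc [symmetric] J_invariant)

text \<open>The map \<open>y \<mapsto> \<rho> y J\<close> is equivariant from the adjoint module, which is \<open>W 3\<close>, so it has no
  component in \<open>W 1\<close>.\<close>

lemma P1_rep_J: "P 1 *v tens (\<rho> y ** J) = 0"
proof -
  obtain F where F: "bij_betw ((*v) F) (W 3) UNIV"
    "\<And>x w. w \<in> W 3 \<Longrightarrow> F *v (\<tau> x *v w) = adjoint_rep br x *v (F *v w)"
    using isomorphic_adjoint unfolding isomorphic_submodules_def by blast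
  have lin: "Vector_Spaces.linear (*s) (*s) (\<lambda>y. tens (\<rho> y ** J))"
    by (rule linear_vecI) (simp_all add: rep_add rep_scale matrix_ring_simps tens_add tens_scm)
  define G where "G = P 1 ** matrix (\<lambda>y. tens (\<rho> y ** J)) ** F"
  have G: "G *v w = P 1 *v tens (\<rho> (F *v w) ** J)" for w
    by (simp add: G_def matrix_vector_mul_assoc [symmetric] matrix_works [OF lin])
  have P1: "P 1 *v (\<tau> x *v w) = \<tau> x *v (P 1 *v w)" for x w
    using P_equivariant [of 1 x] by (simp add: matrix_vector_mul_assoc)
  have zero: "G *v w = 0" if "w \<in> W 3" for w
  proof (rule schur_zero [OF irreducible_W irreducible_W _ _ not_isomorphic_W that])
    show "G *v w \<in> W 1" for w
      by (simp add: G P_in)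
    show "G *v (\<tau> x *v w) = \<tau> x *v (G *v w)" if "w \<in> W 3" for x w
      using that by (simp add: G F(2) P1 [symmetric] \<tau>_rep_J)
  qed simp_all
  have "y \<in> (*v) F ` W 3"
    using F(1) by (simp add: bij_betw_def)
  then show ?thesis
    using zero by (auto simp: G)
qed

lemma rep_J_W3: "tens (\<rho> y ** J) \<in> W 3"
proof -
  have "tens (\<rho> y ** J) \<in> sym2"
    by (simp add: tens_sym2 rep_J_sym)
  then have "P 3 *v tens (\<rho> y ** J) = tens (\<rho> y ** J)"
    using sym2_decomposition [of "tens (\<rho> y ** J)"] P1_rep_J [of y] by simp
  then show ?thesis
    using P_in [of 3 "tens (\<rho> y ** J)"] by simp
qed

section \<open>The Casimir operator on endomorphisms of V, and the cubic contraction\<close>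

abbreviation E where "E a \<equiv> \<rho> (std_basis a)"
abbreviation D where "D a \<equiv> \<rho> (dual_basis a)"

text \<open>Under Y \<mapsto> \<open>tens (Y ** J)\<close>, which identifies endomorphisms of V with
  bivectors, \<open>casimir2\<close> becomes minus this map; the sign comes from moving
  \<open>D a\<close> past \<open>J\<close>. Scalars land in \<open>W 4\<close> and the matrices
  \<open>\<rho> y\<close> in \<open>W 3\<close>.\<close>

definition sandwich :: "complex ^ 'n ^ 'n \<Rightarrow> complex ^ 'n ^ 'n" where
  "sandwich Y = (\<Sum>a\<in>UNIV. E a ** Y ** D a)"

lemma casimir2_tens_J: "casimir2 *v tens (Y ** J) = - tens (sandwich Y ** J)"
proof -
  have "E a ** (Y ** J) ** transpose (D a) = - (E a ** Y ** D a ** J)" for a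
    by (simp add: matrix_mul_assoc [symmetric] J_invariant matrix_minus_right)
  then show ?thesis
    by (simp add: casimir2_tens sandwich_def matrix_sum_left sum_negf tens_minus)
qed

lemma sandwich_eigen:
  assumes "i \<in> {1..4}" "tens (Y ** J) \<in> W i"
  shows "sandwich Y = - casimir_eigenvalue i *m Y"
proof (rule J_cancel)
  have "tens (sandwich Y ** J) = tens ((- casimir_eigenvalue i *m Y) ** J)"
    using casimir2_W [OF assms] unfolding casimir2_tens_J scm_mult_left tens_scm
    by (simp add: neg_eq_iff_add_eq_0 eq_neg_iff_add_eq_0 vec_eq_iff)
  then show "sandwich Y ** J = (- casimir_eigenvalue i *m Y) ** J"
    by simp
qed

lemma sandwich_one: "sandwich (mat 1) = mat (- casimir_eigenvalue 4)"
  using sandwich_eigen [of 4 "mat 1"] J_W4 by (simp add: scm_mat)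

lemma sandwich_rep: "sandwich (\<rho> y) = - casimir_eigenvalue 3 *m \<rho> y"
  using sandwich_eigen [of 3 "\<rho> y"] rep_J_W3 by simp

text \<open>The invariant functional given by the trace, multiplied by the fixed vector
  \<open>tens J\<close>, is an equivariant map into \<open>W 4\<close> and so vanishes on
  \<open>W 2\<close>. Hence the component of Y in \<open>W 4\<close>, a scalar matrix, carries the
  whole trace of Y.\<close>

lemma alt_traceless_W2:
  assumes alt: "tens (Y ** J) \<in> alt2" and tr: "trace Y = 0"
  shows "tens (Y ** J) \<in> W 2"
proof -
  let ?f = "\<lambda>w. trace ((\<chi> i j. w $ (i, j)) ** J_inv) *s tens J"
  have lin: "Vector_Spaces.linear (*s) (*s) ?f"
  proof (rule linear_vecI)
    fix x y :: "complex ^ ('n \<times> 'n)" and c :: complex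
    have "(\<chi> i j. (x + y) $ (i, j)) = (\<chi> i j. x $ (i, j)) + (\<chi> i j. y $ (i, j))"
      "(\<chi> i j. (c *s x) $ (i, j)) = c *m (\<chi> i j. x $ (i, j))"
      by (simp_all add: vec_eq_iff)
    then show "?f (x + y) = ?f x + ?f y" "?f (c *s x) = c *s ?f x"
      by (simp_all only: matrix_add_rdistrib trace_add vector_sadd_rdistrib scm_mult_left trace_scm vector_smult_assoc)
  qed
  define F where "F = matrix ?f"
  have F: "F *v tens M = trace (M ** J_inv) *s tens J" for M
    by (simp add: F_def matrix_works [OF lin])
  have inv: "F *v (\<tau> x *v w) = 0" for x w
  proof -
    obtain M where w: "w = tens M" by (rule tens_cases)
    have "J_inv ** \<rho> x = J_inv ** (\<rho> x ** J) ** J_inv"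
      by (simp add: matrix_mul_assoc [symmetric] J_inverse)
    also have "\<dots> = - (J_inv ** (J ** transpose (\<rho> x)) ** J_inv)"
      by (simp add: J_invariant matrix_minus_left matrix_minus_right)
    also have "\<dots> = - (transpose (\<rho> x) ** J_inv)"
      by (simp add: matrix_mul_assoc J_inverse)
    finally have J'x: "J_inv ** \<rho> x = - (transpose (\<rho> x) ** J_inv)" .
    have "trace (\<rho> x ** M ** J_inv) = trace (M ** (J_inv ** \<rho> x))"
      using trace_mul_sym [of "\<rho> x" "M ** J_inv"] by (simp add: matrix_mul_assoc)
    then show ?thesis
      by (simp add: w tensor_square_tens F matrix_ring_simps trace_add J'x trace_minus matrix_mul_assoc)
  qed
  have zero: "F *v w = 0" if "w \<in> W 2" for w
  proof (rule schur_zero [OF irreducible_W irreducible_W _ _ not_isomorphic_W that])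
    show "F *v w \<in> W 4" for w
    proof -
      obtain M where w: "w = tens M" by (rule tens_cases)
      show ?thesis
        using J_W4 vec.subspace_scale irreducible_subspace [OF irreducible_W [of 4]] by (simp add: w F)
    qed
    then show "F *v (\<tau> x *v w) = \<tau> x *v (F *v w)" for x w
      by (simp add: inv \<tau>_W4)
  qed simp_all
  obtain c where c: "P 4 *v tens (Y ** J) = c *s tens J"
    using W4_J [OF P_in] by (metis atLeastAtMost_iff le_refl one_le_numeral)
  have "P 2 *v tens (Y ** J) = tens ((Y - mat c) ** J)"
    using alt2_decomposition [OF alt] c
    by (simp add: matrix_diff_rdistrib mat_mult_scm tens_diff tens_scm algebra_simps)
  moreover have "F *v (P 2 *v tens (Y ** J)) = 0"
    by (rule zero [OF P_in]) simp
  ultimately have "F *v tens ((Y - mat c) ** J) = 0"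
    by simp
  then have "trace (Y - mat c) = 0"
    using J_nonzero by (simp add: F matrix_mul_assoc [symmetric] J_inverse)
  then have "c * of_nat CARD('n) = 0"
    by (simp add: trace_sub tr trace_mat)
  then have "c = 0" by simp
  with \<open>P 2 *v tens (Y ** J) = tens ((Y - mat c) ** J)\<close> have "P 2 *v tens (Y ** J) = tens (Y ** J)"
    by simp
  then show ?thesis
    using P_in [of 2 "tens (Y ** J)"] by simp
qed

lemma sandwich_scm: "sandwich (c *m Y) = c *m sandwich Y"
  and sandwich_add: "sandwich (Y + Z) = sandwich Y + sandwich Z"
  by (simp_all add: sandwich_def matrix_ring_simps scm_sum sum.distrib)

lemma sandwich_mat: "sandwich (mat c) = - casimir_eigenvalue 4 *m mat c"
  using sandwich_scm [of c "mat 1"] by (simp add: scm_mat sandwich_one mult.commute)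

text \<open>Twice the product is the commutator, in \<open>W 3\<close>, plus the traceless part of
  the anticommutator, in \<open>W 2\<close>, plus a scalar, in \<open>W 4\<close>; each is an
  eigenvector of \<open>sandwich\<close>.\<close>

lemma sandwich_product:
  "2 *m sandwich (\<rho> x ** \<rho> y) =
    - casimir_eigenvalue 3 *m (\<rho> x ** \<rho> y - \<rho> y ** \<rho> x)
    + - casimir_eigenvalue 2 *m (\<rho> x ** \<rho> y + \<rho> y ** \<rho> x - mat (2 * trace_form x y / of_nat CARD('n)))
    + - casimir_eigenvalue 4 *m mat (2 * trace_form x y / of_nat CARD('n))"
proof -
  let ?c = "2 * trace_form x y / of_nat CARD('n)"
  let ?Z = "\<rho> x ** \<rho> y + \<rho> y ** \<rho> x - mat ?c"
  have "transpose (\<rho> x ** \<rho> y ** J) = - (\<rho> y ** \<rho> x ** J)" for x y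
    by (simp add: matrix_transpose_mul J_transpose matrix_minus_left matrix_mul_assoc J_invariant)
       (simp add: matrix_mul_assoc [symmetric] J_invariant matrix_minus_right)
  then have "transpose (?Z ** J) = - (?Z ** J)"
    by (simp add: matrix_ring_simps transpose_add transpose_diff mat_mult_scm transpose_scm J_transpose scm_minus)
  moreover have "trace ?Z = 0"
    by (simp add: trace_add trace_sub trace_mat trace_form_def [symmetric] trace_form_sym [of y x])
  ultimately have "sandwich ?Z = - casimir_eigenvalue 2 *m ?Z"
    by (intro sandwich_eigen alt_traceless_W2) (simp_all add: tens_alt2)
  moreover have "sandwich (\<rho> x ** \<rho> y - \<rho> y ** \<rho> x) = - casimir_eigenvalue 3 *m (\<rho> x ** \<rho> y - \<rho> y ** \<rho> x)"
    using sandwich_rep [of "br x y"] by (simp add: rep_br)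
  moreover have "2 *m (\<rho> x ** \<rho> y) = (\<rho> x ** \<rho> y - \<rho> y ** \<rho> x) + ?Z + mat ?c"
    by (simp add: vec_eq_iff)
  ultimately show ?thesis
    by (simp only: sandwich_scm [symmetric] sandwich_add sandwich_mat)
qed

lemma trace_sandwich_E_D: "(\<Sum>a\<in>UNIV. trace (sandwich (E a) ** D a)) = - casimir_eigenvalue 3 * of_nat CARD('g)"
  by (simp add: sandwich_rep scm_mult_left trace_scm trace_form_def [symmetric] trace_form_dual)

text \<open>Both sides evaluate the contraction \<open>\<Sum>a b c. trace (E a E b E c D b D a D c)\<close>: on the left by
  contracting \<open>b\<close> and then \<open>a\<close>, on the right by contracting \<open>c\<close>. In the latter \<open>D b D a\<close> has no
  component in \<open>W 1\<close>, because its commutator lies in the Lie algebra.\<close>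

lemma casimir_cubic:
  "2 * of_nat CARD('n) * (casimir_eigenvalue 3)\<^sup>2 =
    of_nat CARD('n) * casimir_eigenvalue 3 * (casimir_eigenvalue 4 + - casimir_eigenvalue 3)
    + of_nat CARD('n) * casimir_eigenvalue 2 * (casimir_eigenvalue 4 + casimir_eigenvalue 3)
    + 2 * casimir_eigenvalue 2 - 2 * casimir_eigenvalue 4"
proof -
  let ?n = "of_nat CARD('n) :: complex" and ?d = "of_nat CARD('g) :: complex"
  let ?c2 = "casimir_eigenvalue 2" and ?c3 = "casimir_eigenvalue 3" and ?c4 = "casimir_eigenvalue 4"
  define S where "S = (\<Sum>a\<in>UNIV. \<Sum>b\<in>UNIV. trace (E a ** E b ** sandwich (D b ** D a)))"
  have "S = (\<Sum>a\<in>UNIV. \<Sum>b\<in>UNIV. \<Sum>c\<in>UNIV. trace (E a ** E b ** E c ** D b ** D a ** D c))"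
    by (simp add: S_def sandwich_def matrix_sum_right trace_sum matrix_mul_assoc)
  also have "\<dots> = (\<Sum>a\<in>UNIV. \<Sum>c\<in>UNIV. \<Sum>b\<in>UNIV. trace (E a ** E b ** E c ** D b ** D a ** D c))"
    by (intro sum.cong refl sum.swap)
  also have "\<dots> = (\<Sum>c\<in>UNIV. \<Sum>a\<in>UNIV. \<Sum>b\<in>UNIV. trace (E a ** E b ** E c ** D b ** D a ** D c))"
    by (rule sum.swap)
  also have "\<dots> = (\<Sum>c\<in>UNIV. trace (sandwich (sandwich (E c)) ** D c))"
    by (simp add: sandwich_def matrix_sum_left matrix_sum_right trace_sum matrix_mul_assoc)
  also have "\<dots> = ?c3\<^sup>2 * ?d"
    by (simp add: sandwich_rep sandwich_scm scm_mult_left trace_scm trace_form_def [symmetric] trace_form_dual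
        power2_eq_square scm_scm)
  finally have S1: "S = ?c3\<^sup>2 * ?d" .
  have "2 * trace (E a ** E b ** sandwich (D b ** D a)) =
      (- ?c3 - ?c2) * trace (E a ** E b ** D b ** D a) + (?c3 - ?c2) * trace (E a ** E b ** D a ** D b)
      + (?c2 - ?c4) * (2 / ?n) * (trace_form (std_basis b) (std_basis a) * trace_form (dual_basis b) (dual_basis a))"
    for a b
  proof -
    have "2 * trace (E a ** E b ** sandwich (D b ** D a)) = trace (E a ** E b ** (2 *m sandwich (D b ** D a)))"
      by (simp add: scm_mult_right trace_scm)
    also have "\<dots> = (- ?c3 - ?c2) * trace (E a ** E b ** D b ** D a) + (?c3 - ?c2) * trace (E a ** E b ** D a ** D b)
        + (?c2 - ?c4) * (2 / ?n) * (trace (E a ** E b) * trace_form (dual_basis b) (dual_basis a))"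
      unfolding sandwich_product
      by (simp add: matrix_ring_simps mult_mat_scm trace_add trace_sub trace_scm matrix_mul_assoc
          algebra_simps add_divide_distrib diff_divide_distrib)
    finally show ?thesis
      by (simp add: trace_form_def [symmetric] trace_form_sym [of "std_basis b"])
  qed
  then have "2 * S = (- ?c3 - ?c2) * (\<Sum>a\<in>UNIV. \<Sum>b\<in>UNIV. trace (E a ** E b ** D b ** D a))
      + (?c3 - ?c2) * (\<Sum>a\<in>UNIV. \<Sum>b\<in>UNIV. trace (E a ** E b ** D a ** D b))
      + (?c2 - ?c4) * (2 / ?n) * (\<Sum>a\<in>UNIV. \<Sum>b\<in>UNIV.
          trace_form (std_basis b) (std_basis a) * trace_form (dual_basis b) (dual_basis a))"
    by (simp only: S_def sum_distrib_left sum.distrib)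
  also have "(\<Sum>a\<in>UNIV. \<Sum>b\<in>UNIV. trace (E a ** E b ** D b ** D a)) = - ?c4 * ?d"
  proof -
    have "(\<Sum>b\<in>UNIV. trace (E a ** E b ** D b ** D a)) = trace (E a ** sandwich (mat 1) ** D a)" for a
      by (simp add: sandwich_def matrix_sum_left matrix_sum_right trace_sum matrix_mul_assoc)
    then show ?thesis
      by (simp add: sandwich_one mult_mat_scm scm_mult_left trace_scm trace_form_def [symmetric] trace_form_dual)
  qed
  \<comment> \<open>After the exchange of sums the inner sum over a is the trace of
    \<open>sandwich (E b)\<close> times \<open>D b\<close>.\<close>
  also have "(\<Sum>a\<in>UNIV. \<Sum>b\<in>UNIV. trace (E a ** E b ** D a ** D b)) = - ?c3 * ?d"
    by (subst sum.swap, subst trace_sandwich_E_D [symmetric])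
       (simp add: sandwich_def matrix_sum_left trace_sum)
  finally have "2 * (?c3\<^sup>2 * ?d) = (- ?c3 - ?c2) * (- ?c4 * ?d) + (?c3 - ?c2) * (- ?c3 * ?d)
      + (?c2 - ?c4) * (2 / ?n) * ?d"
    unfolding S1 sum_gram_dual_gram .
  then have "?d * (2 * ?c3\<^sup>2) = ?d * ((?c3 + ?c2) * ?c4 - (?c3 - ?c2) * ?c3 + (?c2 - ?c4) * (2 / ?n))"
    by (simp add: algebra_simps)
  then have "2 * ?c3\<^sup>2 = (?c3 + ?c2) * ?c4 - (?c3 - ?c2) * ?c3 + (?c2 - ?c4) * (2 / ?n)"
    by (simp only: mult_cancel_left) simp
  then have "?n * (2 * ?c3\<^sup>2) = ?n * ((?c3 + ?c2) * ?c4 - (?c3 - ?c2) * ?c3) + ?n * ((?c2 - ?c4) * (2 / ?n))"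
    by (simp only: distrib_left [symmetric])
  also have "?n * ((?c2 - ?c4) * (2 / ?n)) = 2 * (?c2 - ?c4)"
    by simp
  finally show ?thesis
    by (simp add: algebra_simps power2_eq_square)
qed

section \<open>Trace equations and the resulting eigenvalues\<close>

lemma trace_P: "i \<in> {1..4} \<Longrightarrow> trace (P i) = of_nat (vec.dim (W i))"
  using trace_idempotent [OF P_idem] P_range by simp

lemma dim_W3: "vec.dim (W 3) = CARD('g)"
proof -
  obtain F :: "complex ^ ('n \<times> 'n) ^ 'g" where F: "bij_betw ((*v) F) (W 3) UNIV"
    using isomorphic_adjoint unfolding isomorphic_submodules_def by blast
  have span: "vec.span (W 3) = W 3"
    using irreducible_subspace [OF irreducible_W [of 3]] by (simp only: vec.span_eq_iff) simp
  have "vec.dim ((*v) F ` W 3) = vec.dim (W 3)"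
  proof (rule vec.dim_image_eq [OF matrix_vector_mul_linear_gen])
    show "inj_on ((*v) F) (vec.span (W 3))"
      unfolding span using F by (simp add: bij_betw_def)
  qed
  then show ?thesis
    using F by (simp add: bij_betw_def card_cart_basis)
qed

lemma casimir_eigenvalues:
  "(2 * of_nat m + 8) * casimir_eigenvalue 1 = 3"
  "(2 * of_nat m + 8) * casimir_eigenvalue 2 = - 1"
  "(2 * of_nat m + 8) * casimir_eigenvalue 3 = - (2 * of_nat m + 5)"
  "(2 * of_nat m + 8) * casimir_eigenvalue 4 = - (6 * of_nat m + 9)"
proof -
  let ?n = "of_nat CARD('n) :: complex" and ?d = "of_nat CARD('g) :: complex"
  have n: "?n = 6 * of_nat m + 8"
    by (simp add: card_n)
  have t4: "trace (P 4) = 1"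
    using decomposition by (simp add: trace_P e7_decomposition_def Let_def)
  have t3: "trace (P 3) = ?d"
    by (simp add: trace_P dim_W3)
  have t1: "trace (P 1) \<noteq> 0"
  proof -
    have "irreducible_submodule \<tau> (W 1)"
      by (rule irreducible_W) simp
    then have "\<not> W 1 \<subseteq> {0}"
      using vec.subspace_0 unfolding irreducible_submodule_def lie_submodule_def by blast
    then have "vec.dim (W 1) \<noteq> 0"
      unfolding vec.dim_eq_0 .
    then show ?thesis by (simp add: trace_P)
  qed
  have "trace (\<Sum>i\<in>{1..4}. P i) = ?n\<^sup>2"
    unfolding P_sum by (simp add: trace_I power2_eq_square)
  then have e1: "trace (P 1) + trace (P 2) + ?d + 1 = ?n\<^sup>2"
    by (simp add: sum_1_4 trace_add t3 t4)
  have "trace (\<Sum>i\<in>{1..4}. swap_sign i *m P i) = ?n"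
    unfolding swap_eq [symmetric] by (rule trace_tensor_swap)
  then have e2: "trace (P 1) - trace (P 2) + ?d - 1 = ?n"
    by (simp add: sum_1_4 trace_add trace_scm t3 t4 swap_sign_def)
  have "trace (\<Sum>i\<in>{1..4}. casimir_eigenvalue i *m P i) = 0"
    unfolding casimir2_eq [symmetric] by (rule trace_casimir2)
  then have e3: "casimir_eigenvalue 1 * trace (P 1) + casimir_eigenvalue 2 * trace (P 2)
      + casimir_eigenvalue 3 * ?d + casimir_eigenvalue 4 = 0"
    by (simp add: sum_1_4 trace_add trace_scm t3 t4)
  have "tensor_swap ** (\<Sum>i\<in>{1..4}. casimir_eigenvalue i *m P i)
      = (\<Sum>i\<in>{1..4}. casimir_eigenvalue i *m (tensor_swap ** P i))"
    by (simp only: matrix_sum_right scm_mult_right)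
  then have "trace (\<Sum>i\<in>{1..4}. casimir_eigenvalue i *m (tensor_swap ** P i)) = ?d"
    by (metis casimir2_eq trace_swap_casimir2)
  then have e4: "casimir_eigenvalue 1 * trace (P 1) - casimir_eigenvalue 2 * trace (P 2)
      + casimir_eigenvalue 3 * ?d - casimir_eigenvalue 4 = ?d"
    by (simp add: sum_1_4 trace_add trace_scm t3 t4 swap_P swap_sign_def)
  have "casimir2 ** (\<Sum>i\<in>{1..4}. casimir_eigenvalue i *m P i)
      = (\<Sum>i\<in>{1..4}. casimir_eigenvalue i *m (casimir2 ** P i))"
    by (simp only: matrix_sum_right scm_mult_right)
  then have "trace (\<Sum>i\<in>{1..4}. casimir_eigenvalue i *m (casimir2 ** P i)) = ?d"
    by (metis casimir2_eq trace_casimir2_squared)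
  then have e5: "(casimir_eigenvalue 1)\<^sup>2 * trace (P 1) + (casimir_eigenvalue 2)\<^sup>2 * trace (P 2)
      + (casimir_eigenvalue 3)\<^sup>2 * ?d + (casimir_eigenvalue 4)\<^sup>2 = ?d"
    by (simp add: sum_1_4 trace_add trace_scm t3 t4 casimir2_P power2_eq_square mult.assoc)
  \<comment> \<open>The trace of the sum of all \<open>E a ** D a\<close> is computed twice: by
    duality of the bases, and from the eigenvalue on \<open>W 4\<close>.\<close>
  have "?d = (\<Sum>a\<in>UNIV. trace (E a ** D a))"
    by (simp add: trace_form_def [symmetric] trace_form_dual)
  also have "\<dots> = trace (sandwich (mat 1))"
    by (simp add: sandwich_def trace_sum)
  also have "\<dots> = - (?n * casimir_eigenvalue 4)"
    by (simp add: sandwich_one trace_mat mult.commute)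
  finally have e6: "?n * casimir_eigenvalue 4 = - ?d"
    by simp
  have pos: "of_nat j + 1 \<noteq> (0 :: complex)" for j
    by (metis of_nat_Suc add.commute of_nat_neq_0)
  have "?n \<noteq> of_nat 2"
    unfolding of_nat_eq_iff by (simp add: card_n)
  then have "?n \<noteq> 2"
    by simp
  moreover have "?d + 3 * (?n + 1) \<noteq> 0"
    using pos [of "CARD('g) + 3 * CARD('n) + 2"] by (simp add: algebra_simps)
  moreover have "?n + 16 \<noteq> 0"
    using pos [of "CARD('n) + 15"] by (simp add: algebra_simps)
  moreover have "?n + 1 \<noteq> 0"
    by (rule pos)
  moreover note casimir_equations [OF _ _ _ _ _ _ t1 e1 e2 e3 e4 e5 e6 casimir_cubic]
  ultimately have "(?n + 16) * casimir_eigenvalue 1 = 9" "(?n + 16) * casimir_eigenvalue 2 = - 3"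
    "(?n + 16) * casimir_eigenvalue 3 = - (?n + 7)" "(?n + 16) * casimir_eigenvalue 4 = - 3 * (?n + 1)"
    by simp_all
  \<comment> \<open>With n = 6 m + 8 one has n + 16 = 3 (2 m + 8), and a common factor 3 can be
    cancelled.\<close>
  then have "3 * ((2 * of_nat m + 8) * casimir_eigenvalue 1) = 3 * 3"
    "3 * ((2 * of_nat m + 8) * casimir_eigenvalue 2) = 3 * - 1"
    "3 * ((2 * of_nat m + 8) * casimir_eigenvalue 3) = 3 * - (2 * of_nat m + 5)"
    "3 * ((2 * of_nat m + 8) * casimir_eigenvalue 4) = 3 * - (6 * of_nat m + 9)"
    by (simp_all add: n algebra_simps)
  then show "(2 * of_nat m + 8) * casimir_eigenvalue 1 = 3"
    "(2 * of_nat m + 8) * casimir_eigenvalue 2 = - 1"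
    "(2 * of_nat m + 8) * casimir_eigenvalue 3 = - (2 * of_nat m + 5)"
    "(2 * of_nat m + 8) * casimir_eigenvalue 4 = - (6 * of_nat m + 9)"
    by (simp_all only: mult_cancel_left) simp_all
qed

end

section \<open>The intertwining property of the R-matrix\<close>

text \<open>Coefficients of the R-matrix times their common denominator (2 - z) (m + 2 - z) (2 m + 2
  - z). Being polynomial, they make sense over every commutative ring, in particular over
  polynomials in an auxiliary indeterminate.\<close>

definition cleared :: "nat \<Rightarrow> nat \<Rightarrow> 'b::comm_ring_1 \<Rightarrow> 'b" where
  "cleared m i z = (if i = 1 then 2 - z else 2 + z)
    * (if i \<le> 2 then of_nat m + 2 - z else of_nat m + 2 + z)
    * (if i \<le> 3 then 2 * of_nat m + 2 - z else 2 * of_nat m + 2 + z)"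

definition leg3 :: "'a::comm_semiring_1 ^ 'n::finite ^ 'n \<Rightarrow> 'a ^ ('n \<times> 'n \<times> 'n) ^ ('n \<times> 'n \<times> 'n)" where
  "leg3 A = kron (mat 1) (kron (mat 1) A)"

definition leg2 :: "'a::comm_semiring_1 ^ 'n::finite ^ 'n \<Rightarrow> 'a ^ ('n \<times> 'n \<times> 'n) ^ ('n \<times> 'n \<times> 'n)" where
  "leg2 A = kron (mat 1) (kron A (mat 1))"

definition leg1 :: "'a::comm_semiring_1 ^ 'n::finite ^ 'n \<Rightarrow> 'a ^ ('n \<times> 'n \<times> 'n) ^ ('n \<times> 'n \<times> 'n)" where
  "leg1 A = kron A (mat 1)"

lemma tensor_one_legs: "tensor_one (kron A (mat 1)) = leg1 A" "tensor_one (kron (mat 1) A) = leg2 A"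
  by (simp_all add: tensor_one_kron leg1_def leg2_def)

lemma one_tensor_legs: "one_tensor (kron A (mat 1)) = leg2 A" "one_tensor (kron (mat 1) A) = leg3 A"
  by (simp_all add: one_tensor_def leg2_def leg3_def)

lemma tensor_one_leg3: "tensor_one A ** leg3 B = leg3 B ** tensor_one A"
proof -
  have "leg3 B = (\<chi> p q. kron (mat 1) B $ assoc_index p $ assoc_index q)"
    by (auto simp: vec_eq_iff leg3_def assoc_index_def mat_def)
  then show ?thesis
    by (simp add: tensor_one_def matrix_mult_reindex [OF bij_assoc_index] kron_mult)
qed

lemma one_tensor_leg1: "one_tensor A ** leg1 B = leg1 B ** one_tensor A"
  by (simp add: one_tensor_def leg1_def kron_mult)

lemma kron3_legs: "kron A (kron B C) = tensor_one (kron A B) ** leg3 C" "kron A (kron B C) = one_tensor (kron B C) ** leg1 A"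
  by (simp_all add: tensor_one_kron one_tensor_def leg1_def leg3_def kron_mult)

lemma tensor_rev_legs:
  "tensor_rev ** leg1 A = leg3 A ** tensor_rev" "tensor_rev ** leg2 A = leg2 A ** tensor_rev"
  "tensor_rev ** leg3 A = leg1 A ** tensor_rev"
  using tensor_rev_kron [of A "mat 1" "mat 1"] tensor_rev_kron [of "mat 1" A "mat 1"] tensor_rev_kron [of "mat 1" "mat 1" A]
  by (simp_all add: leg1_def leg2_def leg3_def)

lemma legs_mult:
  "leg1 (A ** B) = leg1 A ** leg1 B" "leg2 (A ** B) = leg2 A ** leg2 B" "leg3 (A ** B) = leg3 A ** leg3 B"
  "leg1 A ** leg2 B = leg2 B ** leg1 A" "leg1 A ** leg3 B = leg3 B ** leg1 A" "leg2 A ** leg3 B = leg3 B ** leg2 A"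
  by (simp_all add: leg1_def leg2_def leg3_def kron_mult)

lemma legs_diff:
  "leg1 (A - B) = leg1 A - leg1 B" "leg2 (A - B) = leg2 A - leg2 (B :: 'a::comm_ring_1 ^ _ ^ _)"
  by (simp_all add: leg1_def leg2_def kron_diff_left kron_diff_right)

lemma (in ring_hom) map_matrix_legs:
  "map_matrix \<kappa> (leg1 A) = leg1 (map_matrix \<kappa> A)" "map_matrix \<kappa> (leg2 A) = leg2 (map_matrix \<kappa> A)"
  "map_matrix \<kappa> (leg3 A) = leg3 (map_matrix \<kappa> A)"
  by (simp_all add: leg1_def leg2_def leg3_def map_matrix_kron map_matrix_mat hom_one)

lemma matrix_intertwine:
  assumes "A ** M = N ** A" "B ** N = L ** B"
  shows "B ** A ** M = L ** (B ** A)"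
proof -
  have "B ** A ** M = B ** N ** A"
    by (simp add: matrix_mul_assoc [symmetric] assms(1))
  then show ?thesis
    by (simp add: assms(2) matrix_mul_assoc)
qed

lemma matrix_intertwine_mult:
  assumes "E ** A = A' ** E" "E ** B = B' ** E"
  shows "E ** (A ** B) = A' ** B' ** E"
proof -
  have "E ** (A ** B) = A' ** (E ** B)"
    by (simp add: matrix_mul_assoc assms(1))
  then show ?thesis
    by (simp add: assms(2) matrix_mul_assoc)
qed

lemma transpose_zero: "transpose 0 = 0"
  by (simp add: transpose_def vec_eq_iff)

context e7_rep
begin

section \<open>Blocks of the action on a single factor\<close>

abbreviation X1 where "X1 x \<equiv> kron (\<rho> x) (mat 1 :: complex ^ 'n ^ 'n)"
abbreviation X2 where "X2 x \<equiv> kron (mat 1 :: complex ^ 'n ^ 'n) (\<rho> x)"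

lemma P_X_P_swap:
  assumes "i \<in> {1..4}" "j \<in> {1..4}"
  shows "swap_sign j *m (P j ** X1 x ** P i) = swap_sign i *m (P j ** X2 x ** P i)"
proof -
  have "swap_sign j *m (P j ** X1 x ** P i) = P j ** (tensor_swap ** X1 x) ** P i"
    using P_swap [OF assms(2)] by (simp add: matrix_mul_assoc scm_mult_left)
  also have "\<dots> = P j ** X2 x ** (tensor_swap ** P i)"
    by (simp add: tensor_swap_kron matrix_mul_assoc)
  finally show ?thesis
    by (simp add: swap_P [OF assms(1)] scm_mult_right)
qed

lemma P_X_P_diagonal: "i \<in> {1..4} \<Longrightarrow> P i ** X1 x ** P i = P i ** X2 x ** P i"
  by (rule scm_cancel [OF P_X_P_swap]) (simp_all add: swap_sign_def)

lemma P_X_P_off_diagonal: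
  assumes "i \<in> {1..4}" "j \<in> {1..4}" "i \<noteq> j"
  shows "P j ** X2 x ** P i = - (P j ** X1 x ** P i)"
proof -
  have "P j ** \<tau> x ** P i = \<tau> x ** (P j ** P i)"
    using P_equivariant [OF assms(2)] by (simp add: matrix_mul_assoc)
  also have "\<dots> = 0"
    using assms by (simp add: P_mult)
  finally show ?thesis
    by (simp add: tensor_square_def matrix_ring_simps eq_neg_iff_add_eq_0 add.commute)
qed

text \<open>The blocks of \<open>X1\<close> and \<open>X2\<close> agree here by the flip and are
  opposite because their sum is equivariant.\<close>

lemma P_X_P_same_parity:
  assumes "i \<in> {1..4}" "j \<in> {1..4}" "i \<noteq> j" "even i = even j"
  shows "P j ** X1 x ** P i = 0"
proof -
  have "swap_sign j = swap_sign i"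
    using assms(4) by (simp add: swap_sign_def)
  then have "swap_sign i *m (P j ** X1 x ** P i) = swap_sign i *m (P j ** X2 x ** P i)"
    using P_X_P_swap [OF assms(1,2), of x] by simp
  then have "P j ** X1 x ** P i = P j ** X2 x ** P i"
    by (rule scm_cancel) (simp add: swap_sign_def)
  then show ?thesis
    by (simp add: P_X_P_off_diagonal [OF assms(1-3)] vec_eq_iff eq_neg_iff_add_eq_0)
qed

text \<open>On the bivector spanning \<open>W 4\<close> the first factor gives
  \<open>\<rho> x ** J\<close>, to which \<open>P1_rep_J\<close> applies.\<close>

lemma P1_X_P4: "P 1 ** X1 x ** P 4 = 0"
proof -
  have "P 1 *v (X1 x *v w) = 0" if "w \<in> W 4" for w
  proof -
    obtain c where "w = c *s tens J"
      using W4_J [OF \<open>w \<in> W 4\<close>] by blast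
    then show ?thesis
      using P1_rep_J [of x] by (simp add: matrix_vector_scale kron_tens)
  qed
  then show ?thesis
    using P_in [of 4] by (simp add: matrix_eq_zero_vector matrix_vector_mul_assoc [symmetric])
qed

text \<open>\<open>A ** J2 = J2 ** transpose A\<close> expresses that A is self-adjoint for the
  bilinear form induced on the tensor square.\<close>

definition J2 :: "complex ^ ('n \<times> 'n) ^ ('n \<times> 'n)" where
  "J2 = kron J J"

lemma J2_cancel: "A ** J2 = 0 \<Longrightarrow> A = 0"
proof -
  assume "A ** J2 = 0"
  then have "A ** (J2 ** kron J_inv J_inv) = 0"
    by (simp add: matrix_mul_assoc)
  then show ?thesis
    by (simp add: J2_def kron_mult J_inverse)
qed

lemma casimir2_J2: "casimir2 ** J2 = J2 ** transpose casimir2"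
  by (simp add: casimir2_def J2_def transpose_sum kron_transpose matrix_sum_left matrix_sum_right kron_mult
      J_invariant kron_minus_left kron_minus_right)

lemma casimir_eigenvalues_distinct:
  assumes "i \<in> {1..4}" "j \<in> {1..4}" "casimir_eigenvalue i = casimir_eigenvalue j"
  shows "i = j"
proof -
  \<comment> \<open>The eigenvalues times 2 m + 8 are integers, so they can be compared by integer
    arithmetic.\<close>
  define v where "v i = (if i = 1 then 3 else if i = 2 then - 1 else if i = 3 then - (2 * int m + 5) else - (6 * int m + 9))"
    for i :: nat
  have q: "(2 * of_nat m + 8) * casimir_eigenvalue i = of_int (v i)" if "i \<in> {1..4}" for i
    using that by (cases i rule: index_cases) (simp_all add: v_def casimir_eigenvalues)
  have "of_int (v i) = (of_int (v j) :: complex)"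
    using assms(3) by (simp only: q [OF assms(1), symmetric] q [OF assms(2), symmetric])
  then have "v i = v j"
    by (simp only: of_int_eq_iff)
  show ?thesis
    by (rule index_cases [OF assms(1)]; rule index_cases [OF assms(2)])
       (use \<open>v i = v j\<close> in \<open>simp_all add: v_def\<close>)
qed

text \<open>\<open>casimir2\<close> is self-adjoint and separates the four summands by its
  eigenvalues, so its spectral projectors are self-adjoint too.\<close>

lemma P_J2:
  assumes "i \<in> {1..4}"
  shows "P i ** J2 = J2 ** transpose (P i)"
proof -
  have off: "P j ** J2 ** transpose (P i) = 0" if "i \<in> {1..4}" "j \<in> {1..4}" "i \<noteq> j" for i j
  proof -
    have "casimir_eigenvalue j *m (P j ** J2 ** transpose (P i)) = P j ** (casimir2 ** J2) ** transpose (P i)"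
      using P_casimir2 [OF that(2)] by (simp add: matrix_mul_assoc scm_mult_left)
    also have "\<dots> = P j ** J2 ** transpose (P i ** casimir2)"
      by (simp add: casimir2_J2 matrix_mul_assoc matrix_transpose_mul)
    also have "\<dots> = casimir_eigenvalue i *m (P j ** J2 ** transpose (P i))"
      by (simp add: P_casimir2 [OF that(1)] transpose_scm scm_mult_right)
    finally have "(casimir_eigenvalue j - casimir_eigenvalue i) *m (P j ** J2 ** transpose (P i)) = 0"
      by (simp add: vec_eq_iff algebra_simps)
    moreover have "casimir_eigenvalue j - casimir_eigenvalue i \<noteq> 0"
      using casimir_eigenvalues_distinct that by auto
    ultimately show ?thesis
      by (simp add: vec_eq_iff)
  qed
  have "P i ** J2 = P i ** J2 ** transpose (\<Sum>j\<in>{1..4}. P j)"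
    by (simp only: P_sum transpose_mat matrix_mul_rid)
  also have "\<dots> = (\<Sum>j\<in>{1..4}. P i ** J2 ** transpose (P j))"
    by (simp only: transpose_sum matrix_sum_right)
  also have "\<dots> = (\<Sum>j\<in>{i}. P i ** J2 ** transpose (P j))"
    using assms off by (intro sum.mono_neutral_right) auto
  also have "\<dots> = (\<Sum>j\<in>{i}. P j ** J2 ** transpose (P i))"
    by simp
  also have "\<dots> = (\<Sum>j\<in>{1..4}. P j ** J2 ** transpose (P i))"
    using assms off by (intro sum.mono_neutral_left) auto
  also have "\<dots> = (\<Sum>j\<in>{1..4}. P j) ** J2 ** transpose (P i)"
    by (simp only: matrix_sum_left)
  finally show ?thesis
    by (simp only: P_sum matrix_mul_lid)
qed

text \<open>The adjoint of \<open>P1_X_P4\<close>: the projectors are self-adjoint and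
  \<open>X1 x\<close> is skew.\<close>

lemma P4_X_P1: "P 4 ** X1 x ** P 1 = 0"
proof (rule J2_cancel)
  have X1J2: "X1 x ** J2 = - (J2 ** transpose (X1 x))"
    by (simp add: J2_def kron_transpose kron_mult J_invariant kron_minus_left)
  have "P 4 ** X1 x ** P 1 ** J2 = P 4 ** (X1 x ** J2) ** transpose (P 1)"
    using P_J2 [of 1] by (simp add: matrix_mul_assoc [symmetric])
  also have "\<dots> = - (P 4 ** J2 ** transpose (X1 x) ** transpose (P 1))"
    by (simp add: X1J2 matrix_minus_left matrix_minus_right matrix_mul_assoc)
  also have "\<dots> = - (J2 ** transpose (P 1 ** X1 x ** P 4))"
    using P_J2 [of 4] by (simp add: matrix_transpose_mul matrix_mul_assoc)
  finally show "P 4 ** X1 x ** P 1 ** J2 = 0"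
    by (simp add: P1_X_P4 transpose_zero)
qed

section \<open>Corrections on two and three factors\<close>

definition spectral_correction :: "complex ^ 'g \<Rightarrow> complex ^ ('n \<times> 'n) ^ ('n \<times> 'n)" where
  "spectral_correction x = - (of_nat m + 4) *m bracket_casimir x"

text \<open>The commutator with \<open>casimir2\<close> multiplies each block of \<open>X1 x\<close>
  by a difference of eigenvalues.\<close>

lemma P_correction_P:
  assumes "i \<in> {1..4}" "j \<in> {1..4}"
  shows "P j ** spectral_correction x ** P i
    = ((of_nat m + 4) * (casimir_eigenvalue j - casimir_eigenvalue i)) *m (P j ** X1 x ** P i)"
proof -
  have "P j ** bracket_casimir x ** P i = P j ** X1 x ** (casimir2 ** P i) - (P j ** casimir2) ** X1 x ** P i"
    by (simp add: casimir2_commute_left [symmetric] matrix_ring_simps matrix_mul_assoc)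
  also have "\<dots> = (casimir_eigenvalue i - casimir_eigenvalue j) *m (P j ** X1 x ** P i)"
    by (simp add: casimir2_P [OF assms(1)] P_casimir2 [OF assms(2)] matrix_ring_simps)
       (simp add: vec_eq_iff algebra_simps)
  finally show ?thesis
    by (simp add: spectral_correction_def matrix_ring_simps scm_scm) (simp add: vec_eq_iff algebra_simps)
qed

text \<open>One term for each pair of factors, with the bracket in the earlier factor, as in the
  iterated coproduct of the Yangian.\<close>

definition triple_correction :: "complex ^ 'g \<Rightarrow> complex ^ ('n \<times> 'n \<times> 'n) ^ ('n \<times> 'n \<times> 'n)" where
  "triple_correction x = - (of_nat m + 4) *m (\<Sum>a\<in>UNIV.
     leg1 (\<rho> (br x (std_basis a))) ** leg2 (D a) + leg1 (\<rho> (br x (std_basis a))) ** leg3 (D a)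
     + leg2 (\<rho> (br x (std_basis a))) ** leg3 (D a))"

text \<open>What remains of \<open>triple_correction\<close> without the pair 1, 2: the third factor
  is coupled to the total action on the first two, with which every equivariant operator there
  commutes. \<open>correction23\<close> is the analogue for the last two factors.\<close>

definition correction12 :: "complex ^ 'g \<Rightarrow> complex ^ ('n \<times> 'n \<times> 'n) ^ ('n \<times> 'n \<times> 'n)" where
  "correction12 x = - (of_nat m + 4) *m (\<Sum>a\<in>UNIV. tensor_one (\<tau> (br x (std_basis a))) ** leg3 (D a))"

definition correction23 :: "complex ^ 'g \<Rightarrow> complex ^ ('n \<times> 'n \<times> 'n) ^ ('n \<times> 'n \<times> 'n)" where
  "correction23 x = - (of_nat m + 4) *m (\<Sum>a\<in>UNIV. one_tensor (\<tau> (dual_basis a)) ** leg1 (\<rho> (br x (std_basis a))))"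

lemma triple_correction12: "triple_correction x = tensor_one (spectral_correction x) + correction12 x"
  by (simp add: triple_correction_def correction12_def spectral_correction_def tensor_one_scm bracket_casimir_def
      tensor_one_sum tensor_square_def tensor_one_add tensor_one_legs matrix_add_rdistrib scm_add [symmetric]
      sum.distrib [symmetric] tensor_one_kron leg1_def leg2_def kron_mult add.assoc)

lemma triple_correction23: "triple_correction x = one_tensor (spectral_correction x) + correction23 x"
  by (simp add: triple_correction_def correction23_def spectral_correction_def one_tensor_scm bracket_casimir_def
      one_tensor_sum tensor_square_def one_tensor_add one_tensor_legs matrix_add_rdistrib scm_add [symmetric]
      sum.distrib [symmetric])
     (simp add: leg1_def leg2_def leg3_def one_tensor_def kron_mult add_ac)

end

locale e7_rep_extension = e7_rep br \<rho> m k X e f h W P + ring_hom \<kappa>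
  for br :: "complex ^ 'g \<Rightarrow> complex ^ 'g \<Rightarrow> complex ^ 'g"
    and \<rho> :: "complex ^ 'g \<Rightarrow> complex ^ 'n ^ 'n"
    and m k X e f h W P
    and \<kappa> :: "complex \<Rightarrow> 'b::comm_ring_1"
begin

abbreviation K where "K A \<equiv> map_matrix \<kappa> A"

definition cleared_R :: "'b \<Rightarrow> 'b ^ ('n \<times> 'n) ^ ('n \<times> 'n)" where
  "cleared_R z = (\<Sum>i\<in>{1..4}. cleared m i z *m K (P i))"

lemma K_P_sum: "(\<Sum>i\<in>{1..4}. K (P i)) = mat 1"
  by (simp only: map_matrix_sum [symmetric] P_sum map_matrix_mat hom_one)

lemma K_P_mult: "\<lbrakk>i \<in> {1..4}; j \<in> {1..4}\<rbrakk> \<Longrightarrow> K (P i) ** K (P j) = (if i = j then K (P i) else 0)"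
  by (simp add: map_matrix_mult [symmetric] P_mult map_matrix_zero)

lemma K_P_cleared_R: "i \<in> {1..4} \<Longrightarrow> K (P i) ** cleared_R z = cleared m i z *m K (P i)"
  by (cases i rule: index_cases) (simp_all add: cleared_R_def sum_1_4 matrix_ring_simps K_P_mult)

lemma cleared_R_K_P: "i \<in> {1..4} \<Longrightarrow> cleared_R z ** K (P i) = cleared m i z *m K (P i)"
  by (cases i rule: index_cases) (simp_all add: cleared_R_def sum_1_4 matrix_ring_simps K_P_mult)

lemma eq_blockwise:
  assumes "\<And>i j. i \<in> {1..4} \<Longrightarrow> j \<in> {1..4} \<Longrightarrow> K (P j) ** A ** K (P i) = K (P j) ** B ** K (P i)"
  shows "A = B"
proof -
  have eq: "M = (\<Sum>i\<in>{1..4}. \<Sum>j\<in>{1..4}. K (P j) ** M ** K (P i))" for M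
  proof -
    have "M = (\<Sum>j\<in>{1..4}. K (P j)) ** M ** (\<Sum>i\<in>{1..4}. K (P i))"
      by (simp only: K_P_sum matrix_mul_lid matrix_mul_rid)
    then show ?thesis
      by (simp only: matrix_sum_left matrix_sum_right)
  qed
  have "(\<Sum>i\<in>{1..4}. \<Sum>j\<in>{1..4}. K (P j) ** A ** K (P i)) = (\<Sum>i\<in>{1..4}. \<Sum>j\<in>{1..4}. K (P j) ** B ** K (P i))"
    using assms by (intro sum.cong refl)
  then show ?thesis
    using eq [of A] eq [of B] by simp
qed

lemma K_correction_coefficient:
  "\<kappa> ((of_nat m + 4) * (casimir_eigenvalue 1 - casimir_eigenvalue 2)) = 2"
  "\<kappa> ((of_nat m + 4) * (casimir_eigenvalue 2 - casimir_eigenvalue 1)) = - 2"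
  "\<kappa> ((of_nat m + 4) * (casimir_eigenvalue 2 - casimir_eigenvalue 3)) = of_nat m + 2"
  "\<kappa> ((of_nat m + 4) * (casimir_eigenvalue 3 - casimir_eigenvalue 2)) = - (of_nat m + 2)"
  "\<kappa> ((of_nat m + 4) * (casimir_eigenvalue 3 - casimir_eigenvalue 4)) = 2 * of_nat m + 2"
  "\<kappa> ((of_nat m + 4) * (casimir_eigenvalue 4 - casimir_eigenvalue 3)) = - (2 * of_nat m + 2)"
proof -
  have eq: "(of_nat m + 4) * (casimir_eigenvalue i - casimir_eigenvalue j)
      = ((2 * of_nat m + 8) * casimir_eigenvalue i - (2 * of_nat m + 8) * casimir_eigenvalue j) / 2" for i j
    by (simp add: field_simps)
  show "\<kappa> ((of_nat m + 4) * (casimir_eigenvalue 1 - casimir_eigenvalue 2)) = 2"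
    "\<kappa> ((of_nat m + 4) * (casimir_eigenvalue 2 - casimir_eigenvalue 1)) = - 2"
    unfolding eq casimir_eigenvalues by (simp_all add: hom_minus hom_numeral)
  have "(- 1 + (2 * of_nat m + 5)) / 2 = (of_nat (m + 2) :: complex)"
    "(- (2 * of_nat m + 5) + 1) / 2 = - (of_nat (m + 2) :: complex)"
    "(- (2 * of_nat m + 5) + (6 * of_nat m + 9)) / 2 = (of_nat (2 * m + 2) :: complex)"
    "(- (6 * of_nat m + 9) + (2 * of_nat m + 5)) / 2 = - (of_nat (2 * m + 2) :: complex)"
    by (simp_all add: field_simps)
  then show "\<kappa> ((of_nat m + 4) * (casimir_eigenvalue 2 - casimir_eigenvalue 3)) = of_nat m + 2"
    "\<kappa> ((of_nat m + 4) * (casimir_eigenvalue 3 - casimir_eigenvalue 2)) = - (of_nat m + 2)"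
    "\<kappa> ((of_nat m + 4) * (casimir_eigenvalue 3 - casimir_eigenvalue 4)) = 2 * of_nat m + 2"
    "\<kappa> ((of_nat m + 4) * (casimir_eigenvalue 4 - casimir_eigenvalue 3)) = - (2 * of_nat m + 2)"
    unfolding eq casimir_eigenvalues diff_minus_eq_add by (simp_all only: hom_minus hom_of_nat) simp_all
qed

text \<open>Ratios of neighbouring coefficients, cross-multiplied into the condition \<open>cleared
  m j z * (z + \<theta>) = cleared m i z * (- z + \<theta>)\<close> for the block from i to j, with
  \<theta> taken from \<open>K_correction_coefficient\<close>.\<close>

lemma cleared_ratio:
  "cleared m 2 z * (z + - 2) = cleared m 1 z * (- z + - 2)"
  "cleared m 1 z * (z + 2) = cleared m 2 z * (- z + 2)"
  "cleared m 3 z * (z + - (of_nat m + 2)) = cleared m 2 z * (- z + - (of_nat m + 2))"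
  "cleared m 2 z * (z + (of_nat m + 2)) = cleared m 3 z * (- z + (of_nat m + 2))"
  "cleared m 4 z * (z + - (2 * of_nat m + 2)) = cleared m 3 z * (- z + - (2 * of_nat m + 2))"
  "cleared m 3 z * (z + (2 * of_nat m + 2)) = cleared m 4 z * (- z + (2 * of_nat m + 2))"
  for z :: 'b
  by (simp_all add: cleared_def algebra_simps)

text \<open>By the block structure of \<open>X1\<close> this reduces to the ratios of consecutive coefficients: the tensor
  product graph is the path 1 - 2 - 3 - 4.\<close>

lemma cleared_R_intertwines:
  "cleared_R z ** (z *m K (X1 x) + K (spectral_correction x))
    = (z *m K (X2 x) + K (spectral_correction x)) ** cleared_R z"
proof (rule eq_blockwise)
  fix i j assume ij: "i \<in> {1..4::nat}" "j \<in> {1..4::nat}"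
  let ?\<theta> = "\<kappa> ((of_nat m + 4) * (casimir_eigenvalue j - casimir_eigenvalue i))"
  let ?Y = "K (P j ** X1 x ** P i)"
  have corr: "K (P j) ** K (spectral_correction x) ** K (P i) = ?\<theta> *m ?Y"
    using P_correction_P [OF ij, of x] by (simp only: map_matrix_mult [symmetric] map_matrix_scm [symmetric])
  have L: "K (P j) ** (cleared_R z ** (z *m K (X1 x) + K (spectral_correction x))) ** K (P i)
      = (cleared m j z * (z + ?\<theta>)) *m ?Y"
  proof -
    have "K (P j) ** (cleared_R z ** (z *m K (X1 x) + K (spectral_correction x))) ** K (P i)
        = cleared m j z *m (z *m (K (P j) ** K (X1 x) ** K (P i)) + K (P j) ** K (spectral_correction x) ** K (P i))"
      by (simp add: matrix_mul_assoc K_P_cleared_R [OF ij(2)] matrix_ring_simps scm_add scm_scm mult.commute)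
    also have "\<dots> = (cleared m j z * (z + ?\<theta>)) *m ?Y"
      unfolding corr unfolding map_matrix_mult [symmetric] by (simp add: vec_eq_iff algebra_simps)
    finally show ?thesis .
  qed
  have R: "K (P j) ** ((z *m K (X2 x) + K (spectral_correction x)) ** cleared_R z) ** K (P i)
      = (cleared m i z * z) *m K (P j ** X2 x ** P i) + (cleared m i z * ?\<theta>) *m ?Y"
  proof -
    have "K (P j) ** ((z *m K (X2 x) + K (spectral_correction x)) ** cleared_R z) ** K (P i)
        = cleared m i z *m (z *m (K (P j) ** K (X2 x) ** K (P i)) + K (P j) ** K (spectral_correction x) ** K (P i))"
      by (simp add: matrix_mul_assoc [symmetric] cleared_R_K_P [OF ij(1)] matrix_ring_simps scm_add scm_scm mult.commute)
    also have "\<dots> = (cleared m i z * z) *m K (P j ** X2 x ** P i) + (cleared m i z * ?\<theta>) *m ?Y"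
      unfolding corr unfolding map_matrix_mult [symmetric] by (simp add: vec_eq_iff algebra_simps)
    finally show ?thesis .
  qed
  show "K (P j) ** (cleared_R z ** (z *m K (X1 x) + K (spectral_correction x))) ** K (P i)
      = K (P j) ** ((z *m K (X2 x) + K (spectral_correction x)) ** cleared_R z) ** K (P i)"
  proof (cases "i = j")
    case True
    then show ?thesis
      unfolding L R using P_X_P_diagonal [OF ij(1), of x] by (simp add: hom_zero vec_eq_iff algebra_simps)
  next
    case False
    \<comment> \<open>Off the diagonal \<open>X2\<close> has the opposite block of
      \<open>X1\<close>, hence the sign of z on the right-hand side.\<close>
    have "?Y = 0 \<or> cleared m j z * (z + ?\<theta>) = cleared m i z * (- z + ?\<theta>)"
    proof (cases "even i = even j")
      case True
      then show ?thesis
        using P_X_P_same_parity [OF ij False] by (simp add: map_matrix_zero)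
    next
      case odd: False
      have "i = 1 \<and> j = 4 \<or> i = 4 \<and> j = 1 \<or> i = 1 \<and> j = 2 \<or> i = 2 \<and> j = 1
          \<or> i = 2 \<and> j = 3 \<or> i = 3 \<and> j = 2 \<or> i = 3 \<and> j = 4 \<or> i = 4 \<and> j = 3"
        by (rule index_cases [OF ij(1)]; rule index_cases [OF ij(2)]) (use False odd in simp_all)
      then show ?thesis
        by (elim disjE conjE)
          (simp_all only: P1_X_P4 P4_X_P1 map_matrix_zero K_correction_coefficient cleared_ratio simp_thms)
    qed
    then have "(cleared m j z * (z + ?\<theta>)) *m ?Y = (cleared m i z * (- z + ?\<theta>)) *m ?Y"
      by (elim disjE) (simp_all only: scm_zero)
    also have "\<dots> = (cleared m i z * z) *m - ?Y + (cleared m i z * ?\<theta>) *m ?Y"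
      by (simp add: vec_eq_iff algebra_simps)
    finally show ?thesis
      unfolding L R P_X_P_off_diagonal [OF ij False] map_matrix_minus .
  qed
qed

lemma cleared_R_equivariant: "cleared_R z ** K (\<tau> x) = K (\<tau> x) ** cleared_R z"
proof -
  have "K (P i) ** K (\<tau> x) = K (\<tau> x) ** K (P i)" if "i \<in> {1..4}" for i
    using P_equivariant [OF that] by (simp only: map_matrix_mult [symmetric])
  then show ?thesis
    by (simp add: cleared_R_def matrix_sum_left matrix_sum_right scm_mult_left scm_mult_right)
qed

lemma cleared_R_swap: "tensor_swap ** cleared_R z = cleared_R z ** tensor_swap"
proof -
  have "tensor_swap ** K (P i) = K (P i) ** tensor_swap" if "i \<in> {1..4}" for i
    using swap_P [OF that] P_swap [OF that]
    by (simp only: map_matrix_tensor_swap [symmetric] map_matrix_mult [symmetric])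
  then show ?thesis
    by (simp add: cleared_R_def matrix_sum_left matrix_sum_right scm_mult_left scm_mult_right)
qed

lemma cleared_R_transpose: "cleared_R z ** K J2 = K J2 ** transpose (cleared_R z)"
proof -
  have "K (P i) ** K J2 = K J2 ** transpose (K (P i))" if "i \<in> {1..4}" for i
    using P_J2 [OF that] by (simp only: map_matrix_mult [symmetric] map_matrix_transpose [symmetric])
  then show ?thesis
    by (simp add: cleared_R_def matrix_sum_left matrix_sum_right scm_mult_left scm_mult_right transpose_sum transpose_scm)
qed

section \<open>Currents on the triple product and the defect of the Yang-Baxter equation\<close>

abbreviation R12 where "R12 z \<equiv> tensor_one (cleared_R z)"
abbreviation R23 where "R23 z \<equiv> one_tensor (cleared_R z)"

text \<open>The action of the Yangian generator attached to x, with one parameter per factor. Its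
  correction does not depend on the parameters, so R can exchange neighbouring parameters without
  altering it.\<close>

definition current :: "'b \<Rightarrow> 'b \<Rightarrow> 'b \<Rightarrow> complex ^ 'g \<Rightarrow> 'b ^ ('n \<times> 'n \<times> 'n) ^ ('n \<times> 'n \<times> 'n)" where
  "current z1 z2 z3 x =
    z1 *m K (leg1 (\<rho> x)) + z2 *m K (leg2 (\<rho> x)) + z3 *m K (leg3 (\<rho> x)) + K (triple_correction x)"

definition total :: "complex ^ 'g \<Rightarrow> complex ^ ('n \<times> 'n \<times> 'n) ^ ('n \<times> 'n \<times> 'n)" where
  "total x = leg1 (\<rho> x) + leg2 (\<rho> x) + leg3 (\<rho> x)"

lemma R12_leg3: "R12 z ** K (leg3 A) = K (leg3 A) ** R12 z"
  by (simp add: map_matrix_legs tensor_one_leg3)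

lemma R23_leg1: "R23 z ** K (leg1 A) = K (leg1 A) ** R23 z"
  by (simp add: map_matrix_legs one_tensor_leg1)

lemma R12_tensor_square: "R12 z ** K (tensor_one (\<tau> x)) = K (tensor_one (\<tau> x)) ** R12 z"
  by (simp add: map_matrix_tensor_one tensor_one_mult [symmetric] cleared_R_equivariant)

lemma R23_tensor_square: "R23 z ** K (one_tensor (\<tau> x)) = K (one_tensor (\<tau> x)) ** R23 z"
  by (simp add: map_matrix_one_tensor one_tensor_mult [symmetric] cleared_R_equivariant)

lemma R12_correction: "R12 z ** K (correction12 x) = K (correction12 x) ** R12 z"
proof -
  have "R12 z ** (K (tensor_one (\<tau> y)) ** K (leg3 A)) = K (tensor_one (\<tau> y)) ** K (leg3 A) ** R12 z" for y A
    by (rule matrix_intertwine_mult [OF R12_tensor_square R12_leg3])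
  then show ?thesis
    by (simp add: correction12_def map_matrix_scm map_matrix_sum map_matrix_mult matrix_ring_simps
        matrix_sum_left matrix_sum_right)
qed

lemma R23_correction: "R23 z ** K (correction23 x) = K (correction23 x) ** R23 z"
proof -
  have "R23 z ** (K (one_tensor (\<tau> y)) ** K (leg1 A)) = K (one_tensor (\<tau> y)) ** K (leg1 A) ** R23 z" for y A
    by (rule matrix_intertwine_mult [OF R23_tensor_square R23_leg1])
  then show ?thesis
    by (simp add: correction23_def map_matrix_scm map_matrix_sum map_matrix_mult matrix_ring_simps
        matrix_sum_left matrix_sum_right)
qed

lemma R12_total: "R12 z ** K (total x) = K (total x) ** R12 z"
proof -
  have "total x = tensor_one (\<tau> x) + leg3 (\<rho> x)"
    by (simp add: total_def tensor_square_def tensor_one_add tensor_one_legs)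
  then show ?thesis
    by (simp add: map_matrix_add matrix_ring_simps R12_tensor_square R12_leg3)
qed

lemma R23_total: "R23 z ** K (total x) = K (total x) ** R23 z"
proof -
  have "total x = one_tensor (\<tau> x) + leg1 (\<rho> x)"
    by (simp add: total_def tensor_square_def one_tensor_add one_tensor_legs add_ac)
  then show ?thesis
    by (simp add: map_matrix_add matrix_ring_simps R23_tensor_square R23_leg1)
qed

lemma R12_current: "R12 (z1 - z2) ** current z1 z2 z3 x = current z2 z1 z3 x ** R12 (z1 - z2)"
proof -
  let ?z = "z1 - z2"
  \<comment> \<open>Writing z1 x1 + z2 x2 as (z1 - z2) x1 + z2 (x1 + x2) isolates the part covered
    by \<open>cleared_R_intertwines\<close>; everything else commutes with \<open>R12\<close>. After
    the exchange the first summand is (z1 - z2) x2.\<close>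
  have 1: "current z1 z2 z3 x = tensor_one (?z *m K (X1 x) + K (spectral_correction x))
      + z2 *m K (tensor_one (\<tau> x)) + z3 *m K (leg3 (\<rho> x)) + K (correction12 x)"
    by (simp add: current_def triple_correction12 map_matrix_add tensor_one_add tensor_one_scm
        map_matrix_tensor_one [symmetric] tensor_one_legs tensor_square_def scm_add)
       (simp add: vec_eq_iff algebra_simps)
  have 2: "current z2 z1 z3 x = tensor_one (?z *m K (X2 x) + K (spectral_correction x))
      + z2 *m K (tensor_one (\<tau> x)) + z3 *m K (leg3 (\<rho> x)) + K (correction12 x)"
    by (simp add: current_def triple_correction12 map_matrix_add tensor_one_add tensor_one_scm
        map_matrix_tensor_one [symmetric] tensor_one_legs tensor_square_def scm_add)
       (simp add: vec_eq_iff algebra_simps)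
  have "R12 ?z ** tensor_one (?z *m K (X1 x) + K (spectral_correction x))
      = tensor_one (?z *m K (X2 x) + K (spectral_correction x)) ** R12 ?z"
    by (simp only: tensor_one_mult [symmetric] cleared_R_intertwines)
  then show ?thesis
    unfolding 1 2 by (simp add: matrix_ring_simps R12_tensor_square R12_leg3 R12_correction)
qed

lemma R23_current: "R23 (z2 - z3) ** current z1 z2 z3 x = current z1 z3 z2 x ** R23 (z2 - z3)"
proof -
  let ?z = "z2 - z3"
  have 1: "current z1 z2 z3 x = one_tensor (?z *m K (X1 x) + K (spectral_correction x))
      + z3 *m K (one_tensor (\<tau> x)) + z1 *m K (leg1 (\<rho> x)) + K (correction23 x)"
    by (simp add: current_def triple_correction23 map_matrix_add one_tensor_add one_tensor_scm
        map_matrix_one_tensor [symmetric] one_tensor_legs tensor_square_def scm_add)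
       (simp add: vec_eq_iff algebra_simps)
  have 2: "current z1 z3 z2 x = one_tensor (?z *m K (X2 x) + K (spectral_correction x))
      + z3 *m K (one_tensor (\<tau> x)) + z1 *m K (leg1 (\<rho> x)) + K (correction23 x)"
    by (simp add: current_def triple_correction23 map_matrix_add one_tensor_add one_tensor_scm
        map_matrix_one_tensor [symmetric] one_tensor_legs tensor_square_def scm_add)
       (simp add: vec_eq_iff algebra_simps)
  have "R23 ?z ** one_tensor (?z *m K (X1 x) + K (spectral_correction x))
      = one_tensor (?z *m K (X2 x) + K (spectral_correction x)) ** R23 ?z"
    by (simp only: one_tensor_mult [symmetric] cleared_R_intertwines)
  then show ?thesis
    unfolding 1 2 by (simp add: matrix_ring_simps R23_tensor_square R23_leg1 R23_correction)
qed

definition ybe_defect :: "'b \<Rightarrow> 'b \<Rightarrow> 'b ^ ('n \<times> 'n \<times> 'n) ^ ('n \<times> 'n \<times> 'n)" where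
  "ybe_defect u v = R12 u ** R23 (u + v) ** R12 v - R23 v ** R12 (u + v) ** R23 u"

text \<open>The two sides exchange neighbouring parameters along the two reduced words of the
  reversal, both leading from (u + v, u, 0) to (0, u, u + v). The parameter 0 leaves only two
  factors in the leading part.\<close>

lemma ybe_defect_current: "ybe_defect u v ** current (u + v) u 0 x = current 0 u (u + v) x ** ybe_defect u v"
proof -
  have a: "R12 v ** current (u + v) u 0 x = current u (u + v) 0 x ** R12 v"
    "R23 (u + v) ** current u (u + v) 0 x = current u 0 (u + v) x ** R23 (u + v)"
    "R12 u ** current u 0 (u + v) x = current 0 u (u + v) x ** R12 u"
    using R12_current [of "u + v" u 0 x] R23_current [of "u + v" 0 u x] R12_current [of u 0 "u + v" x] by simp_all
  have b: "R23 u ** current (u + v) u 0 x = current (u + v) 0 u x ** R23 u"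
    "R12 (u + v) ** current (u + v) 0 u x = current 0 (u + v) u x ** R12 (u + v)"
    "R23 v ** current 0 (u + v) u x = current 0 u (u + v) x ** R23 v"
    using R23_current [of u 0 "u + v" x] R12_current [of "u + v" 0 u x] R23_current [of "u + v" u 0 x] by simp_all
  have "R12 u ** R23 (u + v) ** R12 v ** current (u + v) u 0 x = current 0 u (u + v) x ** (R12 u ** R23 (u + v) ** R12 v)"
    by (rule matrix_intertwine [OF a(1) matrix_intertwine [OF a(2,3)]])
  moreover have "R23 v ** R12 (u + v) ** R23 u ** current (u + v) u 0 x
      = current 0 u (u + v) x ** (R23 v ** R12 (u + v) ** R23 u)"
    by (rule matrix_intertwine [OF b(1) matrix_intertwine [OF b(2,3)]])
  ultimately show ?thesis
    by (simp add: ybe_defect_def matrix_ring_simps)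
qed

lemma ybe_defect_total: "ybe_defect u v ** K (total x) = K (total x) ** ybe_defect u v"
proof -
  have "R12 u ** R23 (u + v) ** R12 v ** K (total x) = K (total x) ** (R12 u ** R23 (u + v) ** R12 v)"
    by (rule matrix_intertwine [OF R12_total matrix_intertwine [OF R23_total R12_total]])
  moreover have "R23 v ** R12 (u + v) ** R23 u ** K (total x) = K (total x) ** (R23 v ** R12 (u + v) ** R23 u)"
    by (rule matrix_intertwine [OF R23_total matrix_intertwine [OF R12_total R23_total]])
  ultimately show ?thesis
    by (simp add: ybe_defect_def matrix_ring_simps)
qed

end

context e7_rep
begin

definition J3 :: "complex ^ ('n \<times> 'n \<times> 'n) ^ ('n \<times> 'n \<times> 'n)" where
  "J3 = kron J (kron J J)"

lemma J3_nonzero: "J3 \<noteq> 0"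
proof
  assume "J3 = 0"
  then have "J3 ** kron J_inv (kron J_inv J_inv) = 0" by simp
  then have "(mat 1 :: complex ^ ('n \<times> 'n \<times> 'n) ^ ('n \<times> 'n \<times> 'n)) = 0"
    by (simp add: J3_def kron_mult J_inverse)
  then have "(mat 1 :: complex ^ ('n \<times> 'n \<times> 'n) ^ ('n \<times> 'n \<times> 'n)) $ p $ p = 0" for p
    by simp
  then show False
    by (simp add: mat_def)
qed

end

context e7_rep_extension
begin

lemma R12_J3: "R12 z ** K J3 = K J3 ** transpose (R12 z)"
proof -
  have J3: "K J3 = tensor_one (K J2) ** K (leg3 J)"
    by (simp add: J3_def J2_def kron3_legs(1) map_matrix_mult map_matrix_tensor_one)
  have "R12 z ** K J3 = tensor_one (cleared_R z ** K J2) ** K (leg3 J)"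
    by (simp add: J3 tensor_one_mult matrix_mul_assoc)
  also have "\<dots> = tensor_one (K J2) ** (tensor_one (transpose (cleared_R z)) ** leg3 (K J))"
    by (simp add: cleared_R_transpose tensor_one_mult matrix_mul_assoc map_matrix_legs)
  also have "\<dots> = K J3 ** transpose (R12 z)"
    by (simp add: tensor_one_leg3 J3 map_matrix_legs tensor_one_transpose matrix_mul_assoc)
  finally show ?thesis .
qed

lemma R23_J3: "R23 z ** K J3 = K J3 ** transpose (R23 z)"
proof -
  have J3: "K J3 = one_tensor (K J2) ** K (leg1 J)"
    by (simp add: J3_def J2_def kron3_legs(2) map_matrix_mult map_matrix_one_tensor)
  have "R23 z ** K J3 = one_tensor (cleared_R z ** K J2) ** K (leg1 J)"
    by (simp add: J3 one_tensor_mult matrix_mul_assoc)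
  also have "\<dots> = one_tensor (K J2) ** (one_tensor (transpose (cleared_R z)) ** leg1 (K J))"
    by (simp add: cleared_R_transpose one_tensor_mult matrix_mul_assoc map_matrix_legs)
  also have "\<dots> = K J3 ** transpose (R23 z)"
    by (simp add: one_tensor_leg1 J3 map_matrix_legs one_tensor_transpose matrix_mul_assoc)
  finally show ?thesis .
qed

text \<open>The adjoint with respect to the invariant form, composed with the reversal of the three factors,
  exchanges the two sides of the Yang--Baxter equation.\<close>

lemma ybe_defect_adjoint:
  "(tensor_rev ** K J3) ** transpose (ybe_defect u v) = - (ybe_defect u v ** (tensor_rev ** K J3))"
proof -
  let ?E = "tensor_rev ** K J3"
  have a: "?E ** transpose (R12 z) = R23 z ** ?E" for z
  proof -
    have "?E ** transpose (R12 z) = tensor_rev ** R12 z ** K J3"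
      by (simp add: R12_J3 matrix_mul_assoc [symmetric])
    then show ?thesis
      by (simp add: tensor_rev_tensor_one [OF cleared_R_swap] matrix_mul_assoc)
  qed
  have b: "?E ** transpose (R23 z) = R12 z ** ?E" for z
  proof -
    have "?E ** transpose (R23 z) = tensor_rev ** R23 z ** K J3"
      by (simp add: R23_J3 matrix_mul_assoc [symmetric])
    then show ?thesis
      by (simp add: tensor_rev_one_tensor [OF cleared_R_swap] matrix_mul_assoc)
  qed
  have "?E ** transpose (R12 u ** R23 (u + v) ** R12 v) = R23 v ** (R12 (u + v) ** R23 u) ** ?E"
    unfolding matrix_transpose_mul
    by (rule matrix_intertwine_mult [OF a matrix_intertwine_mult [OF b a]])
  moreover have "?E ** transpose (R23 v ** R12 (u + v) ** R23 u) = R12 u ** (R23 (u + v) ** R12 v) ** ?E"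
    unfolding matrix_transpose_mul
    by (rule matrix_intertwine_mult [OF b matrix_intertwine_mult [OF a b]])
  ultimately show ?thesis
    by (simp add: ybe_defect_def transpose_diff matrix_diff_ldistrib matrix_diff_rdistrib matrix_mul_assoc)
qed

end

section \<open>Leading coefficients\<close>

definition coeff_matrix :: "nat \<Rightarrow> 'a::comm_ring_1 poly ^ 'n ^ 'm \<Rightarrow> 'a ^ 'n ^ 'm" where
  "coeff_matrix d A = map_matrix (\<lambda>p. coeff p d) A"

lemma coeff_matrix_add: "coeff_matrix d (A + B) = coeff_matrix d A + coeff_matrix d B"
  and coeff_matrix_minus: "coeff_matrix d (- A) = - coeff_matrix d A"
  and coeff_matrix_transpose: "coeff_matrix d (transpose A) = transpose (coeff_matrix d A)"
  by (simp_all add: coeff_matrix_def vec_eq_iff transpose_def)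

lemma coeff_matrix_shift: "coeff_matrix (Suc d) ([:0, w:] *m A) = w *m coeff_matrix d A"
  by (simp add: coeff_matrix_def vec_eq_iff)

lemma coeff_matrix_const_right:
  "coeff_matrix d (A ** map_matrix (\<lambda>c. [:c:]) B) = coeff_matrix d A ** B"
  by (simp add: coeff_matrix_def vec_eq_iff matrix_matrix_mult_def coeff_sum mult.commute)

lemma coeff_matrix_const_left:
  "coeff_matrix d (map_matrix (\<lambda>c. [:c:]) B ** A) = B ** coeff_matrix d A"
  by (simp add: coeff_matrix_def vec_eq_iff matrix_matrix_mult_def coeff_sum)

text \<open>The vanishing of the next coefficient is what removes the correction: in degree
  \<open>Suc d\<close> it multiplies exactly that coefficient.\<close>

lemma leading_coeff_matrix:
  assumes "Y \<noteq> 0"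
  obtains d where "coeff_matrix d Y \<noteq> 0" "coeff_matrix (Suc d) Y = 0"
proof -
  let ?S = "{d. coeff_matrix d Y \<noteq> 0}"
  have "?S \<subseteq> (\<Union>i. \<Union>j. {..degree (Y $ i $ j)})"
    by (auto simp: coeff_matrix_def vec_eq_iff intro: le_degree)
  then have fin: "finite ?S"
    by (rule finite_subset) auto
  obtain i j where "Y $ i $ j \<noteq> 0"
    using assms by (auto simp: vec_eq_iff)
  then have "coeff_matrix (degree (Y $ i $ j)) Y $ i $ j \<noteq> 0"
    by (simp add: coeff_matrix_def)
  then have "coeff_matrix (degree (Y $ i $ j)) Y \<noteq> 0"
    by (metis zero_index)
  then have ne: "?S \<noteq> {}"
    by blast
  show thesis
  proof (rule that)
    show "coeff_matrix (Max ?S) Y \<noteq> 0"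
      using Max_in [OF fin ne] by simp
    show "coeff_matrix (Suc (Max ?S)) Y = 0"
      using Max_ge [OF fin, of "Suc (Max ?S)"] by auto
  qed
qed

lemma kron_mat_one_inject:
  fixes A B :: "'a::semiring_1 ^ 'n::finite ^ 'n"
  assumes "kron (mat 1 :: 'a ^ 'p::finite ^ 'p) A = kron (mat 1) B"
  shows "A = B"
proof -
  fix l :: 'p
  have "A $ i $ j = B $ i $ j" for i j
    using arg_cong [OF assms, of "\<lambda>M. M $ (l, i) $ (l, j)"] by (simp add: mat_def)
  then show ?thesis
    by (simp add: vec_eq_iff)
qed

locale e7_rep_field = e7_rep_extension br \<rho> m k X e f h W P \<kappa> + scalar_extension \<kappa>
  for br :: "complex ^ 'g \<Rightarrow> complex ^ 'g \<Rightarrow> complex ^ 'g"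
    and \<rho> :: "complex ^ 'g \<Rightarrow> complex ^ 'n ^ 'n"
    and m k X e f h W P
    and \<kappa> :: "complex \<Rightarrow> 'b::field"
begin

lemma two_nonzero: "(2 :: 'b) \<noteq> 0"
proof
  assume "(2 :: 'b) = 0"
  then have "\<kappa> (2 * (1 / 2)) = 0"
    by (simp only: hom_mult hom_numeral mult_zero_left)
  then show False
    by (simp add: hom_one)
qed

text \<open>The factors are peeled off one at a time, each leaving a smaller matrix that commutes
  with the action on the remaining ones.\<close>

lemma commutant_legs:
  assumes "\<And>x. M ** K (leg1 (\<rho> x)) = K (leg1 (\<rho> x)) ** M"
    and "\<And>x. M ** K (leg2 (\<rho> x)) = K (leg2 (\<rho> x)) ** M"
    and "\<And>x. M ** K (leg3 (\<rho> x)) = K (leg3 (\<rho> x)) ** M"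
  obtains c where "M = mat c"
proof -
  obtain M' where M': "M = kron (mat 1) M'"
    using commutant_kron_left [OF irreducible_rep assms(1) [unfolded map_matrix_legs, unfolded leg1_def]] .
  have "kron (mat 1 :: 'b ^ 'n ^ 'n) (M' ** kron (K (\<rho> x)) (mat 1))
      = kron (mat 1) (kron (K (\<rho> x)) (mat 1) ** M')" for x
    using assms(2) [of x, unfolded map_matrix_legs, unfolded leg2_def M'] by (simp add: kron_mult)
  then have "M' ** kron (K (\<rho> x)) (mat 1) = kron (K (\<rho> x)) (mat 1) ** M'" for x
    by (rule kron_mat_one_inject)
  then obtain M'' where M'': "M' = kron (mat 1) M''"
    using commutant_kron_left [OF irreducible_rep, of M'] by metis
  have "kron (mat 1 :: 'b ^ 'n ^ 'n) (kron (mat 1 :: 'b ^ 'n ^ 'n) (M'' ** K (\<rho> x)))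
      = kron (mat 1) (kron (mat 1) (K (\<rho> x) ** M''))" for x
    using assms(3) [of x, unfolded map_matrix_legs, unfolded leg3_def M' M''] by (simp add: kron_mult)
  then have "M'' ** K (\<rho> x) = K (\<rho> x) ** M''" for x
    by (intro kron_mat_one_inject [of "M'' ** K (\<rho> x)"] kron_mat_one_inject [of "kron (mat 1) (M'' ** K (\<rho> x))"])
  then obtain c where "M'' = mat c"
    using schur_scalar_extension [OF irreducible_rep, of M''] by metis
  then have "M = mat c"
    by (simp add: M' M'' vec_eq_iff mat_def)
  then show thesis using that by blast
qed

text \<open>Commutators of the generators \<open>a x\<close> give \<open>w1\<^sup>2 [x, y]\<^sub>1 + w2\<^sup>2 [x, y]\<^sub>2\<close>, so for distinct nonzero
  weights the generators of the first two factors can be separated.\<close>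

lemma commutant_weighted:
  assumes w: "w1 \<noteq> 0" "w2 \<noteq> 0" "w1 \<noteq> w2"
    and a: "\<And>x. M ** (w1 *m K (leg1 (\<rho> x)) + w2 *m K (leg2 (\<rho> x)))
        = (w1 *m K (leg1 (\<rho> x)) + w2 *m K (leg2 (\<rho> x))) ** M"
    and total: "\<And>x. M ** K (total x) = K (total x) ** M"
  obtains c where "M = mat c"
proof -
  let ?a = "\<lambda>x. w1 *m K (leg1 (\<rho> x)) + w2 *m K (leg2 (\<rho> x))"
  \<comment> \<open>Subtracting w2 times the generator for \<open>br x y\<close> cancels the second
    factor and leaves w1 (w1 - w2) on the first.\<close>
  have commutator: "?a x ** ?a y - ?a y ** ?a x - w2 *m ?a (br x y) = (w1 * (w1 - w2)) *m K (leg1 (\<rho> (br x y)))" for x y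
  proof -
    have "K (leg1 (\<rho> x)) ** K (leg2 (\<rho> y)) = K (leg2 (\<rho> y)) ** K (leg1 (\<rho> x))" for x y
      by (simp only: map_matrix_mult [symmetric] legs_mult)
    moreover have "K (leg1 (\<rho> (br x y))) = K (leg1 (\<rho> x)) ** K (leg1 (\<rho> y)) - K (leg1 (\<rho> y)) ** K (leg1 (\<rho> x))"
      "K (leg2 (\<rho> (br x y))) = K (leg2 (\<rho> x)) ** K (leg2 (\<rho> y)) - K (leg2 (\<rho> y)) ** K (leg2 (\<rho> x))"
      by (simp_all only: rep_br legs_diff legs_mult(1,2) map_matrix_diff map_matrix_mult)
    ultimately show ?thesis
      by (simp add: matrix_ring_simps) (simp add: vec_eq_iff algebra_simps)
  qed
  have leg1: "M ** K (leg1 (\<rho> x)) = K (leg1 (\<rho> x)) ** M" for x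
  proof (induction x rule: perfect_induct)
    case (bracket x y)
    have "M ** (?a x ** ?a y) = ?a x ** ?a y ** M" for x y
      by (rule matrix_intertwine_mult [OF a a])
    then have "M ** (?a x ** ?a y - ?a y ** ?a x - w2 *m ?a (br x y))
        = (?a x ** ?a y - ?a y ** ?a x - w2 *m ?a (br x y)) ** M"
      using a [of "br x y"]
      by (simp only: matrix_diff_ldistrib matrix_diff_rdistrib scm_mult_left scm_mult_right)
    then have "(w1 * (w1 - w2)) *m (M ** K (leg1 (\<rho> (br x y)))) = (w1 * (w1 - w2)) *m (K (leg1 (\<rho> (br x y))) ** M)"
      unfolding commutator unfolding scm_mult_left scm_mult_right .
    then show ?case
      by (rule scm_cancel) (use w in simp)
  next
    case subspace
    have "leg1 (\<rho> (x + y)) = leg1 (\<rho> x) + leg1 (\<rho> y)" "leg1 (\<rho> (c *s x)) = c *m leg1 (\<rho> x)" "leg1 (\<rho> 0) = 0" for x y c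
      by (simp_all add: leg1_def rep_add rep_scale kron_add_left kron_scm_left)
    then show ?case
      by (simp add: vec.subspace_def map_matrix_add map_matrix_scm map_matrix_zero matrix_ring_simps)
  qed
  have leg2: "M ** K (leg2 (\<rho> x)) = K (leg2 (\<rho> x)) ** M" for x
  proof -
    have "w2 *m (M ** K (leg2 (\<rho> x))) = w2 *m (K (leg2 (\<rho> x)) ** M)"
      using a [of x] by (simp add: matrix_ring_simps leg1)
    then show ?thesis
      using w(2) by (rule scm_cancel)
  qed
  have "M ** K (leg3 (\<rho> x)) = K (leg3 (\<rho> x)) ** M" for x
    using total [of x] by (simp add: total_def map_matrix_add matrix_ring_simps leg1 leg2)
  then show thesis
    using commutant_legs [of M] leg1 leg2 that by blast
qed

text \<open>The spectral parameters are scaled by an indeterminate \<open>s\<close>. The leading coefficient in \<open>s\<close> of the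
  defect of the Yang--Baxter equation is then, up to the reversal of the factors, a scalar; the adjoint
  changes its sign, so it vanishes.\<close>

lemma ybe_defect_eq_zero:
  assumes "u \<noteq> 0" "v \<noteq> 0" "u + v \<noteq> 0"
  shows "ybe_defect u v = 0"
proof -
  let ?\<kappa> = "\<lambda>c. [:\<kappa> c:]"
  \<comment> \<open>The same constructions over polynomials in s, where \<open>[:0, u:]\<close>
    stands for s u.\<close>
  interpret S: e7_rep_extension br \<rho> m k X e f h W P ?\<kappa>
    by unfold_locales (simp_all add: hom_add hom_mult hom_one one_pCons)
  define Y where "Y = S.ybe_defect [:0, u:] [:0, v:]"
  interpret C: ring_hom "\<lambda>c :: 'b. [:c:]"
    by unfold_locales (simp_all add: one_pCons)
  have const: "map_matrix ?\<kappa> A = map_matrix (\<lambda>c. [:c:]) (K A)" for A :: "complex ^ 'x::finite ^ 'y::finite"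
    by (simp add: vec_eq_iff)
  have "Y = 0"
  proof (rule ccontr)
    assume "Y \<noteq> 0"
    then obtain d where d: "coeff_matrix d Y \<noteq> 0" "coeff_matrix (Suc d) Y = 0"
      by (rule leading_coeff_matrix)
    let ?Z = "coeff_matrix d Y"
    \<comment> \<open>Coefficients of degree \<open>Suc d\<close> are compared: the parameters
      contribute one factor s, the correction none.\<close>
    have Z_current: "?Z ** ((u + v) *m K (leg1 (\<rho> x)) + u *m K (leg2 (\<rho> x)))
        = (u *m K (leg2 (\<rho> x)) + (u + v) *m K (leg3 (\<rho> x))) ** ?Z" for x
      using arg_cong [OF S.ybe_defect_current [of "[:0, u:]" "[:0, v:]" x], of "coeff_matrix (Suc d)"]
      unfolding Y_def [symmetric] S.current_def const
      by (simp add: matrix_add_ldistrib matrix_add_rdistrib coeff_matrix_add scm_mult_left scm_mult_right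
          coeff_matrix_shift coeff_matrix_const_left coeff_matrix_const_right d(2))
    have Z_total: "?Z ** K (total x) = K (total x) ** ?Z" for x
      using arg_cong [OF S.ybe_defect_total [of "[:0, u:]" "[:0, v:]" x], of "coeff_matrix d"]
      unfolding Y_def [symmetric] const
      by (simp add: coeff_matrix_const_left coeff_matrix_const_right S.total_def total_def)
    have rev: "map_matrix (\<lambda>c. [:c:]) tensor_rev = tensor_rev"
      by (simp add: vec_eq_iff tensor_rev_def)
    have Z_adjoint: "(tensor_rev ** K J3) ** transpose ?Z = - (?Z ** (tensor_rev ** K J3))"
    proof -
      have "tensor_rev ** map_matrix ?\<kappa> J3 = map_matrix (\<lambda>c. [:c:]) (tensor_rev ** K J3)"
        by (simp only: C.map_matrix_mult rev const)
      then show ?thesis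
        using arg_cong [OF S.ybe_defect_adjoint [of "[:0, u:]" "[:0, v:]"], of "coeff_matrix d"]
        unfolding Y_def [symmetric]
        by (simp only: coeff_matrix_const_left coeff_matrix_const_right coeff_matrix_minus coeff_matrix_transpose)
    qed
    define M where "M = tensor_rev ** ?Z"
    have Z: "?Z = tensor_rev ** M"
      by (simp add: M_def matrix_mul_assoc tensor_rev_idem)
    have M_weighted: "M ** ((u + v) *m K (leg1 (\<rho> x)) + u *m K (leg2 (\<rho> x)))
        = ((u + v) *m K (leg1 (\<rho> x)) + u *m K (leg2 (\<rho> x))) ** M" for x
    proof -
      have "M ** ((u + v) *m K (leg1 (\<rho> x)) + u *m K (leg2 (\<rho> x)))
          = tensor_rev ** (u *m K (leg2 (\<rho> x)) + (u + v) *m K (leg3 (\<rho> x))) ** ?Z"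
        by (simp add: M_def matrix_mul_assoc [symmetric] Z_current)
      also have "tensor_rev ** (u *m K (leg2 (\<rho> x)) + (u + v) *m K (leg3 (\<rho> x)))
          = ((u + v) *m K (leg1 (\<rho> x)) + u *m K (leg2 (\<rho> x))) ** tensor_rev"
        by (simp add: matrix_ring_simps map_matrix_legs tensor_rev_legs add.commute)
      finally show ?thesis
        by (simp add: M_def matrix_mul_assoc)
    qed
    have M_total: "M ** K (total x) = K (total x) ** M" for x
    proof -
      have "tensor_rev ** K (total x) = K (total x) ** tensor_rev"
        by (simp add: total_def map_matrix_add matrix_ring_simps map_matrix_legs tensor_rev_legs add_ac)
      then show ?thesis
        by (simp add: M_def matrix_mul_assoc [symmetric] Z_total) (simp add: matrix_mul_assoc)
    qed
    \<comment> \<open>The weights u + v and u must be distinct, and this is where v is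
      nonzero.\<close>
    have "u + v \<noteq> u"
      using assms(2) by simp
    then obtain c where c: "M = mat c"
      using commutant_weighted [OF assms(3,1) _ M_weighted M_total] by metis
    have comm: "K J3 ** tensor_rev = tensor_rev ** K J3"
      unfolding J3_def map_matrix_kron by (rule tensor_rev_kron [symmetric])
    have Zc: "?Z = c *m tensor_rev"
      by (simp add: Z c mult_mat_scm)
    have "(tensor_rev ** K J3) ** transpose ?Z = c *m (tensor_rev ** (K J3 ** tensor_rev))"
      by (simp add: Zc transpose_scm tensor_rev_transpose scm_mult_right matrix_mul_assoc)
    also have "\<dots> = c *m K J3"
      unfolding comm matrix_mul_assoc tensor_rev_idem by simp
    \<comment> \<open>Both sides of the adjoint relation become the same multiple of
      \<open>K J3\<close>, with opposite signs.\<close>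
    finally have left: "(tensor_rev ** K J3) ** transpose ?Z = c *m K J3" .
    have right: "?Z ** (tensor_rev ** K J3) = c *m K J3"
      unfolding Zc scm_mult_left matrix_mul_assoc tensor_rev_idem by simp
    have "c *m K J3 + c *m K J3 = 0"
      using Z_adjoint unfolding left right eq_neg_iff_add_eq_0 .
    then have "(c *m K J3 + c *m K J3) $ p $ q = 0" for p q
      by (simp only: zero_index)
    then have "2 * (c * (K J3 $ p $ q)) = 0" for p q
      by (simp only: mult_2 vector_add_component scm_nth)
    then have zero: "c * (K J3 $ p $ q) = 0" for p q
      using two_nonzero by simp
    have "\<exists>p q. J3 $ p $ q \<noteq> 0"
      using J3_nonzero by (simp add: vec_eq_iff) 
    then obtain p q where "J3 $ p $ q \<noteq> 0" by blast
    then have "\<kappa> (J3 $ p $ q) \<noteq> 0"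
      by (metis hom_mult hom_one mult_zero_left right_inverse zero_neq_one)
    with zero [of p q] have "c = 0" by simp
    with d(1) show False
      by (simp add: Z c)
  qed
  moreover
  interpret eval: ring_hom "\<lambda>p :: 'b poly. poly p 1"
    by unfold_locales simp_all
  \<comment> \<open>Setting s = 1 recovers the original defect from Y.\<close>
  have eval_R: "map_matrix (\<lambda>p. poly p 1) (S.cleared_R [:0, z:]) = cleared_R z" for z
  proof -
    have "poly (cleared m i [:0, z:]) 1 = cleared m i z" for i
      by (simp add: cleared_def eval.hom_of_nat)
    moreover have "map_matrix (\<lambda>p. poly p 1) (map_matrix ?\<kappa> (P i)) = K (P i)" for i
      by (simp add: vec_eq_iff)
    ultimately show ?thesis
      by (simp only: S.cleared_R_def cleared_R_def eval.map_matrix_sum eval.map_matrix_scm)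
  qed
  have "map_matrix (\<lambda>p. poly p 1) Y = ybe_defect u v"
    by (simp add: Y_def S.ybe_defect_def ybe_defect_def eval.map_matrix_diff eval.map_matrix_mult
        eval.map_matrix_tensor_one eval.map_matrix_one_tensor eval_R)
  ultimately show ?thesis
    by (simp add: eval.map_matrix_zero)
qed

end


section \<open>Rational functions\<close>

lemma ring_hom_const_rf: "ring_hom const_rf"
  by unfold_locales (simp_all add: const_rf_def One_fract_def one_pCons)

lemma of_nat_minus_Fract_nonzero: "p \<noteq> [:of_nat c:] \<Longrightarrow> of_nat c - (Fract p 1 :: ratfun) \<noteq> 0"
  by (simp add: Fract_of_nat_eq [symmetric] Zero_fract_def eq_fract of_nat_poly)

lemma R_check_eq_cleared:
  assumes "\<And>c. of_nat c - x \<noteq> (0 :: ratfun)"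
  shows "cleared m 1 x \<noteq> 0"
    and "R_check m P x = inverse (cleared m 1 x) *m (\<Sum>i\<in>{1..4}. cleared m i x *m map_matrix const_rf (P i))"
proof -
  have n: "2 - x \<noteq> 0" "of_nat m + 2 - x \<noteq> 0" "2 * of_nat m + 2 - x \<noteq> 0"
    using assms [of 2] assms [of "m + 2"] assms [of "2 * m + 2"] by (simp_all add: add.commute)
  then show "cleared m 1 x \<noteq> 0"
    by (simp add: cleared_def)
  let ?a = "(2 + x) / (2 - x)" and ?b = "(of_nat m + 2 + x) / (of_nat m + 2 - x)"
  let ?c = "(2 * of_nat m + 2 + x) / (2 * of_nat m + 2 - x)"
  have 1: "inverse (cleared m 1 x) * cleared m 1 x = 1"
    using \<open>cleared m 1 x \<noteq> 0\<close> by simp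
  have 2: "inverse (cleared m 1 x) * cleared m 2 x = ?a"
    using n by (simp add: cleared_def divide_simps)
  have 3: "inverse (cleared m 1 x) * cleared m 3 x = ?a * ?b"
    using n by (simp add: cleared_def divide_simps)
  have 4: "inverse (cleared m 1 x) * cleared m 4 x = ?a * ?b * ?c"
    using n by (simp add: cleared_def divide_simps)
  have "R_check m P x = (inverse (cleared m 1 x) * cleared m 1 x) *m map_matrix const_rf (P 1)
      + (inverse (cleared m 1 x) * cleared m 2 x) *m map_matrix const_rf (P 2)
      + (inverse (cleared m 1 x) * cleared m 3 x) *m map_matrix const_rf (P 3)
      + (inverse (cleared m 1 x) * cleared m 4 x) *m map_matrix const_rf (P 4)"
    unfolding 1 2 3 4 R_check_def Let_def mat_mult_scm scm_one ..
  then show "R_check m P x = inverse (cleared m 1 x) *m (\<Sum>i\<in>{1..4}. cleared m i x *m map_matrix const_rf (P i))"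
    by (simp only: sum_1_4 scm_add scm_scm)
qed

theorem theorem5p8:
  fixes m k :: nat and X :: lie_type
    and br :: "complex ^ 'g \<Rightarrow> complex ^ 'g \<Rightarrow> complex ^ 'g"
    and e f h :: "nat \<Rightarrow> complex ^ 'g"
    and \<rho> :: "complex ^ 'g \<Rightarrow> complex ^ 'n ^ 'n"
    and W :: "nat \<Rightarrow> (complex ^ ('n \<times> 'n)) set"
    and P :: "nat \<Rightarrow> complex ^ ('n \<times> 'n) ^ ('n \<times> 'n)"
  assumes "e7_series_module m X k br e f h \<rho>"
    and "e7_decomposition X k br e h \<rho> W"
    and "\<And>i. i \<in> {1..4} \<Longrightarrow> equivariant_projector (tensor_square \<rho>) (W i) (P i)"
  shows "tensor_one (R_check m P u_rf) ** one_tensor (R_check m P (u_rf + v_rf)) **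
           tensor_one (R_check m P v_rf) =
         one_tensor (R_check m P v_rf) ** tensor_one (R_check m P (u_rf + v_rf)) **
           one_tensor (R_check m P u_rf)"
proof -
  interpret ring_hom const_rf
    by (rule ring_hom_const_rf)
  interpret e7_rep_field br \<rho> m k X e f h W P const_rf
    using assms by unfold_locales (auto simp: e7_series_module_def)
  have uv: "u_rf + v_rf = Fract [:[:0, 1:], 1:] 1"
    by (simp add: u_rf_def v_rf_def)
  have nz: "u_rf \<noteq> 0" "v_rf \<noteq> 0" "u_rf + v_rf \<noteq> 0"
    unfolding uv by (simp_all add: u_rf_def v_rf_def Zero_fract_def eq_fract)
  have n: "of_nat c - u_rf \<noteq> 0" "of_nat c - v_rf \<noteq> 0" "of_nat c - (u_rf + v_rf) \<noteq> 0" for c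
    unfolding uv unfolding u_rf_def v_rf_def by (rule of_nat_minus_Fract_nonzero, simp add: of_nat_poly)+
  have R: "R_check m P x = inverse (cleared m 1 x) *m cleared_R x" if "\<And>c. of_nat c - x \<noteq> 0" for x
    unfolding cleared_R_def using that by (rule R_check_eq_cleared(2))
  \<comment> \<open>Both sides of the equation carry the same three scalar denominators, so the
    cleared identity is enough.\<close>
  have "R12 u_rf ** R23 (u_rf + v_rf) ** R12 v_rf = R23 v_rf ** R12 (u_rf + v_rf) ** R23 u_rf"
    using ybe_defect_eq_zero [OF nz] by (simp add: ybe_defect_def)
  then show ?thesis
    unfolding R [OF n(1)] R [OF n(2)] R [OF n(3)]
    by (simp add: tensor_one_scm one_tensor_scm scm_mult_left scm_mult_right scm_scm mult_ac)
qed

end
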